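(* Let $\Gamma$ be a finite directed rooted binary tree with $n_\Gamma$ edges and root edge $r$, let $K_e,H_e,a_e>0$ for $e\in\Gamma$, and let $\lambda>0$. Consider the process $\boldsymbol X=[\boldsymbol Q;\boldsymbol R]$ with spatially uniform rainfall described in the context, with i.i.d. rainfall depths $P_n$ having a probability density $f_P$ on $(0,\infty)$ and $\mathbb E[\max(\log P_1,0)]<\infty$, so that $\boldsymbol X$ has a unique invariant distribution $g$. For $n\ge1$ let $M^{(n)}_{Q_r}=\mathbb E_g[Q_r^n]$ be the $n$-th moment of $Q_r$ under the invariant distribution and $M^{(n)}_P=\mathbb E[P_1^n]$. Then for every $n\ge 1$ (as an identity in $[0,\infty]$), $$M^{(n)}_{Q_r}=(aK_r)^n\sum_{k=1}^n\left(\frac{\lambda}{H_r}\right)^kB_{n,k}\Big(\big\{M^{(i)}_P\,c_i\big\}_{i=1}^{n-k+1}\Big),$$ where $a=\sum_{e\in\Gamma}a_e$, the coefficients $c_\alpha$ are $$c_\alpha=\int_0^1\frac{1}{u}\left[\sum_{e\in\Gamma}\frac{H_e}{K_r}\,\frac{a_e}{a}\,(\boldsymbol m_r(u))_e\right]^{\alpha}\mathrm du,\qquad \alpha>0,$$ and $B_{n,k}$ are the partial Bell polynomials $$B_{n,k}(\{x_i\}_{i=1}^{n-k+1})=n!\sum_{\boldsymbol j}\prod_{i=1}^{n-k+1}\frac{1}{j_i!}\left(\frac{x_i}{i!}\right)^{j_i},$$ the sum being over all vectors $\boldsymbol j=(j_1,\dots,j_{n-k+1})$ of nonnegative integers with $\sum_i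 j_i=k$ and $\sum_i i\,j_i=n$.
   Context: $\Gamma$ is a finite rooted binary tree modelling a river network: its $n_\Gamma$ edges are called links, $r$ is the root (most downstream) link, and each link $e$ either has two tributaries (the two links immediately upstream of it) or none. Vectors indexed by $\Gamma$ list the root first. The incidence matrix $\boldsymbol\Lambda_\Gamma\in\mathbb R^{n_\Gamma\times n_\Gamma}$ has $(\boldsymbol\Lambda_\Gamma)_{e,e}=1$ for all $e$, $(\boldsymbol\Lambda_\Gamma)_{e,e'}=-1$ if $e'$ is a tributary of $e$, and all other entries zero. Put $\mathbf K=\mathrm{diag}(K_e:e\in\Gamma)$, $\mathbf H=\mathrm{diag}(H_e:e\in\Gamma)$, $\boldsymbol a=[a_e:e\in\Gamma]^{\intercal}$, and $$\mathbf M=\begin{bmatrix}-\mathbf K\boldsymbol\Lambda_\Gamma&\mathbf K\\ \mathbf O&-\mathbf H\end{bmatrix}\in\mathbb R^{2n_\Gamma\times 2n_\Gamma}.$$ Let $N$ be a Poisson process with rate $\lambda$ and jump times $T_1<T_2<\cdots$, and let $P_n$, $n\ge1$, be i.i.d. positive random variables with density $f_P$, independent of $N$ (spatially uniform rainfall: every link receives the same depth $P_n$ at time $T_n$). The process $\boldsymbol X$ solves $\mathrm d\boldsymbol X=\mathbf M\boldsymbol X\,\mathrm dt+\mathrm d\boldsymbol Y$ with $\boldsymbol Y(t)=\sum_{n=1}^{N(t)}\begin{bmatrix}\boldsymbol 0\\ \mathbf H\boldsymbol a\,P_n\end{bmatrix}$, i.e. $$\boldsymbol X(t)=\begin{bmatrix}\boldsymbol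 Q(t)\\ \boldsymbol R(t)\end{bmatrix}=e^{\mathbf Mt}\boldsymbol X(0)+\sum_{n=1}^{N(t)}e^{\mathbf M(t-T_n)}\begin{bmatrix}\boldsymbol 0\\ \mathbf H\boldsymbol a\,P_n\end{bmatrix},$$ with $\boldsymbol Q=[Q_e:e\in\Gamma]^{\intercal}$, $\boldsymbol R=[R_e:e\in\Gamma]^{\intercal}$ and state space $(0,\infty)^{2n_\Gamma}$. A probability distribution is invariant for $\boldsymbol X$ if $\boldsymbol X(t)$ has that distribution for all $t>0$ whenever $\boldsymbol X(0)$ does (with $\boldsymbol X(0)$ independent of $\boldsymbol Y$); $\mathbb P_g,\mathbb E_g$ denote probability and expectation under the invariant distribution $g$. For $u\in(0,1]$, $u^{-\mathbf M^{\intercal}/H_r}:=\exp\big(-\tfrac{\log u}{H_r}\mathbf M^{\intercal}\big)$, and $\boldsymbol m_r(u)\in\mathbb R^{n_\Gamma}$ consists of the last $n_\Gamma$ entries of its first column (the column corresponding to $Q_r$). In the Bell polynomials, factors with $j_i=0$ equal $1$. *)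

theory Defs
  imports "HOL-Probability.Probability"
begin

text \<open>
  The tree is encoded on its set of links, the finite type \<open>'e\<close>, by the set of tributaries of
  each link: every link other than the root has exactly one downstream link, every link is upstream
  of (or equal to) the root, and a link has two tributaries or none.
\<close>

definition river_tree :: "'e::finite \<Rightarrow> ('e \<Rightarrow> 'e set) \<Rightarrow> bool" where
  "river_tree r trib \<longleftrightarrow>
     (\<forall>e. trib e = {} \<or> card (trib e) = 2) \<and>
     (\<forall>e. r \<notin> trib e) \<and>
     (\<forall>e'. e' \<noteq> r \<longrightarrow> (\<exists>!e. e' \<in> trib e)) \<and>
     (\<forall>e. (r, e) \<in> {(d, u). u \<in> trib d}\<^sup>*)"

definition incidence_matrix :: "('e::finite \<Rightarrow> 'e set) \<Rightarrow> real^'e^'e" where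
  "incidence_matrix trib =
     (\<chi> e e'. if e' = e then 1 else if e' \<in> trib e then -1 else 0)"

definition diag_matrix :: "('e::finite \<Rightarrow> real) \<Rightarrow> real^'e^'e" where
  "diag_matrix d = (\<chi> e e'. if e' = e then d e else 0)"

text \<open>
  Vectors of length \<open>2n\<close> are indexed by \<open>'e + 'e\<close>: \<open>Inl e\<close> is the coordinate \<open>Q\<^sub>e\<close> and
  \<open>Inr e\<close> the coordinate \<open>R\<^sub>e\<close>.
\<close>

definition block_matrix ::
  "real^'e^'e \<Rightarrow> real^'e^'e \<Rightarrow> real^'e^'e \<Rightarrow> real^'e^'e \<Rightarrow> real^('e::finite + 'e)^('e + 'e)" where
  "block_matrix A B C D =
     (\<chi> i j. case i of
         Inl e \<Rightarrow> (case j of Inl e' \<Rightarrow> A $ e $ e' | Inr e' \<Rightarrow> B $ e $ e')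
       | Inr e \<Rightarrow> (case j of Inl e' \<Rightarrow> C $ e $ e' | Inr e' \<Rightarrow> D $ e $ e'))"

definition block_vector :: "real^'e \<Rightarrow> real^'e \<Rightarrow> real^('e::finite + 'e)" where
  "block_vector x y = (\<chi> i. case i of Inl e \<Rightarrow> x $ e | Inr e \<Rightarrow> y $ e)"

definition system_matrix ::
  "('e::finite \<Rightarrow> 'e set) \<Rightarrow> ('e \<Rightarrow> real) \<Rightarrow> ('e \<Rightarrow> real) \<Rightarrow> real^('e + 'e)^('e + 'e)" where
  "system_matrix trib K H =
     block_matrix (- (diag_matrix K ** incidence_matrix trib)) (diag_matrix K)
                  0 (- diag_matrix H)"

definition input_vector :: "('e::finite \<Rightarrow> real) \<Rightarrow> ('e \<Rightarrow> real) \<Rightarrow> real^('e + 'e)" where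
  "input_vector H a = block_vector 0 (diag_matrix H *v (\<chi> e. a e))"

text \<open>
  The type \<open>real^'n^'n\<close> has the entrywise product as its multiplication, so neither \<open>(^)\<close>
  nor \<open>exp\<close> refer to the matrix product; the exponential series is therefore written out. It is
  summed in the (complete) normed space \<open>real^'n^'n\<close>, where it always converges.
\<close>

primrec matrix_power :: "real^'n^'n \<Rightarrow> nat \<Rightarrow> real^'n::finite^'n" where
  "matrix_power A 0 = mat 1"
| "matrix_power A (Suc k) = A ** matrix_power A k"

definition matrix_exp :: "real^'n^'n \<Rightarrow> real^'n::finite^'n" where
  "matrix_exp A = (\<Sum>k. (1 / fact k) *\<^sub>R matrix_power A k)"

definition poisson_process :: "'w measure \<Rightarrow> real \<Rightarrow> (real \<Rightarrow> 'w \<Rightarrow> nat) \<Rightarrow> bool" where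
  "poisson_process \<Omega> lam N \<longleftrightarrow>
     prob_space \<Omega> \<and>
     (\<forall>t\<ge>0. N t \<in> measurable \<Omega> (count_space UNIV)) \<and>
     (\<forall>\<omega>\<in>space \<Omega>. N 0 \<omega> = 0 \<and>
        (\<forall>s t. 0 \<le> s \<and> s \<le> t \<longrightarrow> N s \<omega> \<le> N t \<omega>) \<and>
        (\<forall>t\<ge>0. continuous (at_right t) (\<lambda>s. N s \<omega>))) \<and>
     (\<forall>(\<tau>::nat \<Rightarrow> real) m. 0 \<le> \<tau> 0 \<and> mono \<tau> \<longrightarrow>
        prob_space.indep_vars \<Omega> (\<lambda>_. count_space UNIV)
          (\<lambda>i \<omega>. N (\<tau> (Suc i)) \<omega> - N (\<tau> i) \<omega>) {..<m}) \<and>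
     (\<forall>s t. 0 \<le> s \<and> s < t \<longrightarrow>
        distr \<Omega> (count_space UNIV) (\<lambda>\<omega>. N t \<omega> - N s \<omega>) =
          measure_pmf (poisson_pmf (lam * (t - s))))"

definition sigma_generated ::
  "'w measure \<Rightarrow> 'i set \<Rightarrow> ('i \<Rightarrow> 'w \<Rightarrow> 'b) \<Rightarrow> 'b measure \<Rightarrow> 'w set set" where
  "sigma_generated \<Omega> I X M =
     sets (vimage_algebra (space \<Omega>) (\<lambda>\<omega>. \<lambda>i\<in>I. X i \<omega>) (\<Pi>\<^sub>M i\<in>I. M))"

text \<open>The value is only used for \<open>n \<ge> 1\<close> on paths that reach the level \<open>n\<close>.\<close>

definition jump_time :: "(real \<Rightarrow> 'w \<Rightarrow> nat) \<Rightarrow> nat \<Rightarrow> 'w \<Rightarrow> real" where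
  "jump_time N n \<omega> = Inf {t. 0 \<le> t \<and> n \<le> N t \<omega>}"

definition shot_noise_process ::
  "real^'n^'n \<Rightarrow> real^'n \<Rightarrow> (real \<Rightarrow> 'w \<Rightarrow> nat) \<Rightarrow> (nat \<Rightarrow> 'w \<Rightarrow> real) \<Rightarrow>
   real^'n \<Rightarrow> real \<Rightarrow> 'w \<Rightarrow> real^'n::finite" where
  "shot_noise_process A v N P x t \<omega> =
     matrix_exp (t *\<^sub>R A) *v x +
     (\<Sum>n = 1..N t \<omega>. matrix_exp ((t - jump_time N n \<omega>) *\<^sub>R A) *v (P n \<omega> *\<^sub>R v))"

definition network_process ::
  "('e::finite \<Rightarrow> 'e set) \<Rightarrow> ('e \<Rightarrow> real) \<Rightarrow> ('e \<Rightarrow> real) \<Rightarrow> ('e \<Rightarrow> real) \<Rightarrow>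
   (real \<Rightarrow> 'w \<Rightarrow> nat) \<Rightarrow> (nat \<Rightarrow> 'w \<Rightarrow> real) \<Rightarrow>
   real^('e + 'e) \<Rightarrow> real \<Rightarrow> 'w \<Rightarrow> real^('e + 'e)" where
  "network_process trib K H a N P = shot_noise_process (system_matrix trib K H) (input_vector H a) N P"

text \<open>
  \<open>X x t \<omega>\<close> is the state at time \<open>t\<close> of the process started at \<open>x\<close>. The product with \<open>g\<close>
  realises an initial state of law \<open>g\<close> that is independent of the driving noise on \<open>\<Omega>\<close>.
\<close>

definition invariant_distribution ::
  "'w measure \<Rightarrow> ('s::topological_space \<Rightarrow> real \<Rightarrow> 'w \<Rightarrow> 's) \<Rightarrow> 's set \<Rightarrow> 's measure \<Rightarrow> bool" where
  "invariant_distribution \<Omega> X S g \<longleftrightarrow>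
     prob_space g \<and> sets g = sets borel \<and> emeasure g S = 1 \<and>
     (\<forall>t>0. distr (g \<Otimes>\<^sub>M \<Omega>) borel (\<lambda>(x, \<omega>). X x t \<omega>) = g)"

definition positive_orthant :: "(real^'n::finite) set" where
  "positive_orthant = {x. \<forall>i. 0 < x $ i}"

definition m_root ::
  "'e \<Rightarrow> ('e::finite \<Rightarrow> 'e set) \<Rightarrow> ('e \<Rightarrow> real) \<Rightarrow> ('e \<Rightarrow> real) \<Rightarrow> real \<Rightarrow> real^'e" where
  "m_root r trib K H u =
     (\<chi> e. column (Inl r)
        (matrix_exp (- (ln u / H r) *\<^sub>R transpose (system_matrix trib K H))) $ Inr e)"

definition c_coeff ::
  "'e \<Rightarrow> ('e::finite \<Rightarrow> 'e set) \<Rightarrow> ('e \<Rightarrow> real) \<Rightarrow> ('e \<Rightarrow> real) \<Rightarrow> ('e \<Rightarrow> real) \<Rightarrow>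
   real \<Rightarrow> ennreal" where
  "c_coeff r trib K H a \<alpha> =
     (\<integral>\<^sup>+u\<in>{0<..1}. ennreal (1 / u *
        (\<Sum>e\<in>UNIV. H e / K r * (a e / (\<Sum>e'\<in>UNIV. a e')) * m_root r trib K H u $ e) powr \<alpha>)
      \<partial>lborel)"

text \<open>
  Partial Bell polynomials with arguments in \<open>[0,\<infinity>]\<close>. The index set of \<open>j\<close> is finite, since
  \<open>\<Sum>i. j i = k\<close> bounds every entry. A factor with \<open>j i = 0\<close> is 1 also for \<open>x i = \<infinity>\<close>,
  as \<open>y ^ 0 = 1\<close>.
\<close>

definition bell_poly :: "nat \<Rightarrow> nat \<Rightarrow> (nat \<Rightarrow> ennreal) \<Rightarrow> ennreal" where
  "bell_poly n k x =
     of_nat (fact n) *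
     (\<Sum>j | j \<in> {1..n - k + 1} \<rightarrow>\<^sub>E (UNIV :: nat set) \<and>
            (\<Sum>i = 1..n - k + 1. j i) = k \<and> (\<Sum>i = 1..n - k + 1. i * j i) = n.
        \<Prod>i = 1..n - k + 1. 1 / of_nat (fact (j i)) * (x i / of_nat (fact i)) ^ j i)"

end

theory Submission
  imports Defs "HOL-Real_Asymp.Real_Asymp"
begin

text \<open>
  Writing \<open>h(s) = exp(sM) v\<close> for the response to a unit shot, the state at time \<open>t\<close> started from \<open>x\<close> is
  \<open>exp(tM) x\<close> plus a sum of terms \<open>h(t - T\<^sub>n) P\<^sub>n\<close>, all with nonnegative entries, so its law is determined by its
  Laplace transform on the nonnegative orthant. Conditioning on the jumps and approximating the jump times by a grid gives
  \<open>E exp(- \<theta> \<bullet> sum) = exp(- \<lambda> \<integral>\<^sub>0\<^sup>t G(\<theta> \<bullet> h(s)) ds)\<close> with \<open>G(q) = 1 - E exp(- q P\<^sub>1)\<close>. The matrix \<open>M\<close> has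
  nonnegative off-diagonal entries and a positive weight that decays along the flow, so \<open>h\<close> decays exponentially,
  and the log-moment makes the integral over the half-line converge. Its exponential is the only possible Laplace
  transform of an invariant law; it is attained by the law of the time-reversed sum of all \<open>h(T\<^sub>n) P\<^sub>n\<close>. Hence \<open>Q\<^sub>r\<close> is
  infinitely divisible with cumulants \<open>\<lambda> E(P\<^sub>1\<^sup>i) \<integral> h\<^sub>r(s)\<^sup>i ds\<close>, Bell polynomials turn cumulants into moments, and
  \<open>u = exp(- H\<^sub>r s)\<close> turns the integrals into the coefficients \<open>c\<^sub>i\<close>.
\<close>

section \<open>Laplace transforms on the nonnegative orthant\<close>

text \<open>Moments may be infinite, and this shapes the last part: a Laplace transform need not be
  differentiable at 0, and the logarithm that usually defines cumulants has no meaning for infinite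
  values. The argument therefore differentiates at q > 0 only and lets q decrease to 0 in the
  recursion M(n+1) = sum over k of (n choose k) \<kappa>(k+1) M(n-k), which has neither subtraction
  nor division and so survives in [0,\<infinity>]. The evolution of Q_r involves other coordinates,
  so the invariant law is identified on all of them, with a vector parameter \<theta>; only
  afterwards is \<theta> taken along one axis. Time is reversed because the forward sums do not
  converge pathwise: all arguments t - T_n move with t. The reversed sums only gain nonnegative
  terms, so they converge as soon as they stay bounded.\<close>

inductive exp_span :: "(real^'n::finite \<Rightarrow> real) \<Rightarrow> bool" where
  exp: "(\<forall>i. 0 \<le> \<theta> $ i) \<Longrightarrow> exp_span (\<lambda>x. exp (- (\<theta> \<bullet> x)))"
| add: "exp_span f \<Longrightarrow> exp_span g \<Longrightarrow> exp_span (\<lambda>x. f x + g x)"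
| scale: "exp_span f \<Longrightarrow> exp_span (\<lambda>x. c * f x)"

text \<open>Parameters add under multiplication and stay in the orthant. Closure under products is
  what lets the span absorb arbitrary polynomials in \<open>exp_neg x\<close>.\<close>

lemma exp_span_mult:
  assumes "exp_span f" "exp_span g"
  shows "exp_span (\<lambda>x. f x * g x)"
  using assms(1)
proof induction
  case (exp \<theta>)
  from assms(2) show ?case
  proof induction
    case (exp \<theta>')
    have "(\<lambda>x. exp (- (\<theta> \<bullet> x)) * exp (- (\<theta>' \<bullet> x))) = (\<lambda>x. exp (- ((\<theta> + \<theta>') \<bullet> x)))"
      by (simp add: inner_add_left exp_add[symmetric])
    then show ?case
      using exp_span.exp[of "\<theta> + \<theta>'"] exp \<open>\<forall>i. 0 \<le> \<theta> $ i\<close> by simp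
  next
    case (add f g)
    then show ?case using exp_span.add[OF add.IH] by (simp add: algebra_simps)
  next
    case (scale f c)
    then show ?case using exp_span.scale[OF scale.IH, of c] by (simp add: algebra_simps)
  qed
next
  case (add f h)
  then show ?case using exp_span.add[OF add.IH] by (simp add: algebra_simps)
next
  case (scale f c)
  then show ?case using exp_span.scale[OF scale.IH, of c] by (simp add: algebra_simps)
qed

lemma exp_span_const: "exp_span (\<lambda>x. c)"
  using exp_span.scale[OF exp_span.exp[of 0], of c] by simp

lemma exp_span_sum: "finite I \<Longrightarrow> (\<And>i. i \<in> I \<Longrightarrow> exp_span (f i)) \<Longrightarrow> exp_span (\<lambda>x. \<Sum>i\<in>I. f i x)"
  by (induction rule: finite_induct) (auto intro: exp_span.add exp_span_const)

text \<open>Change of variables that maps the closed orthant into the compact cube, where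
  polynomials are uniformly dense in the continuous functions.\<close>

definition exp_neg :: "real^'n \<Rightarrow> real^'n::finite" where
  "exp_neg x = (\<chi> i. exp (- (x $ i)))"

lemma exp_span_polynomial:
  assumes "real_polynomial_function p"
  shows "exp_span (\<lambda>x. p (exp_neg x))"
  using assms
proof induction
  case (linear f)
  interpret bounded_linear f by fact
  have coord: "exp_span (\<lambda>x. exp (- (x $ i)))" for i :: 'a
  proof -
    have "(\<lambda>x. exp (- (axis i 1 \<bullet> x))) = (\<lambda>x. exp (- (x $ i)))"
      by (simp add: inner_axis inner_commute)
    then show ?thesis using exp_span.exp[of "axis i 1"] by (simp add: axis_def)
  qed
  have "f (exp_neg x) = (\<Sum>i\<in>UNIV. f (axis i 1) * exp (- (x $ i)))" for x
  proof -
    have "exp_neg x = (\<Sum>i\<in>UNIV. exp (- (x $ i)) *\<^sub>R axis i 1)"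
      by (subst basis_expansion[symmetric]) (simp add: exp_neg_def scalar_mult_eq_scaleR)
    then have "f (exp_neg x) = (\<Sum>i\<in>UNIV. exp (- (x $ i)) *\<^sub>R f (axis i 1))"
      by (simp add: sum scaleR)
    then show ?thesis by (simp add: mult.commute)
  qed
  then show ?case
    by (simp add: exp_span_sum exp_span.scale coord)
qed (auto intro: exp_span_const exp_span.add exp_span_mult)

lemma continuous_on_exp_neg: "continuous_on S exp_neg"
  unfolding exp_neg_def by (intro continuous_intros)

lemma measurable_exp_neg [measurable]: "exp_neg \<in> borel_measurable borel"
  by (rule borel_measurable_continuous_onI) (rule continuous_on_exp_neg)

lemma exp_neg_in_cube: "(\<forall>i. 0 \<le> x $ i) \<Longrightarrow> exp_neg x \<in> cbox 0 1"
  by (simp add: mem_box_cart exp_neg_def)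

lemma exp_span_integral_eq:
  fixes \<mu> \<nu> :: "(real^'n::finite) measure"
  assumes "prob_space \<mu>" "sets \<mu> = sets borel" "AE x in \<mu>. \<forall>i. 0 \<le> x $ i"
    and "prob_space \<nu>" "sets \<nu> = sets borel" "AE x in \<nu>. \<forall>i. 0 \<le> x $ i"
    and eq: "\<And>\<theta>. (\<forall>i. 0 \<le> \<theta> $ i) \<Longrightarrow> (\<integral>x. exp (- (\<theta> \<bullet> x)) \<partial>\<mu>) = (\<integral>x. exp (- (\<theta> \<bullet> x)) \<partial>\<nu>)"
    and "exp_span f"
  shows "integrable \<mu> f \<and> integrable \<nu> f \<and> (\<integral>x. f x \<partial>\<mu>) = (\<integral>x. f x \<partial>\<nu>)"
  using \<open>exp_span f\<close>
proof induction
  case (exp \<theta>)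
  have *: "integrable M (\<lambda>x. exp (- (\<theta> \<bullet> x)))"
    if "prob_space M" "sets M = sets borel" "AE x in M. \<forall>i. 0 \<le> x $ i" for M :: "(real^'n) measure"
  proof -
    interpret prob_space M by fact
    note that(2)[measurable_cong]
    show ?thesis
    proof (rule integrable_const_bound[where B=1])
      show "AE x in M. norm (exp (- (\<theta> \<bullet> x))) \<le> 1"
        using that(3) by eventually_elim (auto simp: inner_vec_def intro!: sum_nonneg mult_nonneg_nonneg exp[rule_format])
    qed measurable
  qed
  show ?case using * assms eq[OF exp] by auto
qed auto

text \<open>Stone-Weierstrass on the cube: f is uniformly close to a polynomial p there, and p
  composed with \<open>exp_neg\<close> lies in the span of the exponentials, on which the two
  measures agree. Almost every x has \<open>exp_neg x\<close> in the cube, so closeness on the cube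
  is enough.\<close>

lemma orthant_integral_eq:
  fixes \<mu> \<nu> :: "(real^'n::finite) measure"
  assumes \<mu>: "prob_space \<mu>" "sets \<mu> = sets borel" "AE x in \<mu>. \<forall>i. 0 \<le> x $ i"
    and \<nu>: "prob_space \<nu>" "sets \<nu> = sets borel" "AE x in \<nu>. \<forall>i. 0 \<le> x $ i"
    and eq: "\<And>\<theta>. (\<forall>i. 0 \<le> \<theta> $ i) \<Longrightarrow> (\<integral>x. exp (- (\<theta> \<bullet> x)) \<partial>\<mu>) = (\<integral>x. exp (- (\<theta> \<bullet> x)) \<partial>\<nu>)"
    and f: "continuous_on UNIV f" "\<And>x. \<bar>f x\<bar> \<le> (B::real)"
  shows "(\<integral>x. f (exp_neg x) \<partial>\<mu>) = (\<integral>x. f (exp_neg x) \<partial>\<nu>)"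
proof -
  have fm [measurable]: "f \<in> borel_measurable borel"
    using f(1) by (rule borel_measurable_continuous_onI)
  have close: "\<bar>(\<integral>x. f (exp_neg x) \<partial>M) - (\<integral>x. p (exp_neg x) \<partial>M)\<bar> \<le> e"
    if M: "prob_space M" "sets M = sets borel" "AE x in M. \<forall>i. 0 \<le> x $ i"
      and p: "integrable M (\<lambda>x. p (exp_neg x))"
      and fp: "\<And>z. z \<in> cbox 0 1 \<Longrightarrow> \<bar>f z - p z\<bar> < e"
    for M :: "(real^'n) measure" and e p
  proof -
    interpret prob_space M by fact
    note M(2)[measurable_cong]
    have int: "integrable M (\<lambda>x. f (exp_neg x))"
      by (rule integrable_const_bound[where B=B]) (auto simp: f(2))
    have "\<bar>(\<integral>x. f (exp_neg x) \<partial>M) - (\<integral>x. p (exp_neg x) \<partial>M)\<bar> = \<bar>\<integral>x. f (exp_neg x) - p (exp_neg x) \<partial>M\<bar>"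
      using int p by simp
    also have "\<dots> \<le> (\<integral>x. \<bar>f (exp_neg x) - p (exp_neg x)\<bar> \<partial>M)"
      using integral_abs_bound by blast
    also have "\<dots> \<le> (\<integral>x. e \<partial>M)"
      using int p M(3)
      by (intro integral_mono_AE) (auto elim!: eventually_mono dest!: exp_neg_in_cube fp intro: less_imp_le)
    finally show ?thesis by (simp add: prob_space)
  qed
  have "\<bar>(\<integral>x. f (exp_neg x) \<partial>\<mu>) - (\<integral>x. f (exp_neg x) \<partial>\<nu>)\<bar> \<le> 0 + e" if "e > 0" for e
  proof -
    have "compact (cbox (0::real^'n) 1)" "continuous_on (cbox (0::real^'n) 1) f" "e / 2 > 0"
      using f(1) that by (auto intro: continuous_on_subset)
    then obtain p where p: "real_polynomial_function p" "\<And>z. z \<in> cbox 0 1 \<Longrightarrow> \<bar>f z - p z\<bar> < e / 2"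
      by (rule Stone_Weierstrass_real_polynomial_function) blast
    have i: "integrable \<mu> (\<lambda>x. p (exp_neg x)) \<and> integrable \<nu> (\<lambda>x. p (exp_neg x)) \<and>
        (\<integral>x. p (exp_neg x) \<partial>\<mu>) = (\<integral>x. p (exp_neg x) \<partial>\<nu>)"
      by (rule exp_span_integral_eq[OF \<mu> \<nu> eq exp_span_polynomial[OF p(1)]])
    have "\<bar>(\<integral>x. f (exp_neg x) \<partial>\<mu>) - (\<integral>x. p (exp_neg x) \<partial>\<mu>)\<bar> \<le> e / 2"
      "\<bar>(\<integral>x. f (exp_neg x) \<partial>\<nu>) - (\<integral>x. p (exp_neg x) \<partial>\<nu>)\<bar> \<le> e / 2"
      using close[OF \<mu>, of p "e / 2"] close[OF \<nu>, of p "e / 2"] i p(2) by blast+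
    then show ?thesis using i by linarith
  qed
  then show ?thesis using field_le_epsilon[of "\<bar>(\<integral>x. f (exp_neg x) \<partial>\<mu>) - (\<integral>x. f (exp_neg x) \<partial>\<nu>)\<bar>" 0] by simp
qed

text \<open>Closed sets are stable under intersection and generate the Borel sets, and the indicator
  of a nonempty closed C is the limit of the bounded continuous functions max 0 (1 - m dist(x,
  C)).\<close>

lemma prob_measure_eqI_continuous:
  fixes \<mu> \<nu> :: "'a::{metric_space} measure"
  assumes \<mu>: "prob_space \<mu>" "sets \<mu> = sets borel"
    and \<nu>: "prob_space \<nu>" "sets \<nu> = sets borel"
    and eq: "\<And>f B. continuous_on UNIV f \<Longrightarrow> (\<And>x. \<bar>f x\<bar> \<le> (B::real)) \<Longrightarrow> (\<integral>x. f x \<partial>\<mu>) = (\<integral>x. f x \<partial>\<nu>)"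
  shows "\<mu> = \<nu>"
proof (rule measure_eqI_generator_eq[of "Collect closed" UNIV \<mu> \<nu> "\<lambda>_. UNIV"])
  show "Int_stable (Collect (closed :: 'a set \<Rightarrow> bool))"
    by (auto simp: Int_stable_def)
  show "sets \<mu> = sigma_sets UNIV (Collect closed)" "sets \<nu> = sigma_sets UNIV (Collect closed)"
    using \<mu>(2) \<nu>(2) by (simp_all add: borel_eq_closed)
  show "emeasure \<mu> UNIV \<noteq> \<infinity>"
    using \<mu> by (metis prob_space.emeasure_space_1 sets_eq_imp_space_eq space_borel ennreal_one_neq_top infinity_ennreal_def)
  fix C :: "'a set" assume "C \<in> Collect closed"
  then have C: "closed C" by simp
  show "emeasure \<mu> C = emeasure \<nu> C"
  \<comment> \<open>\<open>infdist\<close> to the empty set is 0 by convention, so the functions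
    below would be constantly 1 for empty C.\<close>
  proof (cases "C = {}")
    case False
    define f where "f m x = max 0 (1 - real m * infdist x C)" for m x
    have cont: "continuous_on UNIV (f m)" for m
      unfolding f_def by (intro continuous_intros)
    have fb: "\<bar>f m x\<bar> \<le> 1" for m x
      by (auto simp: f_def infdist_nonneg)
    have lim: "(\<lambda>m. f m x) \<longlonglongrightarrow> indicat_real C x" for x
    proof (cases "x \<in> C")
      case True
      then show ?thesis using C False by (simp add: f_def)
    next
      case x: False
      then have pos: "infdist x C > 0"
        using C False in_closed_iff_infdist_zero[of C x] infdist_nonneg[of x C] by linarith
      then obtain m0 where "1 / infdist x C < real m0" using reals_Archimedean2 by blast
      then have "f m x = 0" if "m \<ge> m0" for m
      proof -
        have "1 < real m0 * infdist x C"
          using \<open>1 / infdist x C < real m0\<close> pos by (simp add: field_simps)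
        also have "\<dots> \<le> real m * infdist x C"
          using that pos by (intro mult_right_mono) auto
        finally show ?thesis by (simp add: f_def)
      qed
      then have "eventually (\<lambda>m. f m x = 0) sequentially"
        by (auto simp: eventually_sequentially)
      then show ?thesis using x by (auto intro: tendsto_eventually)
    qed
    have conv: "(\<lambda>m. \<integral>x. f m x \<partial>M) \<longlonglongrightarrow> measure M C"
      if M: "prob_space M" "sets M = sets borel" for M
    proof -
      interpret prob_space M by fact
      note M(2)[measurable_cong]
      have [measurable]: "f m \<in> borel_measurable borel" for m
        by (rule borel_measurable_continuous_onI) (rule cont)
      have [measurable]: "C \<in> sets borel" using C by auto
      have "(\<lambda>m. \<integral>x. f m x \<partial>M) \<longlonglongrightarrow> (\<integral>x. indicat_real C x \<partial>M)"
        using lim fb by (intro integral_dominated_convergence[where w="\<lambda>_. 1"]) auto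
      then show ?thesis using M(2) by (simp add: sets_eq_imp_space_eq[OF M(2)])
    qed
    have "measure \<mu> C = measure \<nu> C"
      using conv[OF \<mu>] conv[OF \<nu>] eq[OF cont fb] by (simp add: LIMSEQ_unique)
    then show ?thesis
      by (simp add: finite_measure.emeasure_eq_measure prob_space.finite_measure \<mu> \<nu>)
  qed simp
qed auto

text \<open>For the images under \<open>exp_neg\<close>, the test functions of
  \<open>orthant_integral_eq\<close> are arbitrary bounded continuous ones. The coordinatewise
  negative logarithm is a measurable left inverse and carries the equality back.\<close>

theorem prob_measure_eqI_laplace:
  fixes \<mu> \<nu> :: "(real^'n::finite) measure"
  assumes \<mu>: "prob_space \<mu>" "sets \<mu> = sets borel" "AE x in \<mu>. \<forall>i. 0 \<le> x $ i"
    and \<nu>: "prob_space \<nu>" "sets \<nu> = sets borel" "AE x in \<nu>. \<forall>i. 0 \<le> x $ i"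
    and eq: "\<And>\<theta>. (\<forall>i. 0 \<le> \<theta> $ i) \<Longrightarrow> (\<integral>x. exp (- (\<theta> \<bullet> x)) \<partial>\<mu>) = (\<integral>x. exp (- (\<theta> \<bullet> x)) \<partial>\<nu>)"
  shows "\<mu> = \<nu>"
proof -
  define L :: "real^'n \<Rightarrow> real^'n" where "L z = (\<chi> i. - ln (z $ i))" for z
  have [measurable]: "L \<in> borel_measurable borel"
  proof (subst borel_measurable_euclidean_space, rule ballI)
    fix b :: "real^'n" assume "b \<in> Basis"
    then obtain i where b: "b = axis i 1" by (auto simp: Basis_vec_def)
    have "(\<lambda>z. L z \<bullet> b) = (\<lambda>z::real^'n. - ln (z \<bullet> axis i 1))"
      by (simp add: b L_def inner_axis)
    then show "(\<lambda>z. L z \<bullet> b) \<in> borel_measurable borel" by simp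
  qed
  have Le: "L (exp_neg x) = x" for x by (simp add: L_def exp_neg_def vec_eq_iff)
  note [measurable_cong] = \<mu>(2) \<nu>(2)
  have m: "exp_neg \<in> measurable \<mu> borel" "exp_neg \<in> measurable \<nu> borel" by measurable
  have "distr \<mu> borel exp_neg = distr \<nu> borel exp_neg"
  proof (rule prob_measure_eqI_continuous)
    fix f :: "real^'n \<Rightarrow> real" and B assume f: "continuous_on UNIV f" "\<And>x. \<bar>f x\<bar> \<le> B"
    have [measurable]: "f \<in> borel_measurable borel" by (rule borel_measurable_continuous_onI) fact
    show "(\<integral>x. f x \<partial>distr \<mu> borel exp_neg) = (\<integral>x. f x \<partial>distr \<nu> borel exp_neg)"
      using orthant_integral_eq[OF \<mu> \<nu> eq f] m by (simp add: integral_distr)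
  qed (auto intro!: prob_space.prob_space_distr \<mu> \<nu> m)
  then have "distr (distr \<mu> borel exp_neg) borel L = distr (distr \<nu> borel exp_neg) borel L" by simp
  then have "distr \<mu> borel (\<lambda>x. x) = distr \<nu> borel (\<lambda>x. x)"
    using m by (simp add: distr_distr comp_def Le)
  then show ?thesis
    by (metis \<mu>(2) \<nu>(2) distr_id2)
qed

section \<open>The matrix exponential\<close>

lemma matrix_power_commute: "A ** matrix_power A k = matrix_power A k ** A"
proof (induction k)
  case (Suc k)
  then show ?case by (metis matrix_mul_assoc matrix_power.simps(2))
qed simp

lemma matrix_power_scaleR: "matrix_power (t *\<^sub>R A) k = t ^ k *\<^sub>R matrix_power A k"
  by (induction k) (simp_all add: scalar_matrix_assoc[symmetric] matrix_scalar_ac mult.commute flip: scalar_mult_eq_scaleR)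

lemma transpose_mat: "transpose (mat c) = mat c"
  by (simp add: transpose_def mat_def vec_eq_iff)

lemma matrix_power_transpose: "matrix_power (transpose A) k = transpose (matrix_power (A::real^'n::finite^'n) k)"
proof (induction k)
  case (Suc k)
  then show ?case by (simp add: matrix_transpose_mul[symmetric] matrix_power_commute)
qed (simp add: transpose_mat)

text \<open>The sum of all absolute entries bounds every row sum, so each further factor costs at
  most this constant. The geometric bound makes the exponential series converge.\<close>

lemma matrix_power_bound:
  fixes A :: "real^'n::finite^'n"
  obtains C where "0 \<le> C" "\<And>k i j. \<bar>matrix_power A k $ i $ j\<bar> \<le> C ^ k"
proof -
  define c where "c = (\<Sum>i\<in>UNIV. \<Sum>j\<in>UNIV. \<bar>A $ i $ j\<bar>)"
  have "0 \<le> c" by (simp add: c_def sum_nonneg)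
  have row: "(\<Sum>j\<in>UNIV. \<bar>A $ i $ j\<bar>) \<le> c" for i
    unfolding c_def by (rule member_le_sum[of i UNIV "\<lambda>i. \<Sum>j\<in>UNIV. \<bar>A $ i $ j\<bar>"]) (auto simp: sum_nonneg)
  have "\<bar>matrix_power A k $ i $ j\<bar> \<le> c ^ k" for k i j
  proof (induction k arbitrary: i)
    case (Suc k)
    have "\<bar>matrix_power A (Suc k) $ i $ j\<bar> \<le> (\<Sum>l\<in>UNIV. \<bar>A $ i $ l * matrix_power A k $ l $ j\<bar>)"
      by (simp add: matrix_matrix_mult_def sum_abs)
    also have "\<dots> \<le> (\<Sum>l\<in>UNIV. \<bar>A $ i $ l\<bar> * c ^ k)"
      by (auto intro!: sum_mono mult_left_mono Suc simp: abs_mult)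
    also have "\<dots> = (\<Sum>l\<in>UNIV. \<bar>A $ i $ l\<bar>) * c ^ k" by (simp add: sum_distrib_right)
    also have "\<dots> \<le> c * c ^ k" using row \<open>0 \<le> c\<close> by (intro mult_right_mono) auto
    finally show ?case by simp
  qed (simp add: mat_def)
  then show ?thesis using that \<open>0 \<le> c\<close> by blast
qed

lemma matrix_exp_entry_summable:
  fixes A :: "real^'n::finite^'n"
  shows "summable (\<lambda>k. matrix_power A k $ i $ j / fact k * t ^ k)"
proof -
  obtain C where C: "0 \<le> C" "\<And>k i j. \<bar>matrix_power A k $ i $ j\<bar> \<le> C ^ k" using matrix_power_bound[of A] by blast
  show ?thesis
  proof (rule summable_comparison_test)
    have "norm (matrix_power A k $ i $ j / fact k * t ^ k) \<le> inverse (fact k) * (C * \<bar>t\<bar>) ^ k" for k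
      using mult_right_mono[OF C(2)[of k i j], of "\<bar>t\<bar> ^ k / fact k"]
      by (simp add: abs_mult power_abs power_mult_distrib divide_simps)
    then show "\<exists>N. \<forall>k\<ge>N. norm (matrix_power A k $ i $ j / fact k * t ^ k) \<le> inverse (fact k) * (C * \<bar>t\<bar>) ^ k"
      by blast
    show "summable (\<lambda>k. inverse (fact k) * (C * \<bar>t\<bar>) ^ k)"
      by (rule summable_exp)
  qed
qed

text \<open>Coordinate projections are bounded linear, so the series in matrix space can be read
  entry by entry as a real power series in t, to which termwise differentiation applies.\<close>

lemma matrix_exp_entry:
  fixes A :: "real^'n::finite^'n"
  shows "matrix_exp (t *\<^sub>R A) $ i $ j = (\<Sum>k. matrix_power A k $ i $ j / fact k * t ^ k)"
proof -
  obtain C where C: "0 \<le> C" "\<And>k i j. \<bar>matrix_power (t *\<^sub>R A) k $ i $ j\<bar> \<le> C ^ k"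
    using matrix_power_bound[of "t *\<^sub>R A"] by blast
  have "summable (\<lambda>k. (1 / fact k) *\<^sub>R matrix_power (t *\<^sub>R A) k)"
  proof (rule summable_comparison_test)
    let ?n = "real CARD('n)"
    have "norm ((1 / fact k) *\<^sub>R matrix_power (t *\<^sub>R A) k) \<le> ?n * ?n * (inverse (fact k) * C ^ k)" for k
    proof -
      have "norm (matrix_power (t *\<^sub>R A) k) \<le> (\<Sum>i\<in>UNIV. norm (matrix_power (t *\<^sub>R A) k $ i))"
        unfolding norm_vec_def by (rule L2_set_le_sum) simp
      also have "\<dots> \<le> (\<Sum>i\<in>UNIV. \<Sum>j\<in>UNIV. \<bar>matrix_power (t *\<^sub>R A) k $ i $ j\<bar>)"
        by (intro sum_mono norm_le_l1_cart)
      also have "\<dots> \<le> (\<Sum>i::'n\<in>UNIV. \<Sum>j::'n\<in>UNIV. C ^ k)"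
        by (intro sum_mono C)
      finally show ?thesis by (simp add: divide_simps mult.assoc)
    qed
    then show "\<exists>N. \<forall>k\<ge>N. norm ((1 / fact k) *\<^sub>R matrix_power (t *\<^sub>R A) k) \<le> ?n * ?n * (inverse (fact k) * C ^ k)"
      by blast
    show "summable (\<lambda>k. ?n * ?n * (inverse (fact k) * C ^ k))"
      by (intro summable_mult summable_exp)
  qed
  then have "(\<lambda>k. (1 / fact k) *\<^sub>R matrix_power (t *\<^sub>R A) k) sums matrix_exp (t *\<^sub>R A)"
    unfolding matrix_exp_def by (rule summable_sums)
  moreover have "bounded_linear (\<lambda>X::real^'n^'n. X $ i $ j)"
    using bounded_linear_compose[OF bounded_linear_vec_nth bounded_linear_vec_nth] .
  ultimately have "(\<lambda>k. ((1 / fact k) *\<^sub>R matrix_power (t *\<^sub>R A) k) $ i $ j) sums (matrix_exp (t *\<^sub>R A) $ i $ j)"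
    using bounded_linear.sums by blast
  then show ?thesis
    by (simp add: matrix_power_scaleR sums_iff mult_ac)
qed

lemma matrix_exp_0: "matrix_exp (0 *\<^sub>R A) = (mat 1 :: real^'n::finite^'n)"
proof -
  have "matrix_exp (0 *\<^sub>R A) $ i $ j = mat 1 $ i $ j" for i j
    using powser_zero[of "\<lambda>k. matrix_power A k $ i $ j / fact k"] by (simp add: matrix_exp_entry del: scaleR_zero_left)
  then show ?thesis by (simp add: vec_eq_iff del: scaleR_zero_left)
qed

lemma matrix_exp_commute: "A ** matrix_exp (t *\<^sub>R A) = matrix_exp (t *\<^sub>R A) ** (A :: real^'n::finite^'n)"
proof -
  have "(A ** matrix_exp (t *\<^sub>R A)) $ i $ j = (\<Sum>k. (A ** matrix_power A k) $ i $ j / fact k * t ^ k)" for i j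
  proof -
    have "(A ** matrix_exp (t *\<^sub>R A)) $ i $ j = (\<Sum>l\<in>UNIV. \<Sum>k. A $ i $ l * (matrix_power A k $ l $ j / fact k * t ^ k))"
      by (simp only: matrix_matrix_mult_def matrix_exp_entry suminf_mult[OF matrix_exp_entry_summable] vec_lambda_beta)
    also have "\<dots> = (\<Sum>k. \<Sum>l\<in>UNIV. A $ i $ l * (matrix_power A k $ l $ j / fact k * t ^ k))"
      by (rule suminf_sum[symmetric]) (rule summable_mult[OF matrix_exp_entry_summable])
    also have "\<dots> = (\<Sum>k. (A ** matrix_power A k) $ i $ j / fact k * t ^ k)"
      by (simp add: matrix_matrix_mult_def sum_divide_distrib sum_distrib_right sum_distrib_left mult_ac)
    finally show ?thesis .
  qed
  moreover have "(matrix_exp (t *\<^sub>R A) ** A) $ i $ j = (\<Sum>k. (matrix_power A k ** A) $ i $ j / fact k * t ^ k)" for i j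
  proof -
    have "(matrix_exp (t *\<^sub>R A) ** A) $ i $ j = (\<Sum>l\<in>UNIV. \<Sum>k. matrix_power A k $ i $ l / fact k * t ^ k * A $ l $ j)"
      by (simp only: matrix_matrix_mult_def matrix_exp_entry suminf_mult2[OF matrix_exp_entry_summable] vec_lambda_beta)
    also have "\<dots> = (\<Sum>k. \<Sum>l\<in>UNIV. matrix_power A k $ i $ l / fact k * t ^ k * A $ l $ j)"
      by (rule suminf_sum[symmetric]) (rule summable_mult2[OF matrix_exp_entry_summable])
    also have "\<dots> = (\<Sum>k. (matrix_power A k ** A) $ i $ j / fact k * t ^ k)"
      by (simp add: matrix_matrix_mult_def sum_divide_distrib sum_distrib_right sum_distrib_left mult_ac)
    finally show ?thesis .
  qed
  ultimately show ?thesis by (simp add: vec_eq_iff matrix_power_commute)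
qed

lemma DERIV_matrix_exp:
  fixes A :: "real^'n::finite^'n"
  shows "((\<lambda>t. matrix_exp (t *\<^sub>R A) $ i $ j) has_real_derivative (matrix_exp (t *\<^sub>R A) ** A) $ i $ j) (at t)"
proof -
  let ?c = "\<lambda>k. matrix_power A k $ i $ j / fact k"
  have "((\<lambda>t. \<Sum>k. ?c k * t ^ k) has_real_derivative (\<Sum>k. diffs ?c k * t ^ k)) (at t)"
    by (rule termdiffs_strong_converges_everywhere) (rule matrix_exp_entry_summable)
  moreover have "diffs ?c k = (\<Sum>l\<in>UNIV. A $ i $ l * (matrix_power A k $ l $ j / fact k))" for k
  proof -
    have "diffs ?c k = (A ** matrix_power A k) $ i $ j / fact k"
      by (simp add: diffs_def del: of_nat_Suc)
    then show ?thesis by (simp add: matrix_matrix_mult_def sum_divide_distrib)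
  qed
  then have "(\<Sum>k. diffs ?c k * t ^ k) = (\<Sum>k. \<Sum>l\<in>UNIV. A $ i $ l * (matrix_power A k $ l $ j / fact k * t ^ k))"
    by (simp add: sum_distrib_right mult.assoc)
  also have "\<dots> = (\<Sum>l\<in>UNIV. \<Sum>k. A $ i $ l * (matrix_power A k $ l $ j / fact k * t ^ k))"
    by (rule suminf_sum) (rule summable_mult[OF matrix_exp_entry_summable])
  also have "\<dots> = (A ** matrix_exp (t *\<^sub>R A)) $ i $ j"
    by (simp only: matrix_matrix_mult_def matrix_exp_entry suminf_mult[OF matrix_exp_entry_summable] vec_lambda_beta)
  ultimately show ?thesis by (simp add: matrix_exp_entry[abs_def] matrix_exp_commute)
qed

section \<open>Linear matrix differential equations\<close>

lemma DERIV_matrix_mult: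
  assumes "\<And>i j. ((\<lambda>t. F t $ i $ j) has_real_derivative F' $ i $ j) (at t)"
    and "\<And>i j. ((\<lambda>t. G t $ i $ j) has_real_derivative G' $ i $ j) (at t)"
  shows "((\<lambda>t. (F t ** G t) $ i $ j) has_real_derivative (F' ** G t + F t ** G') $ i $ j) (at t)"
  unfolding matrix_matrix_mult_def
  by (auto intro!: derivative_eq_intros assms simp: sum.distrib algebra_simps)

text \<open>For any solution G the product G(s) exp(- s A) has derivative 0 and so equals G(0).
  Taking G = exp(s A) shows that exp(- t A) inverts exp(t A); taking G = F then solves for
  F(t).\<close>

lemma matrix_ode_unique:
  fixes F :: "real \<Rightarrow> real^'n::finite^'n"
  assumes F: "\<And>t i j. ((\<lambda>t. F t $ i $ j) has_real_derivative (F t ** A) $ i $ j) (at t)"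
  shows "F t = F 0 ** matrix_exp (t *\<^sub>R A)"
proof -
  let ?E = "\<lambda>t. matrix_exp (t *\<^sub>R A)"
  have neg: "((\<lambda>t. ?E (- t) $ i $ j) has_real_derivative (- (A ** ?E (- t))) $ i $ j) (at t)"
    for t i j
  proof -
    have "((\<lambda>t. ?E (- t) $ i $ j) has_real_derivative (?E (- t) ** A) $ i $ j * (- 1)) (at t)"
      by (rule DERIV_chain2[where f="\<lambda>t. matrix_exp (t *\<^sub>R A) $ i $ j" and g="\<lambda>t. - t", OF DERIV_matrix_exp])
         (auto intro!: derivative_eq_intros)
    then show ?thesis using matrix_exp_commute[of A "- t"] by simp
  qed
  have const: "G s ** ?E (- s) = G 0"
    if G: "\<And>t i j. ((\<lambda>t. G t $ i $ j) has_real_derivative (G t ** A) $ i $ j) (at t)"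
    for G :: "real \<Rightarrow> real^'n^'n" and s
  proof -
    have "(G s ** ?E (- s)) $ i $ j = (G 0 ** ?E (- 0)) $ i $ j" for i j
    proof (rule DERIV_isconst_all[rule_format, where f="\<lambda>s. (G s ** ?E (- s)) $ i $ j"])
      fix x
      have "((\<lambda>s. (G s ** ?E (- s)) $ i $ j) has_real_derivative
         (G x ** A ** ?E (- x) + G x ** (- (A ** ?E (- x)))) $ i $ j) (at x)"
        by (rule DERIV_matrix_mult[OF G neg])
      moreover have "G x ** (- (A ** ?E (- x))) = - (G x ** A ** ?E (- x))"
        unfolding matrix_mul_assoc[symmetric] by (simp add: matrix_matrix_mult_def[of "G x"] vec_eq_iff sum_negf)
      ultimately show "((\<lambda>s. (G s ** ?E (- s)) $ i $ j) has_real_derivative 0) (at x)"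
        by simp
    qed
    then show ?thesis by (simp add: vec_eq_iff matrix_exp_0 del: scaleR_zero_left)
  qed
  have "?E (- t) ** matrix_exp (t *\<^sub>R A) = mat 1"
    using const[OF DERIV_matrix_exp, of "- t"] matrix_exp_0[of A] by simp
  then show ?thesis
    using const[OF F, of t] by (metis matrix_mul_assoc matrix_mul_rid)
qed

lemma matrix_exp_add:
  fixes A :: "real^'n::finite^'n"
  shows "matrix_exp ((s + t) *\<^sub>R A) = matrix_exp (s *\<^sub>R A) ** matrix_exp (t *\<^sub>R A)"
proof -
  have "((\<lambda>t. matrix_exp ((s + t) *\<^sub>R A) $ i $ j) has_real_derivative (matrix_exp ((s + t) *\<^sub>R A) ** A) $ i $ j) (at t)"
    for t i j
  proof -
    have "((\<lambda>t. matrix_exp ((s + t) *\<^sub>R A) $ i $ j) has_real_derivative (matrix_exp ((s + t) *\<^sub>R A) ** A) $ i $ j * 1) (at t)"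
      by (rule DERIV_chain2[where f="\<lambda>t. matrix_exp (t *\<^sub>R A) $ i $ j" and g="\<lambda>t. s + t"])
         (auto intro!: DERIV_matrix_exp derivative_eq_intros)
    then show ?thesis by simp
  qed
  from matrix_ode_unique[OF this, of t] show ?thesis by simp
qed

text \<open>\<open>mat c\<close> is c times the identity, so both sides solve F' = F A with F(0) =
  1. For a Metzler matrix a large c makes all entries of \<open>A + mat c\<close> nonnegative, which
  turns questions of sign into series with nonnegative terms.\<close>

lemma matrix_exp_shift:
  fixes A :: "real^'n::finite^'n"
  shows "matrix_exp (t *\<^sub>R A) = exp (- c * t) *\<^sub>R matrix_exp (t *\<^sub>R (A + mat c))"
proof -
  define F where "F t = exp (- c * t) *\<^sub>R matrix_exp (t *\<^sub>R (A + mat c))" for t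
  have mc: "(X ** mat c) $ i $ j = c * X $ i $ j" for X :: "real^'n^'n" and i j
    by (simp add: matrix_matrix_mult_def mat_def if_distrib[of "(*) _"] cong: if_cong)
  have "((\<lambda>t. F t $ i $ j) has_real_derivative (F t ** A) $ i $ j) (at t)" for t i j
  proof -
    let ?E = "matrix_exp (t *\<^sub>R (A + mat c))"
    have "((\<lambda>t. F t $ i $ j) has_real_derivative
        - c * exp (- c * t) * ?E $ i $ j + exp (- c * t) * (?E ** (A + mat c)) $ i $ j) (at t)"
      unfolding F_def vector_scaleR_component
      by (rule derivative_eq_intros DERIV_matrix_exp refl | simp)+
    moreover have "(F t ** A) $ i $ j = exp (- c * t) * (?E ** A) $ i $ j"
      by (simp add: F_def matrix_matrix_mult_def sum_distrib_left mult.assoc)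
    ultimately show ?thesis by (simp add: matrix_add_ldistrib mc algebra_simps)
  qed
  from matrix_ode_unique[OF this, of t] show ?thesis by (simp add: F_def matrix_exp_0 del: scaleR_zero_left)
qed

lemma matrix_exp_transpose:
  fixes A :: "real^'n::finite^'n"
  shows "matrix_exp (t *\<^sub>R transpose A) = transpose (matrix_exp (t *\<^sub>R A))"
  by (simp add: vec_eq_iff matrix_exp_entry matrix_power_transpose transpose_def[of "matrix_exp _"])
     (simp add: transpose_def)

section \<open>Metzler matrices: sign and decay of the exponential\<close>

definition metzler :: "real^'n^'n \<Rightarrow> bool" where
  "metzler A \<longleftrightarrow> (\<forall>i j. i \<noteq> j \<longrightarrow> 0 \<le> A $ i $ j)"

lemma metzler_shift_nonneg:
  fixes A :: "real^'n::finite^'n"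
  assumes "metzler A"
  obtains c where "0 \<le> c" "\<And>i j. 0 \<le> (A + mat c) $ i $ j"
proof
  define c where "c = (\<Sum>i\<in>UNIV. \<bar>A $ i $ i\<bar>)"
  show "0 \<le> c" by (simp add: c_def sum_nonneg)
  have "\<bar>A $ i $ i\<bar> \<le> c" for i
    unfolding c_def by (rule member_le_sum[of i UNIV "\<lambda>i. \<bar>A $ i $ i\<bar>"]) auto
  then have "0 \<le> A $ i $ i + c" for i by (smt (verit))
  then show "0 \<le> (A + mat c) $ i $ j" for i j
    using assms by (simp add: mat_def metzler_def)
qed

lemma matrix_power_nonneg:
  assumes "\<And>i j. 0 \<le> A $ i $ j"
  shows "0 \<le> matrix_power A k $ i $ j"
  by (induction k arbitrary: i j) (auto simp: mat_def matrix_matrix_mult_def intro!: sum_nonneg mult_nonneg_nonneg assms)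

text \<open>All terms of the series are nonnegative, so the first two bound it from below; the
  linear one is the source of strict positivity.\<close>

lemma matrix_exp_ge_first_order:
  fixes A :: "real^'n::finite^'n"
  assumes "\<And>i j. 0 \<le> A $ i $ j" "0 \<le> t"
  shows "(mat 1 + t *\<^sub>R A) $ i $ j \<le> matrix_exp (t *\<^sub>R A) $ i $ j"
proof -
  have "(\<Sum>k<2. matrix_power A k $ i $ j / fact k * t ^ k) \<le> matrix_exp (t *\<^sub>R A) $ i $ j"
    unfolding matrix_exp_entry
    by (rule sum_le_suminf[OF matrix_exp_entry_summable]) (auto simp: assms matrix_power_nonneg)
  then show ?thesis by (simp add: eval_nat_numeral mult.commute)
qed

lemma matrix_exp_metzler_nonneg:
  fixes A :: "real^'n::finite^'n"
  assumes "metzler A" "0 \<le> t"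
  shows "0 \<le> matrix_exp (t *\<^sub>R A) $ i $ j"
proof -
  obtain c where c: "0 \<le> c" "\<And>i j. 0 \<le> (A + mat c) $ i $ j" using metzler_shift_nonneg[OF assms(1)] by blast
  have "0 \<le> (mat 1 + t *\<^sub>R (A + mat c)) $ i $ j"
    using c(2)[of i j] assms(2) by (simp add: mat_def)
  also have "\<dots> \<le> matrix_exp (t *\<^sub>R (A + mat c)) $ i $ j"
    using c assms(2) by (rule_tac matrix_exp_ge_first_order) auto
  finally show ?thesis by (subst matrix_exp_shift[of t A c]) simp
qed

text \<open>The first-order bound suffices: coordinate i is either charged by v itself or reached
  after one application of A. The second case is that of the channel coordinates, where the input
  vector vanishes.\<close>

lemma matrix_exp_metzler_pos:
  fixes A :: "real^'n::finite^'n" and v :: "real^'n"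
  assumes "metzler A" "0 < t" "\<And>j. 0 \<le> v $ j" "0 < v $ i \<or> 0 < (A *v v) $ i"
  shows "0 < (matrix_exp (t *\<^sub>R A) *v v) $ i"
proof -
  obtain c where c: "0 \<le> c" "\<And>i j. 0 \<le> (A + mat c) $ i $ j" using metzler_shift_nonneg[OF assms(1)] by blast
  have Bv: "((A + mat c) *v v) $ i = (A *v v) $ i + c * v $ i"
    by (simp add: matrix_vector_mult_def mat_def distrib_right sum.distrib if_distrib[of "\<lambda>x. x * _"] cong: if_cong)
  have Bn: "0 \<le> ((A + mat c) *v v) $ i"
    unfolding matrix_vector_mult_def using c(2) assms(3) by (auto intro!: sum_nonneg mult_nonneg_nonneg simp del: vector_add_component)
  have "0 < v $ i + t * ((A + mat c) *v v) $ i"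
    using assms(4)
  proof
    assume "0 < (A *v v) $ i"
    then have "0 < ((A + mat c) *v v) $ i" using c(1) assms(3)[of i] by (simp add: Bv add_pos_nonneg)
    then show ?thesis using assms(2) assms(3)[of i] by (simp add: add_nonneg_pos)
  qed (use Bn assms(2) in \<open>simp add: add_pos_nonneg\<close>)
  also have "\<dots> = (\<Sum>j\<in>UNIV. (mat 1 + t *\<^sub>R (A + mat c)) $ i $ j * v $ j)"
    by (simp add: matrix_vector_mult_def distrib_right sum.distrib sum_distrib_left mult.assoc mat_def[of 1] if_distrib[of "\<lambda>x. x * _"]
        cong: if_cong) (simp add: algebra_simps sum.distrib sum_distrib_left)
  also have "\<dots> \<le> (\<Sum>j\<in>UNIV. matrix_exp (t *\<^sub>R (A + mat c)) $ i $ j * v $ j)"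
    using c assms by (intro sum_mono mult_right_mono matrix_exp_ge_first_order) auto
  also have "\<dots> = (matrix_exp (t *\<^sub>R (A + mat c)) *v v) $ i"
    by (simp add: matrix_vector_mult_def)
  finally have "0 < exp (- c * t) * (matrix_exp (t *\<^sub>R (A + mat c)) *v v) $ i" by simp
  also have "\<dots> = (matrix_exp (t *\<^sub>R A) *v v) $ i"
    by (subst matrix_exp_shift[of t A c]) (simp add: scaleR_matrix_vector_assoc[symmetric])
  finally show ?thesis .
qed

text \<open>A Gronwall argument for the linear functional y: since exp(t A) has nonnegative entries,
  the inequality y A \<le> - d y may be multiplied by it from the right, so exp(d t) y exp(t A) is
  nonincreasing in every coordinate.\<close>

lemma matrix_exp_decay:
  fixes A :: "real^'n::finite^'n"
  assumes "metzler A" and y: "\<And>j. (\<Sum>i\<in>UNIV. y i * A $ i $ j) \<le> - d * y j" and t: "0 \<le> t"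
  shows "(\<Sum>i\<in>UNIV. y i * matrix_exp (t *\<^sub>R A) $ i $ j) \<le> exp (- d * t) * y j"
proof -
  define f where "f t = exp (d * t) * (\<Sum>i\<in>UNIV. y i * matrix_exp (t *\<^sub>R A) $ i $ j)" for t
  have "f t \<le> f 0"
  proof (rule DERIV_nonpos_imp_nonincreasing[OF t], rule exI, rule conjI)
    fix s :: real assume s: "0 \<le> s"
    show "(f has_real_derivative exp (d * s) * (d * (\<Sum>i\<in>UNIV. y i * matrix_exp (s *\<^sub>R A) $ i $ j) +
        (\<Sum>i\<in>UNIV. y i * (A ** matrix_exp (s *\<^sub>R A)) $ i $ j))) (at s)"
      unfolding f_def by (auto intro!: derivative_eq_intros DERIV_matrix_exp simp: matrix_exp_commute algebra_simps)
    have "(\<Sum>i\<in>UNIV. y i * (A ** matrix_exp (s *\<^sub>R A)) $ i $ j) =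
        (\<Sum>l\<in>UNIV. (\<Sum>i\<in>UNIV. y i * A $ i $ l) * matrix_exp (s *\<^sub>R A) $ l $ j)"
      by (simp add: matrix_matrix_mult_def sum_distrib_left sum_distrib_right mult.assoc)
         (rule sum.swap)
    also have "\<dots> \<le> (\<Sum>l\<in>UNIV. - d * y l * matrix_exp (s *\<^sub>R A) $ l $ j)"
      by (intro sum_mono mult_right_mono y matrix_exp_metzler_nonneg assms s)
    finally have "d * (\<Sum>i\<in>UNIV. y i * matrix_exp (s *\<^sub>R A) $ i $ j) +
        (\<Sum>i\<in>UNIV. y i * (A ** matrix_exp (s *\<^sub>R A)) $ i $ j) \<le> 0"
      by (simp add: sum_distrib_left sum_negf mult.assoc)
    then show "exp (d * s) * (d * (\<Sum>i\<in>UNIV. y i * matrix_exp (s *\<^sub>R A) $ i $ j) +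
        (\<Sum>i\<in>UNIV. y i * (A ** matrix_exp (s *\<^sub>R A)) $ i $ j)) \<le> 0"
      by (simp add: mult_nonneg_nonpos)
  qed
  also have "f 0 = y j"
    by (simp only: f_def matrix_exp_0) (simp add: mat_def if_distrib[of "(*) _"] cong: if_cong)
  finally show ?thesis by (simp add: f_def exp_minus field_simps)
qed

section \<open>The river network system\<close>

lemma sum_UNIV_sum:
  "(\<Sum>i\<in>(UNIV :: ('a::finite + 'b::finite) set). f i) = (\<Sum>e\<in>UNIV. f (Inl e)) + (\<Sum>e\<in>UNIV. f (Inr e))"
  by (simp add: UNIV_Plus_UNIV[symmetric] sum.Plus del: UNIV_Plus_UNIV)

lemma system_matrix_nth [simp]:
  "system_matrix trib K H $ Inl e $ Inl e' = (if e' = e then - K e else if e' \<in> trib e then K e else 0)"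
  "system_matrix trib K H $ Inl e $ Inr e' = (if e' = e then K e else 0)"
  "system_matrix trib K H $ Inr e $ Inl e' = 0"
  "system_matrix trib K H $ Inr e $ Inr e' = (if e' = e then - H e else 0)"
  by (simp_all add: system_matrix_def block_matrix_def diag_matrix_def incidence_matrix_def
      matrix_matrix_mult_def if_distrib[of "\<lambda>x. x * _"] cong: if_cong)

lemma input_vector_nth [simp]:
  "input_vector H a $ Inl e = 0" "input_vector H a $ Inr e = H e * a e"
  by (simp_all add: input_vector_def block_vector_def diag_matrix_def matrix_vector_mult_def
      if_distrib[of "\<lambda>x. x * _"] cong: if_cong)

lemma metzler_system_matrix:
  assumes "\<And>e. 0 < K e"
  shows "metzler (system_matrix trib K H)"
  unfolding metzler_def
proof (intro allI impI)
  fix i j :: "'a + 'a" assume "i \<noteq> j"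
  then show "0 \<le> system_matrix trib K H $ i $ j"
    using assms by (cases i; cases j) (auto intro: less_imp_le)
qed

lemma system_matrix_input_pos:
  assumes "\<And>e. 0 < K e" "\<And>e. 0 < H e" "\<And>e. 0 < a e"
  shows "0 < input_vector H a $ i \<or> 0 < (system_matrix trib K H *v input_vector H a) $ i"
proof (cases i)
  case (Inl e)
  have "(system_matrix trib K H *v input_vector H a) $ Inl e = K e * (H e * a e)"
    by (simp add: matrix_vector_mult_def sum_UNIV_sum if_distrib[of "\<lambda>x. x * _"] cong: if_cong)
  then show ?thesis using assms Inl by simp
qed (use assms in simp)

text \<open>The witness is the length of a shortest path from the root. A link other than the root
  has a unique downstream link, so the last step of a shortest path to a tributary must come from
  there.\<close>

lemma river_tree_depth:
  assumes "river_tree r trib"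
  obtains d :: "'e::finite \<Rightarrow> nat" where "\<And>e e'. e' \<in> trib e \<Longrightarrow> d e < d e'"
proof
  let ?R = "{(d, u). u \<in> trib d}"
  define d where "d e = (LEAST n. (r, e) \<in> ?R ^^ n)" for e
  have ex: "\<exists>n. (r, e) \<in> ?R ^^ n" for e
    using assms by (auto simp: river_tree_def rtrancl_is_UN_relpow)
  fix e e' assume e': "e' \<in> trib e"
  have path: "(r, e') \<in> ?R ^^ d e'" unfolding d_def using LeastI_ex[OF ex] .
  have ne: "e' \<noteq> r" using e' assms by (auto simp: river_tree_def)
  then obtain n where n: "d e' = Suc n" using path by (cases "d e'") auto
  then obtain f where f: "(r, f) \<in> ?R ^^ n" "e' \<in> trib f" using path by auto
  have "f = e" using f(2) e' ne assms unfolding river_tree_def by blast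
  then have "d e \<le> n" unfolding d_def using f(1) by (auto intro: Least_le)
  then show "d e < d e'" using n by simp
qed

text \<open>The weight of \<^term>\<open>Inl e\<close> grows with the distance from the root, so that the outflow of a
  link outweighs what it feeds into the downstream link.\<close>

lemma system_matrix_dissipative:
  fixes trib :: "'e::finite \<Rightarrow> 'e set"
  assumes "river_tree r trib" "\<And>e. 0 < K e" "\<And>e. 0 < H e"
  obtains y d where "\<And>i. 0 < y i" "0 < d"
    "\<And>j. (\<Sum>i\<in>UNIV. y i * system_matrix trib K H $ i $ j) \<le> - d * y j"
proof -
  obtain dep :: "'e \<Rightarrow> nat" where dep: "\<And>e e'. e' \<in> trib e \<Longrightarrow> dep e < dep e'"
    using river_tree_depth[OF assms(1)] by blast
  \<comment> \<open>The divisions cancel K and H, so column sums become differences of depths: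
    column \<open>Inr e\<close> gives (1 + dep e) - (2 + dep e), and column \<open>Inl e'\<close>
    gives (1 + dep e) - (1 + dep e') for the link e below e'. The summand 1 yields the bound - 1 at
    the root as well.\<close>
  define y where "y i = (case i of Inl e \<Rightarrow> (1 + real (dep e)) / K e | Inr e \<Rightarrow> (2 + real (dep e)) / H e)" for i
  have ypos: "0 < y i" for i using assms by (cases i) (auto simp: y_def)
  define Y where "Y = (\<Sum>i\<in>UNIV. y i)"
  have yY: "y i \<le> Y" for i unfolding Y_def by (rule member_le_sum) (auto intro: less_imp_le ypos)
  have Ypos: "0 < Y" using ypos yY by (meson less_le_trans)
  have main: "(\<Sum>i\<in>UNIV. y i * system_matrix trib K H $ i $ j) \<le> - 1" for j
  proof (cases j)
    case (Inr e)
    have "(\<Sum>i\<in>UNIV. y i * system_matrix trib K H $ i $ Inr e) = y (Inl e) * K e - y (Inr e) * H e"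
      by (simp add: sum_UNIV_sum if_distrib[of "(*) _"] cong: if_cong)
    also have "\<dots> = - 1"
      using assms(2)[of e] assms(3)[of e] by (simp add: y_def)
    finally show ?thesis using Inr by simp
  next
    case (Inl e')
    let ?f = "\<lambda>e. if e' = e then - (1 + real (dep e)) else if e' \<in> trib e then 1 + real (dep e) else 0"
    have K: "y (Inl e) * K e = 1 + real (dep e)" for e using assms(2)[of e] by (simp add: y_def)
    have "(\<Sum>i\<in>UNIV. y i * system_matrix trib K H $ i $ Inl e') = (\<Sum>e\<in>UNIV. ?f e)"
      unfolding sum_UNIV_sum by (simp, rule sum.cong) (auto simp: K)
    also have "\<dots> \<le> - 1"
    proof (cases "\<exists>e. e' \<in> trib e")
      case False
      then have "(\<Sum>e\<in>UNIV. ?f e) = (\<Sum>e\<in>UNIV. if e' = e then - (1 + real (dep e)) else 0)"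
        by (intro sum.cong) auto
      also have "\<dots> \<le> - 1" by simp
      finally show ?thesis .
    next
      case True
      then obtain e where e: "e' \<in> trib e" by auto
      have "e' \<noteq> r" using e assms(1) by (auto simp: river_tree_def)
      then have u: "e' \<in> trib x \<longleftrightarrow> x = e" for x using e assms(1) unfolding river_tree_def by blast
      have "e \<noteq> e'" using dep[OF e] by auto
      then have "(\<Sum>e\<in>UNIV. ?f e) = (\<Sum>x\<in>UNIV. (if e' = x then - (1 + real (dep x)) else 0) + (if e = x then 1 + real (dep x) else 0))"
        by (intro sum.cong) (auto simp: u)
      then have "(\<Sum>e\<in>UNIV. ?f e) = - (1 + real (dep e')) + (1 + real (dep e))" by (simp add: sum.distrib)
      then show ?thesis using dep[OF e] by simp
    qed
    finally show ?thesis using Inl by simp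
  qed
  \<comment> \<open>The weights are at most Y, so the absolute bound - 1 becomes the relative rate 1
    / Y.\<close>
  have "(\<Sum>i\<in>UNIV. y i * system_matrix trib K H $ i $ j) \<le> - (1 / Y) * y j" for j
  proof -
    have "y j / Y \<le> 1" using yY[of j] Ypos by simp
    then show ?thesis using main[of j] by simp
  qed
  then show ?thesis using that[of y "1 / Y"] ypos Ypos by auto
qed

text \<open>Transposition turns the column of Q_r into the row of Q_r of the exponential, and the
  vanishing upper half of the input vector leaves only the lower entries. The right-hand side is the
  response of Q_r at time - ln u / H_r.\<close>

lemma m_root_sum:
  "(\<Sum>e\<in>UNIV. H e * a e * m_root r trib K H u $ e) =
     (matrix_exp (- (ln u / H r) *\<^sub>R system_matrix trib K H) *v input_vector H a) $ Inl r"
  by (simp only: m_root_def matrix_exp_transpose)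
     (simp add: column_def transpose_def matrix_vector_mult_def sum_UNIV_sum mult_ac)

section \<open>Bell polynomials and the moment--cumulant recursion\<close>

text \<open>The number m of variables is kept apart from n and k, unlike in
  \<open>bell_poly\<close>: the recursion compares different n and k over the same m.\<close>

definition bell_index :: "nat \<Rightarrow> nat \<Rightarrow> nat \<Rightarrow> (nat \<Rightarrow> nat) set" where
  "bell_index m n k = {j \<in> {1..m} \<rightarrow>\<^sub>E UNIV. (\<Sum>i = 1..m. j i) = k \<and> (\<Sum>i = 1..m. i * j i) = n}"

definition bell_weight :: "nat \<Rightarrow> (nat \<Rightarrow> ennreal) \<Rightarrow> (nat \<Rightarrow> nat) \<Rightarrow> ennreal" where
  "bell_weight m x j = (\<Prod>i = 1..m. 1 / of_nat (fact (j i)) * (x i / of_nat (fact i)) ^ j i)"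

definition bell_sum :: "nat \<Rightarrow> (nat \<Rightarrow> ennreal) \<Rightarrow> nat \<Rightarrow> nat \<Rightarrow> ennreal" where
  "bell_sum m x n k = (\<Sum>j\<in>bell_index m n k. bell_weight m x j)"

lemma finite_bell_index: "finite (bell_index m n k)"
proof (rule finite_subset)
  show "bell_index m n k \<subseteq> {1..m} \<rightarrow>\<^sub>E {..k}"
  proof
    fix j assume j: "j \<in> bell_index m n k"
    have "j i \<le> k" if "i \<in> {1..m}" for i
      using j member_le_sum[of i "{1..m}" j] that by (auto simp: bell_index_def)
    then show "j \<in> {1..m} \<rightarrow>\<^sub>E {..k}" using j by (auto simp: bell_index_def PiE_iff)
  qed
qed (auto intro: finite_PiE)

lemma bell_poly_eq: "bell_poly n k x = of_nat (fact n) * bell_sum (n - k + 1) x n k"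
  unfolding bell_poly_def bell_sum_def bell_index_def bell_weight_def by simp

text \<open>One block of size i together with k - 1 further blocks of size at least 1 already uses i
  + k - 1 of the n available units.\<close>

lemma bell_index_bound:
  assumes "j \<in> bell_index m n k" "i \<in> {1..m}" "n - k + 1 < i"
  shows "j i = 0"
proof (rule ccontr)
  assume ji: "j i \<noteq> 0"
  have k: "k = j i + (\<Sum>l\<in>{1..m} - {i}. j l)" and n: "n = i * j i + (\<Sum>l\<in>{1..m} - {i}. l * j l)"
    using assms(1,2) by (auto simp: bell_index_def sum.remove)
  have "(\<Sum>l\<in>{1..m} - {i}. j l) \<le> (\<Sum>l\<in>{1..m} - {i}. l * j l)"
    by (rule sum_mono) auto
  then have "n - i * j i \<ge> k - j i" "n \<ge> i * j i" using k n by auto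
  moreover have "i * j i \<ge> i + (j i - 1)"
    using ji assms(2) by (cases "j i"; cases i) auto
  ultimately show False using assms(3) ji k by linarith
qed

text \<open>The extra entries are forced to 0 by \<open>bell_index_bound\<close> and contribute
  factors y ^ 0 = 1 even where x is infinite. Padding with 0 inverts the restriction;
  \<open>undefined\<close> keeps the functions extensional.\<close>

lemma bell_sum_extend:
  assumes "n - k + 1 \<le> m"
  shows "bell_sum m x n k = bell_sum (n - k + 1) x n k"
proof -
  let ?p = "n - k + 1"
  have split: "(\<Sum>i = 1..m. f i) = (\<Sum>i = 1..?p. f i)"
    if "\<And>i. i \<in> {1..m} \<Longrightarrow> ?p < i \<Longrightarrow> f i = 0" for f :: "nat \<Rightarrow> nat"
    by (rule sum.mono_neutral_right) (use assms that in auto)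
  have psplit: "(\<Prod>i = 1..m. f i) = (\<Prod>i = 1..?p. f i)"
    if "\<And>i. i \<in> {1..m} \<Longrightarrow> ?p < i \<Longrightarrow> f i = 1" for f :: "nat \<Rightarrow> ennreal"
    by (rule prod.mono_neutral_right) (use assms that in auto)
  show ?thesis
    unfolding bell_sum_def
  proof (rule sum.reindex_bij_witness[where j="\<lambda>j. restrict j {1..?p}"
        and i="\<lambda>j i. if i \<in> {1..?p} then j i else if i \<in> {1..m} then 0 else undefined"])
    fix j assume j: "j \<in> bell_index m n k"
    note z = bell_index_bound[OF j]
    show "(\<lambda>i. if i \<in> {1..?p} then restrict j {1..?p} i else if i \<in> {1..m} then 0 else undefined) = j"
      using j z assms by (auto simp: bell_index_def PiE_def extensional_def fun_eq_iff not_le)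
    show "restrict j {1..?p} \<in> bell_index ?p n k"
      using j z split[of j] split[of "\<lambda>i. i * j i"] by (auto simp: bell_index_def PiE_iff)
    show "bell_weight ?p x (restrict j {1..?p}) = bell_weight m x j"
      using z unfolding bell_weight_def by (subst psplit) auto
  next
    fix j assume j: "j \<in> bell_index ?p n k"
    let ?j = "\<lambda>i. if i \<in> {1..?p} then j i else if i \<in> {1..m} then 0 else undefined"
    show "restrict ?j {1..?p} = j"
      using j by (auto simp: bell_index_def PiE_def extensional_def fun_eq_iff)
    have "(\<Sum>i = 1..m. ?j i) = (\<Sum>i = 1..?p. ?j i)" by (rule split) auto
    also have "\<dots> = (\<Sum>i = 1..?p. j i)" by (rule sum.cong) auto
    finally have s1: "(\<Sum>i = 1..m. ?j i) = (\<Sum>i = 1..?p. j i)" .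
    have "(\<Sum>i = 1..m. i * ?j i) = (\<Sum>i = 1..?p. i * ?j i)" by (rule split) auto
    also have "\<dots> = (\<Sum>i = 1..?p. i * j i)" by (rule sum.cong) auto
    finally have s2: "(\<Sum>i = 1..m. i * ?j i) = (\<Sum>i = 1..?p. i * j i)" .
    show "?j \<in> bell_index m n k"
      unfolding bell_index_def mem_Collect_eq s1 s2
      using j assms by (auto simp: bell_index_def PiE_iff extensional_def)
  qed
qed

lemma ennreal_divide_fact: "x / of_nat (fact i) = ennreal (1 / fact i) * x"
  by (simp add: divide_ennreal_def inverse_ennreal mult.commute inverse_eq_divide flip: ennreal_of_nat_eq_real_of_nat)
     (metis ennreal_of_nat_eq_real_of_nat inverse_ennreal inverse_eq_divide fact_gt_zero of_nat_fact)

text \<open>The factor j i counts the ways to mark a block of size i. Removing the marked block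
  leaves k blocks of total size n - i, and j i / (j i)! = 1 / (j i - 1)! accounts for the
  weight.\<close>

lemma bell_sum_marked:
  assumes i: "i \<in> {1..m}"
  shows "(\<Sum>j\<in>bell_index m n (Suc k). of_nat (j i) * bell_weight m x j) =
    (if i \<le> n then x i / of_nat (fact i) * bell_sum m x (n - i) k else 0)"
proof -
  let ?S = "{j \<in> bell_index m n (Suc k). j i \<noteq> 0}"
  have upd: "(\<Sum>l = 1..m. f l ((j(i := c)) l)) = f i c + (\<Sum>l\<in>{1..m} - {i}. f l (j l))"
    for f :: "nat \<Rightarrow> nat \<Rightarrow> nat" and j c
    using i by (subst sum.remove[of _ i]) (auto intro!: sum.cong)
  have "(\<Sum>j\<in>bell_index m n (Suc k). of_nat (j i) * bell_weight m x j) = (\<Sum>j\<in>?S. of_nat (j i) * bell_weight m x j)"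
    by (rule sum.mono_neutral_right) (auto simp: finite_bell_index)
  also have "\<dots> = (if i \<le> n then x i / of_nat (fact i) * bell_sum m x (n - i) k else 0)"
  proof (cases "i \<le> n")
    case False
    have "?S = {}"
    proof (rule ccontr)
      assume "?S \<noteq> {}"
      then obtain j where j: "j \<in> bell_index m n (Suc k)" "j i \<noteq> 0" by auto
      have "i * j i \<le> (\<Sum>l = 1..m. l * j l)" by (rule member_le_sum) (use i in auto)
      also have "\<dots> = n" using j by (simp add: bell_index_def)
      finally show False using False j(2) by (cases "j i") auto
    qed
    then show ?thesis using False by (simp only: sum.empty if_False)
  next
    case True
    have "(\<Sum>j\<in>?S. of_nat (j i) * bell_weight m x j) =
        (\<Sum>j\<in>bell_index m (n - i) k. x i / of_nat (fact i) * bell_weight m x j)"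
    proof (rule sum.reindex_bij_witness[where j="\<lambda>j. j(i := j i - 1)" and i="\<lambda>j. j(i := Suc (j i))"])
      fix j assume j: "j \<in> ?S"
      let ?j = "j(i := j i - 1)"
      show "?j(i := Suc (?j i)) = j" using j by auto
      have "(\<Sum>l = 1..m. j l) = j i + (\<Sum>l\<in>{1..m} - {i}. j l)"
        "(\<Sum>l = 1..m. l * j l) = i * j i + (\<Sum>l\<in>{1..m} - {i}. l * j l)"
        using i by (auto simp: sum.remove)
      moreover note upd[of "\<lambda>l a. a" j "j i - 1"] upd[of "\<lambda>l a. l * a" j "j i - 1"]
      moreover have "i * j i = i * (j i - 1) + i" using j by (cases "j i") auto
      ultimately show "?j \<in> bell_index m (n - i) k"
        using j i by (auto simp: bell_index_def PiE_iff extensional_def)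
      let ?R = "\<Prod>l\<in>{1..m} - {i}. 1 / of_nat (fact (j l)) * (x l / of_nat (fact l)) ^ j l"
      have R: "(\<Prod>l\<in>{1..m} - {i}. 1 / of_nat (fact (?j l)) * (x l / of_nat (fact l)) ^ ?j l) = ?R"
        by (rule prod.cong) auto
      have w: "bell_weight m x j = (1 / of_nat (fact (j i)) * (x i / of_nat (fact i)) ^ j i) * ?R"
        unfolding bell_weight_def using i by (subst prod.remove[of _ i]) auto
      have w': "bell_weight m x ?j = (1 / of_nat (fact (j i - 1)) * (x i / of_nat (fact i)) ^ (j i - 1)) * ?R"
        unfolding bell_weight_def R[symmetric] using i by (subst prod.remove[of _ i]) auto
      have "of_nat (j i) * (1 / of_nat (fact (j i)) * (x i / of_nat (fact i)) ^ j i) =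
          x i / of_nat (fact i) * (1 / of_nat (fact (j i - 1)) * (x i / of_nat (fact i)) ^ (j i - 1))"
      proof -
        obtain q where q: "j i = Suc q" using j by (cases "j i") auto
        have "of_nat (Suc q) * (1 / of_nat (fact (Suc q))) = (1 / of_nat (fact q) :: ennreal)"
          unfolding ennreal_divide_fact unfolding ennreal_of_nat_eq_real_of_nat
          by (simp add: ennreal_mult[symmetric] divide_simps del: of_nat_Suc)
        then show ?thesis unfolding q diff_Suc_1 power_Suc mult.assoc[symmetric] by (simp only: mult_ac)
      qed
      then show "x i / of_nat (fact i) * bell_weight m x ?j = of_nat (j i) * bell_weight m x j"
        unfolding w w' mult.assoc[symmetric] by (rule arg_cong[where f="\<lambda>y. y * ?R", symmetric])
    next
      fix j assume j: "j \<in> bell_index m (n - i) k"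
      let ?j = "j(i := Suc (j i))"
      show "?j(i := ?j i - 1) = j" by auto
      have "(\<Sum>l = 1..m. j l) = j i + (\<Sum>l\<in>{1..m} - {i}. j l)"
        "(\<Sum>l = 1..m. l * j l) = i * j i + (\<Sum>l\<in>{1..m} - {i}. l * j l)"
        using i by (auto simp: sum.remove)
      moreover note upd[of "\<lambda>l a. a" j "Suc (j i)"] upd[of "\<lambda>l a. l * a" j "Suc (j i)"]
      ultimately show "?j \<in> ?S"
        using j i True by (auto simp: bell_index_def PiE_iff extensional_def)
    qed
    then show ?thesis using True by (simp add: bell_sum_def sum_distrib_left)
  qed
  finally show ?thesis .
qed

lemma bell_sum_zero: "k > n \<Longrightarrow> bell_sum m x n k = 0"
proof -
  assume "k > n"
  have "bell_index m n k = {}"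
  proof (rule ccontr)
    assume "bell_index m n k \<noteq> {}"
    then obtain j where j: "j \<in> bell_index m n k" by auto
    have "(\<Sum>i = 1..m. j i) \<le> (\<Sum>i = 1..m. i * j i)" by (rule sum_mono) auto
    then show False using j \<open>k > n\<close> by (simp add: bell_index_def)
  qed
  then show ?thesis by (simp add: bell_sum_def)
qed

lemma bell_sum_0:
  assumes "0 < m"
  shows "bell_sum m x n 0 = (if n = 0 then 1 else 0)"
proof -
  have "bell_index m n 0 = (if n = 0 then {restrict (\<lambda>_. 0) {1..m}} else {})"
    by (auto simp: bell_index_def PiE_iff extensional_def fun_eq_iff)
  then show ?thesis by (simp add: bell_sum_def bell_weight_def)
qed

text \<open>In each summand n is written as the sum of all i * j i, and for each i the factor j i is
  resolved by \<open>bell_sum_marked\<close>, which gives 0 for sizes above n.\<close>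

lemma bell_sum_recursion:
  assumes "n \<le> m"
  shows "of_nat n * bell_sum m x n (Suc k) =
    (\<Sum>i = 1..n. of_nat i * (x i / of_nat (fact i)) * bell_sum m x (n - i) k)"
proof -
  have "of_nat n * bell_sum m x n (Suc k) =
      (\<Sum>j\<in>bell_index m n (Suc k). of_nat (\<Sum>i = 1..m. i * j i) * bell_weight m x j)"
    unfolding bell_sum_def sum_distrib_left by (rule sum.cong) (auto simp: bell_index_def)
  also have "\<dots> = (\<Sum>i = 1..m. of_nat i * (\<Sum>j\<in>bell_index m n (Suc k). of_nat (j i) * bell_weight m x j))"
    unfolding of_nat_sum sum_distrib_right sum_distrib_left by (subst sum.swap) (simp add: mult.assoc)
  also have "\<dots> = (\<Sum>i = 1..m. of_nat i * (if i \<le> n then x i / of_nat (fact i) * bell_sum m x (n - i) k else 0))"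
    by (simp only: bell_sum_marked cong: sum.cong)
  also have "\<dots> = (\<Sum>i = 1..n. of_nat i * (if i \<le> n then x i / of_nat (fact i) * bell_sum m x (n - i) k else 0))"
    by (rule sum.mono_neutral_right) (use assms in auto)
  also have "\<dots> = (\<Sum>i = 1..n. of_nat i * (x i / of_nat (fact i)) * bell_sum m x (n - i) k)"
    by (rule sum.cong) (auto simp: mult.assoc)
  finally show ?thesis .
qed

text \<open>In terms of u q = M q / q! and y i = \<kappa> i / i!, the hypothesis is the coefficient
  form of U' = Y' U, that is U = exp(Y) for the generating series; the sums of
  \<open>bell_sum\<close> over k satisfy the same recursion. The only cancellation is of the finite
  nonzero factor q, so infinite values are harmless.\<close>

theorem moment_eq_sum_bell_poly:
  fixes M \<kappa> :: "nat \<Rightarrow> ennreal"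
  assumes M0: "M 0 = 1"
    and rec: "\<And>n. M (Suc n) = (\<Sum>k\<le>n. of_nat (n choose k) * \<kappa> (Suc k) * M (n - k))"
    and "1 \<le> n"
  shows "M n = (\<Sum>k = 1..n. bell_poly n k \<kappa>)"
proof -
  \<comment> \<open>A common number of variables, large enough for every q \<le> n in the induction
    below.\<close>
  let ?m = "n + 1"
  define y where "y i = \<kappa> i / of_nat (fact i)" for i
  define u where "u q = M q / of_nat (fact q)" for q
  have urec: "of_nat (Suc q) * u (Suc q) = (\<Sum>k\<le>q. of_nat (Suc k) * y (Suc k) * u (q - k))" for q
  proof -
    have "of_nat (Suc q) * u (Suc q) = ennreal (1 / fact q) * M (Suc q)"
      unfolding u_def ennreal_divide_fact unfolding ennreal_of_nat_eq_real_of_nat mult.assoc[symmetric]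
      by (simp add: ennreal_mult[symmetric] divide_simps del: of_nat_Suc)
    also have "\<dots> = (\<Sum>k\<le>q. ennreal (1 / fact q * real (q choose k)) * \<kappa> (Suc k) * M (q - k))"
    proof -
      have "ennreal (1 / fact q * real (q choose k)) = ennreal (1 / fact q) * of_nat (q choose k)" for k
        unfolding ennreal_of_nat_eq_real_of_nat by (rule ennreal_mult) auto
      then show ?thesis by (simp only: rec sum_distrib_left mult.assoc)
    qed
    also have "\<dots> = (\<Sum>k\<le>q. of_nat (Suc k) * y (Suc k) * u (q - k))"
    proof (rule sum.cong)
      fix k assume "k \<in> {..q}"
      then have k: "k \<le> q" by simp
      have "1 / fact q * real (q choose k) = 1 / fact k * (1 / fact (q - k) :: real)"
        using binomial_fact[OF k, where 'a=real] by simp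
      also have "\<dots> = real (Suc k) * (1 / fact (Suc k)) * (1 / fact (q - k))"
        by (simp add: divide_simps del: of_nat_Suc)
      finally have c: "1 / fact q * real (q choose k) = real (Suc k) * (1 / fact (Suc k)) * (1 / fact (q - k))" .
      show "ennreal (1 / fact q * real (q choose k)) * \<kappa> (Suc k) * M (q - k) = of_nat (Suc k) * y (Suc k) * u (q - k)"
      proof -
        have mult3: "ennreal (a * b * c) = ennreal a * ennreal b * ennreal c" if "0 \<le> a" "0 \<le> b" "0 \<le> c" for a b c
          using that by (simp add: ennreal_mult)
        have "ennreal (real (Suc k) * (1 / fact (Suc k)) * (1 / fact (q - k))) =
            of_nat (Suc k) * ennreal (1 / fact (Suc k)) * ennreal (1 / fact (q - k))"
          unfolding ennreal_of_nat_eq_real_of_nat by (rule mult3) auto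
        then show ?thesis
          unfolding c u_def y_def ennreal_divide_fact by (simp only: mult_ac)
      qed
    qed simp
    finally show ?thesis .
  qed
  have u: "u q = (\<Sum>k\<le>q. bell_sum ?m \<kappa> q k)" if "q \<le> n" for q
    using that
  proof (induction q rule: less_induct)
    case (less q)
    show ?case
    proof (cases q)
      case 0
      then show ?thesis by (simp add: u_def M0 bell_sum_0)
    next
      case (Suc p)
      have "of_nat q * (\<Sum>k\<le>q. bell_sum ?m \<kappa> q k) = (\<Sum>k\<le>p. of_nat q * bell_sum ?m \<kappa> q (Suc k))"
        unfolding Suc by (subst sum.atMost_Suc_shift) (simp add: bell_sum_0 sum_distrib_left)
      also have "\<dots> = (\<Sum>k\<le>p. \<Sum>i = 1..q. of_nat i * y i * bell_sum ?m \<kappa> (q - i) k)"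
        using less.prems by (simp add: bell_sum_recursion y_def)
      also have "\<dots> = (\<Sum>i = 1..q. of_nat i * y i * (\<Sum>k\<le>p. bell_sum ?m \<kappa> (q - i) k))"
        by (subst sum.swap) (simp add: sum_distrib_left)
      also have "\<dots> = (\<Sum>i = 1..q. of_nat i * y i * u (q - i))"
      proof (rule sum.cong)
        fix i assume i: "i \<in> {1..q}"
        have "(\<Sum>k\<le>p. bell_sum ?m \<kappa> (q - i) k) = (\<Sum>k\<le>q - i. bell_sum ?m \<kappa> (q - i) k)"
          by (rule sum.mono_neutral_right) (use i Suc in \<open>auto simp: bell_sum_zero\<close>)
        also have "\<dots> = u (q - i)" by (rule less.IH[symmetric]) (use i less.prems in auto)
        finally show "of_nat i * y i * (\<Sum>k\<le>p. bell_sum ?m \<kappa> (q - i) k) = of_nat i * y i * u (q - i)" by simp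
      qed simp
      also have "\<dots> = (\<Sum>k\<le>p. of_nat (Suc k) * y (Suc k) * u (p - k))"
        unfolding Suc by (rule sum.reindex_bij_witness[of _ Suc "\<lambda>i. i - 1"]) auto
      also have "\<dots> = of_nat q * u q" unfolding Suc urec ..
      finally show ?thesis
        using Suc by (simp add: ennreal_mult_cancel_left del: of_nat_Suc)
    qed
  qed
  have "M n = of_nat (fact n) * u n"
    unfolding u_def ennreal_divide_fact unfolding ennreal_of_nat_eq_real_of_nat mult.assoc[symmetric]
    by (simp add: ennreal_mult[symmetric])
  also have "\<dots> = (\<Sum>k\<le>n. of_nat (fact n) * bell_sum ?m \<kappa> n k)" by (simp add: u sum_distrib_left)
  also have "\<dots> = (\<Sum>k = 1..n. of_nat (fact n) * bell_sum ?m \<kappa> n k)"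
    by (rule sum.mono_neutral_right) (use \<open>1 \<le> n\<close> in \<open>auto simp: bell_sum_0 not_le\<close>)
  also have "\<dots> = (\<Sum>k = 1..n. bell_poly n k \<kappa>)"
    by (intro sum.cong refl) (simp add: bell_poly_eq, subst bell_sum_extend, auto)
  finally show ?thesis .
qed

text \<open>In every monomial the i * j i add up to n and the j i add up to k, which are its degrees
  in z and c.\<close>

lemma bell_poly_homogeneous:
  "bell_poly n k (\<lambda>i. z ^ i * c * x i) = z ^ n * c ^ k * bell_poly n k x"
proof -
  let ?m = "n - k + 1"
  have "bell_weight ?m (\<lambda>i. z ^ i * c * x i) j = z ^ n * c ^ k * bell_weight ?m x j"
    if j: "j \<in> bell_index ?m n k" for j
  proof -
    have "bell_weight ?m (\<lambda>i. z ^ i * c * x i) j =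
       (\<Prod>i = 1..?m. z ^ (i * j i)) * (\<Prod>i = 1..?m. c ^ j i) * bell_weight ?m x j"
      unfolding bell_weight_def prod.distrib[symmetric]
      unfolding ennreal_divide_fact by (rule prod.cong) (simp_all add: power_mult_distrib power_mult mult_ac)
    then show ?thesis using j by (simp add: bell_index_def power_sum[symmetric] del: prod.cl_ivl_Suc)
  qed
  then show ?thesis
    by (simp add: bell_poly_eq bell_sum_def sum_distrib_left mult_ac cong: sum.cong)
qed

lemma bell_poly_cong:
  assumes "\<And>i. 1 \<le> i \<Longrightarrow> x i = y i"
  shows "bell_poly n k x = bell_poly n k y"
  unfolding bell_poly_def
  by (intro arg_cong2[where f="(*)"] sum.cong prod.cong refl) (use assms in auto)

section \<open>Marked Poisson processes\<close>

abbreviation grid_point :: "real \<Rightarrow> nat \<Rightarrow> nat \<Rightarrow> real" where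
  "grid_point T m j \<equiv> T * real j / real (Suc m)"

text \<open>Uniform continuity bounds the error on each cell by e' times its length, and induction
  over the cells adds this up. Right endpoints match the rounding of jump times in
  \<open>grid_shot_sum\<close>.\<close>

lemma right_riemann_sums_LIMSEQ:
  fixes f :: "real \<Rightarrow> real"
  assumes T: "0 < T" and f: "continuous_on {0..T} f"
  shows "(\<lambda>m. \<Sum>j<Suc m. T / real (Suc m) * f (grid_point T m (Suc j))) \<longlonglongrightarrow> (LINT s:{0..T}|lborel. f s)"
proof -
  have "integral {0..T} f = (LINT s:{0..T}|lborel. f s)"
    using f by (intro set_borel_integral_eq_integral(2)[symmetric] borel_integrable_atLeastAtMost')
  moreover have "(\<lambda>m. \<Sum>j<Suc m. T / real (Suc m) * f (grid_point T m (Suc j))) \<longlonglongrightarrow> integral {0..T} f"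
  proof (rule LIMSEQ_I)
    fix e :: real assume "0 < e"
    define e' where "e' = e / (2 * T)"
    have e': "0 < e'" using T \<open>0 < e\<close> by (simp add: e'_def)
    obtain d where d: "0 < d" "\<And>x y. x \<in> {0..T} \<Longrightarrow> y \<in> {0..T} \<Longrightarrow> dist y x < d \<Longrightarrow> dist (f y) (f x) < e'"
      using compact_uniformly_continuous[OF f] e' unfolding uniformly_continuous_on_def by (metis compact_Icc)
    obtain m0 where m0: "T / d < real m0" using reals_Archimedean2 by blast
    show "\<exists>no. \<forall>m\<ge>no. norm ((\<Sum>j<Suc m. T / real (Suc m) * f (grid_point T m (Suc j))) - integral {0..T} f) < e"
    proof (intro exI allI impI)
      fix m assume "m0 \<le> m"
      define h where "h = T / real (Suc m)"
      have h: "0 < h" "h < d" "h * real (Suc m) = T"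
        using T m0 d(1) \<open>m0 \<le> m\<close> by (auto simp: h_def field_simps) (smt (verit) mult_left_mono of_nat_le_iff)
      have le: "h * real j \<le> T" if "j \<le> Suc m" for j
        using mult_left_mono[of "real j" "real (Suc m)" h] that h(1) unfolding h(3) by simp
      have "\<bar>(\<Sum>i<j. h * f (h * real (Suc i))) - integral {0..h * real j} f\<bar> \<le> e' * (h * real j)" if "j \<le> Suc m" for j
        using that
      proof (induction j)
        case (Suc j)
        let ?a = "h * real j" and ?b = "h * real (Suc j)"
        have ab: "0 \<le> ?a" "?a \<le> ?b" "?b \<le> T" "?b - ?a = h"
          using h le[OF Suc.prems] by (auto simp: algebra_simps)
        have fb: "continuous_on {0..?b} f" "continuous_on {?a..?b} f"
          using ab by (intro continuous_on_subset[OF f]; auto)+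
        have int: "f integrable_on {0..?b}" "f integrable_on {?a..?b}"
          using fb by (auto intro: integrable_continuous_real)
        have "norm (integral {?a..?b} (\<lambda>x. f x - f ?b)) \<le> e' * (?b - ?a)"
        proof (rule integral_bound)
          show "continuous_on {?a..?b} (\<lambda>x. f x - f ?b)"
            by (intro continuous_intros fb)
          fix x assume x: "x \<in> {?a..?b}"
          have "dist (f x) (f ?b) < e'"
            using x ab h(1,2) order_trans[OF ab(1), of x] by (intro d(2)) (auto simp: dist_real_def)
          then show "norm (f x - f ?b) \<le> e'" by (simp add: dist_real_def)
        qed (use ab in simp)
        moreover have "integral {?a..?b} (\<lambda>x. f x - f ?b) = integral {?a..?b} f - h * f ?b"
          using int ab by (subst integral_diff) auto
        moreover have "integral {0..?b} f = integral {0..?a} f + integral {?a..?b} f"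
          using ab int by (intro Henstock_Kurzweil_Integration.integral_combine[symmetric]) auto
        ultimately have "\<bar>((\<Sum>i<Suc j. h * f (h * real (Suc i))) - integral {0..?b} f)
            - ((\<Sum>i<j. h * f (h * real (Suc i))) - integral {0..?a} f)\<bar> \<le> e' * h"
          using ab(4) by (simp add: abs_minus_commute)
        moreover have "e' * ?b = e' * ?a + e' * h" by (simp add: algebra_simps)
        ultimately show ?case using Suc.IH Suc.prems by linarith
      qed simp
      from this[of "Suc m"] have "\<bar>(\<Sum>i<Suc m. h * f (h * real (Suc i))) - integral {0..T} f\<bar> \<le> e' * T"
        using h(3) by simp
      also have "\<dots> < e" using T \<open>0 < e\<close> by (simp add: e'_def)
      finally show "norm ((\<Sum>j<Suc m. T / real (Suc m) * f (grid_point T m (Suc j))) - integral {0..T} f) < e"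
        by (simp add: h_def)
    qed
  qed
  ultimately show ?thesis by simp
qed

lemma prod_blocks:
  fixes k :: "nat \<Rightarrow> nat"
  assumes "mono k"
  shows "(\<Prod>j<m. \<Prod>n\<in>{k j<..k (Suc j)}. f n) = (\<Prod>n\<in>{k 0<..k m}. (f n :: 'a::comm_monoid_mult))"
proof (induction m)
  case (Suc m)
  have "{k 0<..k (Suc m)} = {k 0<..k m} \<union> {k m<..k (Suc m)}"
    using monoD[OF assms, of 0 m] monoD[OF assms, of m "Suc m"] by auto
  then have "(\<Prod>n\<in>{k 0<..k (Suc m)}. f n) = (\<Prod>n\<in>{k 0<..k m}. f n) * (\<Prod>n\<in>{k m<..k (Suc m)}. f n)"
    by (simp only:) (rule prod.union_disjoint, auto)
  then show ?case using Suc by simp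
qed simp

lemma sum_blocks:
  fixes k :: "nat \<Rightarrow> nat"
  assumes "mono k"
  shows "(\<Sum>j<m. \<Sum>n\<in>{k j<..k (Suc j)}. f n) = (\<Sum>n\<in>{k 0<..k m}. (f n :: 'a::comm_monoid_add))"
proof (induction m)
  case (Suc m)
  have "{k 0<..k (Suc m)} = {k 0<..k m} \<union> {k m<..k (Suc m)}"
    using monoD[OF assms, of 0 m] monoD[OF assms, of m "Suc m"] by auto
  then have "(\<Sum>n\<in>{k 0<..k (Suc m)}. f n) = (\<Sum>n\<in>{k 0<..k m}. f n) + (\<Sum>n\<in>{k m<..k (Suc m)}. f n)"
    by (simp only:) (rule sum.union_disjoint, auto)
  then show ?case using Suc by simp
qed simp

text \<open>When k j counts the jumps up to the j-th grid point, this is the index of the cell that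
  contains the n-th jump.\<close>

definition block_of :: "(nat \<Rightarrow> nat) \<Rightarrow> nat \<Rightarrow> nat" where
  "block_of k n = (LEAST j. n \<le> k (Suc j))"

lemma block_of_eq:
  assumes "mono k" "n \<in> {k j<..k (Suc j)}"
  shows "block_of k n = j"
  unfolding block_of_def
proof (rule Least_equality)
  fix i assume "n \<le> k (Suc i)"
  then have "k j < k (Suc i)" using assms(2) by simp
  then show "j \<le> i" using monoD[OF assms(1), of "Suc i" j] by (metis leD not_less_eq_eq)
qed (use assms in simp)

lemma block_of_in:
  assumes "n \<in> {k 0<..k m}"
  shows "block_of k n < m" "n \<in> {k (block_of k n)<..k (Suc (block_of k n))}"
proof -
  have "m \<noteq> 0" using assms by (cases m) auto
  then have m: "n \<le> k (Suc (m - 1))" using assms by simp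
  show "block_of k n < m" unfolding block_of_def using Least_le[of "\<lambda>j. n \<le> k (Suc j)", OF m] \<open>m \<noteq> 0\<close> by linarith
  have up: "n \<le> k (Suc (block_of k n))" unfolding block_of_def using LeastI[of "\<lambda>j. n \<le> k (Suc j)", OF m] .
  have "k (block_of k n) < n"
  proof (cases "block_of k n")
    case (Suc i)
    then show ?thesis using not_less_Least[of i "\<lambda>j. n \<le> k (Suc j)"] by (auto simp: block_of_def)
  qed (use assms in simp)
  then show "n \<in> {k (block_of k n)<..k (Suc (block_of k n))}" using up by simp
qed

section \<open>The marked Poisson process and its Laplace transforms on a grid\<close>

locale marked_poisson = prob_space \<Omega> for \<Omega> :: "'w measure" +
  fixes N :: "real \<Rightarrow> 'w \<Rightarrow> nat" and P :: "nat \<Rightarrow> 'w \<Rightarrow> real" and lam :: real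
  assumes lam_pos: "0 < lam"
    and poisson: "poisson_process \<Omega> lam N"
    and marks_indep: "indep_vars (\<lambda>_. borel) P {1..}"
    and marks_distr: "\<And>n. 1 \<le> n \<Longrightarrow> distr \<Omega> borel (P n) = distr \<Omega> borel (P 1)"
    and marks_pos: "\<And>n. 1 \<le> n \<Longrightarrow> AE \<omega> in \<Omega>. 0 < P n \<omega>"
    and indep: "indep_set (sigma_generated \<Omega> {0..} N (count_space UNIV)) (sigma_generated \<Omega> {1..} P borel)"
begin

lemma N_measurable [measurable]: "0 \<le> t \<Longrightarrow> N t \<in> measurable \<Omega> (count_space UNIV)"
  using poisson by (auto simp: poisson_process_def)

lemma N_0: "\<omega> \<in> space \<Omega> \<Longrightarrow> N 0 \<omega> = 0"
  using poisson by (auto simp: poisson_process_def)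

lemma N_mono: "\<omega> \<in> space \<Omega> \<Longrightarrow> 0 \<le> s \<Longrightarrow> s \<le> t \<Longrightarrow> N s \<omega> \<le> N t \<omega>"
  using poisson by (auto simp: poisson_process_def)

lemma P_measurable [measurable]: "1 \<le> n \<Longrightarrow> P n \<in> borel_measurable \<Omega>"
  using marks_indep by (auto simp: indep_vars_def)

lemma AE_marks_pos: "AE \<omega> in \<Omega>. \<forall>n\<ge>1. 0 < P n \<omega>"
  using marks_pos by (auto simp: AE_all_countable)

definition mark_laplace :: "real \<Rightarrow> real" where
  "mark_laplace q = expectation (\<lambda>\<omega>. exp (- q * P 1 \<omega>))"

lemma integrable_mark_exp: "0 \<le> q \<Longrightarrow> integrable \<Omega> (\<lambda>\<omega>. exp (- q * P 1 \<omega>))"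
  using marks_pos[of 1] by (intro integrable_const_bound[where B=1]) (auto elim!: eventually_mono)

lemma mark_laplace_bounds:
  assumes "0 \<le> q"
  shows "0 \<le> mark_laplace q" "mark_laplace q \<le> 1"
proof -
  show "0 \<le> mark_laplace q" unfolding mark_laplace_def by simp
  have "mark_laplace q \<le> expectation (\<lambda>\<omega>. 1)"
    unfolding mark_laplace_def using marks_pos[of 1] assms
    by (intro integral_mono_AE integrable_mark_exp) (auto elim!: eventually_mono)
  then show "mark_laplace q \<le> 1" by (simp add: prob_space)
qed

lemma nn_integral_mark_exp:
  assumes "0 \<le> q" "1 \<le> n"
  shows "(\<integral>\<^sup>+\<omega>. ennreal (exp (- q * P n \<omega>)) \<partial>\<Omega>) = ennreal (mark_laplace q)"
proof -
  have "(\<integral>\<^sup>+\<omega>. ennreal (exp (- q * P n \<omega>)) \<partial>\<Omega>) = (\<integral>\<^sup>+x. ennreal (exp (- q * x)) \<partial>distr \<Omega> borel (P n))"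
    using assms by (subst nn_integral_distr) auto
  also have "\<dots> = (\<integral>\<^sup>+\<omega>. ennreal (exp (- q * P 1 \<omega>)) \<partial>\<Omega>)"
    unfolding marks_distr[OF assms(2)] by (subst nn_integral_distr) auto
  also have "\<dots> = ennreal (mark_laplace q)"
    unfolding mark_laplace_def using assms(1) by (intro nn_integral_eq_integral integrable_mark_exp) auto
  finally show ?thesis .
qed

lemma continuous_on_mark_laplace: "continuous_on {0..} mark_laplace"
proof (rule continuous_on_sequentiallyI)
  fix u :: "nat \<Rightarrow> real" and a assume u: "\<forall>n. u n \<in> {0..}" "a \<in> {0..}" "u \<longlonglongrightarrow> a"
  show "(\<lambda>n. mark_laplace (u n)) \<longlonglongrightarrow> mark_laplace a"
    unfolding mark_laplace_def
  proof (rule integral_dominated_convergence[where w="\<lambda>_. 1"])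
    show "AE \<omega> in \<Omega>. (\<lambda>n. exp (- u n * P 1 \<omega>)) \<longlonglongrightarrow> exp (- a * P 1 \<omega>)"
      using u(3) by (auto intro!: tendsto_intros)
    show "AE \<omega> in \<Omega>. norm (exp (- u n * P 1 \<omega>)) \<le> 1" for n
      using marks_pos[of 1] u(1) by (auto elim!: eventually_mono)
  qed auto
qed

text \<open>Independence of the two sigma-algebras makes the joint law of counting path and marks a
  product measure, since the two agree on rectangles. Fubini then integrates over the marks, taken
  at a fresh \<omega>', with the path frozen.\<close>

lemma joint_nn_integral:
  assumes F [measurable]: "F \<in> borel_measurable ((\<Pi>\<^sub>M t\<in>{0..}. count_space UNIV) \<Otimes>\<^sub>M (\<Pi>\<^sub>M n\<in>{1..}. borel))"
  shows "(\<integral>\<^sup>+\<omega>. F (\<lambda>t\<in>{0..}. N t \<omega>, \<lambda>n\<in>{1..}. P n \<omega>) \<partial>\<Omega>) =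
    (\<integral>\<^sup>+\<omega>. \<integral>\<^sup>+\<omega>'. F (\<lambda>t\<in>{0..}. N t \<omega>, \<lambda>n\<in>{1..}. P n \<omega>') \<partial>\<Omega> \<partial>\<Omega>)"
proof -
  let ?M1 = "(\<Pi>\<^sub>M t\<in>{0..}. count_space UNIV) :: (real \<Rightarrow> nat) measure"
  let ?M2 = "(\<Pi>\<^sub>M n\<in>{1..}. borel) :: (nat \<Rightarrow> real) measure"
  let ?X = "\<lambda>\<omega>. \<lambda>t\<in>{0..}. N t \<omega>" and ?Y = "\<lambda>\<omega>. \<lambda>n\<in>{1..}. P n \<omega>"
  have X [measurable]: "?X \<in> measurable \<Omega> ?M1" and Y [measurable]: "?Y \<in> measurable \<Omega> ?M2"
    by (auto intro!: measurable_restrict)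
  interpret D1: prob_space "distr \<Omega> ?M1 ?X" by (rule prob_space_distr) (rule X)
  interpret D2: prob_space "distr \<Omega> ?M2 ?Y" by (rule prob_space_distr) (rule Y)
  have eq: "distr \<Omega> ?M1 ?X \<Otimes>\<^sub>M distr \<Omega> ?M2 ?Y = distr \<Omega> (?M1 \<Otimes>\<^sub>M ?M2) (\<lambda>\<omega>. (?X \<omega>, ?Y \<omega>))"
  proof (rule pair_measure_eqI)
    fix A B assume "A \<in> sets (distr \<Omega> ?M1 ?X)" "B \<in> sets (distr \<Omega> ?M2 ?Y)"
    then have A [measurable]: "A \<in> sets ?M1" and B [measurable]: "B \<in> sets ?M2" by auto
    have "?X -` A \<inter> space \<Omega> \<in> sigma_generated \<Omega> {0..} N (count_space UNIV)"
      "?Y -` B \<inter> space \<Omega> \<in> sigma_generated \<Omega> {1..} P borel"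
      unfolding sigma_generated_def by (rule in_vimage_algebra; fact)+
    then have "prob ((?X -` A \<inter> space \<Omega>) \<inter> (?Y -` B \<inter> space \<Omega>)) =
        prob (?X -` A \<inter> space \<Omega>) * prob (?Y -` B \<inter> space \<Omega>)"
      by (rule indep_setD[OF indep])
    moreover have "(\<lambda>\<omega>. (?X \<omega>, ?Y \<omega>)) -` (A \<times> B) \<inter> space \<Omega> = (?X -` A \<inter> space \<Omega>) \<inter> (?Y -` B \<inter> space \<Omega>)"
      by auto
    ultimately show "emeasure (distr \<Omega> ?M1 ?X) A * emeasure (distr \<Omega> ?M2 ?Y) B =
        emeasure (distr \<Omega> (?M1 \<Otimes>\<^sub>M ?M2) (\<lambda>\<omega>. (?X \<omega>, ?Y \<omega>))) (A \<times> B)"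
      unfolding emeasure_distr[OF X A] emeasure_distr[OF Y B]
      by (subst emeasure_distr) (use X Y in \<open>simp_all add: emeasure_eq_measure ennreal_mult del: One_nat_def\<close>)
  qed (use D1.sigma_finite_measure_axioms D2.sigma_finite_measure_axioms in \<open>simp_all del: One_nat_def\<close>)
  interpret D: pair_prob_space "distr \<Omega> ?M1 ?X" "distr \<Omega> ?M2 ?Y" ..
  have "(\<integral>\<^sup>+\<omega>. F (?X \<omega>, ?Y \<omega>) \<partial>\<Omega>) = (\<integral>\<^sup>+z. F z \<partial>distr \<Omega> (?M1 \<Otimes>\<^sub>M ?M2) (\<lambda>\<omega>. (?X \<omega>, ?Y \<omega>)))"
    by (rule nn_integral_distr[OF measurable_Pair[OF X Y], symmetric]) (simp only: measurable_distr_eq1, rule F)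
  also have "\<dots> = (\<integral>\<^sup>+x. \<integral>\<^sup>+y. F (x, y) \<partial>distr \<Omega> ?M2 ?Y \<partial>distr \<Omega> ?M1 ?X)"
    unfolding eq[symmetric]
  proof (rule D2.nn_integral_fst[symmetric])
    show "F \<in> borel_measurable (distr \<Omega> ?M1 ?X \<Otimes>\<^sub>M distr \<Omega> ?M2 ?Y)"
      using F by (subst measurable_cong_sets[OF sets_pair_measure_cong[OF sets_distr sets_distr] refl])
  qed
  also have "\<dots> = (\<integral>\<^sup>+x. \<integral>\<^sup>+\<omega>'. F (x, ?Y \<omega>') \<partial>\<Omega> \<partial>distr \<Omega> ?M1 ?X)"
  proof (rule nn_integral_cong)
    fix x assume "x \<in> space (distr \<Omega> ?M1 ?X)"
    then have "x \<in> space ?M1" by simp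
    then show "(\<integral>\<^sup>+y. F (x, y) \<partial>distr \<Omega> ?M2 ?Y) = (\<integral>\<^sup>+\<omega>'. F (x, ?Y \<omega>') \<partial>\<Omega>)"
      by (intro nn_integral_distr Y, simp only: measurable_distr_eq1) (intro measurable_compose[OF measurable_Pair1' F])
  qed
  also have "\<dots> = (\<integral>\<^sup>+\<omega>. \<integral>\<^sup>+\<omega>'. F (?X \<omega>, ?Y \<omega>') \<partial>\<Omega> \<partial>\<Omega>)"
  proof (rule nn_integral_distr[OF X])
    have "(\<lambda>z. F (fst z, ?Y (snd z))) \<in> borel_measurable (?M1 \<Otimes>\<^sub>M \<Omega>)"
      by (intro measurable_compose[OF _ F] measurable_Pair measurable_fst measurable_compose[OF measurable_snd Y])
    then show "(\<lambda>x. \<integral>\<^sup>+\<omega>'. F (x, ?Y \<omega>') \<partial>\<Omega>) \<in> borel_measurable (distr \<Omega> ?M1 ?X)"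
      unfolding measurable_distr_eq1
      using borel_measurable_nn_integral[of "\<lambda>x \<omega>'. F (x, ?Y \<omega>')" ?M1] by (simp add: case_prod_beta' del: One_nat_def)
  qed
  finally show ?thesis .
qed

lemma nn_integral_marks_prod:
  assumes "finite I" "I \<subseteq> {1..}" "\<And>n. n \<in> I \<Longrightarrow> 0 \<le> c n"
  shows "(\<integral>\<^sup>+\<omega>. (\<Prod>n\<in>I. ennreal (exp (- c n * P n \<omega>))) \<partial>\<Omega>) = (\<Prod>n\<in>I. ennreal (mark_laplace (c n)))"
proof -
  have "indep_vars (\<lambda>_. borel) (\<lambda>n \<omega>. ennreal (exp (- c n * P n \<omega>))) I"
    by (rule indep_vars_compose2[where Y="\<lambda>n x. ennreal (exp (- c n * x))", OF indep_vars_subset[OF marks_indep assms(2)]]) auto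
  then have "(\<integral>\<^sup>+\<omega>. (\<Prod>n\<in>I. ennreal (exp (- c n * P n \<omega>))) \<partial>\<Omega>) = (\<Prod>n\<in>I. \<integral>\<^sup>+\<omega>. ennreal (exp (- c n * P n \<omega>)) \<partial>\<Omega>)"
    using assms(1) by (intro indep_vars_nn_integral) auto
  also have "\<dots> = (\<Prod>n\<in>I. ennreal (mark_laplace (c n)))"
    using assms by (intro prod.cong refl nn_integral_mark_exp) auto
  finally show ?thesis .
qed

lemma nn_integral_increment_power:
  assumes "0 \<le> s" "s < t" "0 \<le> x"
  shows "(\<integral>\<^sup>+\<omega>. ennreal x ^ (N t \<omega> - N s \<omega>) \<partial>\<Omega>) = ennreal (exp (- (lam * (t - s) * (1 - x))))"
proof -
  define r where "r = lam * (t - s)"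
  have r: "0 < r" using assms lam_pos by (simp add: r_def)
  have [measurable]: "(\<lambda>\<omega>. N t \<omega> - N s \<omega>) \<in> measurable \<Omega> (count_space UNIV)"
  proof -
    have "N s \<in> measurable \<Omega> (count_space UNIV)" "N t \<in> measurable \<Omega> (count_space UNIV)"
      using assms by auto
    then show ?thesis by measurable
  qed
  have "(\<integral>\<^sup>+\<omega>. ennreal x ^ (N t \<omega> - N s \<omega>) \<partial>\<Omega>) = (\<integral>\<^sup>+n. ennreal x ^ n \<partial>distr \<Omega> (count_space UNIV) (\<lambda>\<omega>. N t \<omega> - N s \<omega>))"
    by (subst nn_integral_distr) auto
  also have "distr \<Omega> (count_space UNIV) (\<lambda>\<omega>. N t \<omega> - N s \<omega>) = measure_pmf (poisson_pmf r)"
    using poisson assms by (auto simp: poisson_process_def r_def)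
  also have "(\<integral>\<^sup>+n. ennreal x ^ n \<partial>measure_pmf (poisson_pmf r)) = (\<Sum>n. ennreal (pmf (poisson_pmf r) n) * ennreal x ^ n)"
    by (simp add: nn_integral_measure_pmf nn_integral_count_space_nat)
  also have "\<dots> = (\<Sum>n. ennreal (inverse (fact n) * (r * x) ^ n * exp (- r)))"
    using r assms(3) by (intro suminf_cong)
      (simp add: ennreal_power ennreal_mult[symmetric] power_mult_distrib field_simps)
  also have "\<dots> = ennreal (exp (r * x) * exp (- r))"
  proof (rule suminf_ennreal_eq)
    show "(\<lambda>n. inverse (fact n) * (r * x) ^ n * exp (- r)) sums (exp (r * x) * exp (- r))"
      using exp_converges[of "r * x"] by (intro sums_mult2) simp
  qed (use r assms(3) in auto)
  also have "exp (r * x) * exp (- r) = exp (- (r * (1 - x)))"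
    by (simp add: exp_add[symmetric] algebra_simps)
  finally show ?thesis unfolding r_def .
qed

text \<open>With the counting path frozen, each jump in cell j contributes one factor
  \<open>mark_laplace (w j)\<close>. What remains is a product of powers over independent
  increments, so the Poisson generating functions multiply.\<close>

lemma laplace_grid:
  fixes t :: "nat \<Rightarrow> real"
  assumes t: "0 \<le> t 0" "strict_mono t" and w: "\<And>j. j < m \<Longrightarrow> 0 \<le> w j"
  shows "(\<integral>\<^sup>+\<omega>. (\<Prod>j<m. \<Prod>n\<in>{N (t j) \<omega><..N (t (Suc j)) \<omega>}. ennreal (exp (- w j * P n \<omega>))) \<partial>\<Omega>) =
    ennreal (exp (- (\<Sum>j<m. lam * (t (Suc j) - t j) * (1 - mark_laplace (w j)))))"
proof -
  have t0: "0 \<le> t j" for j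
    using t strict_mono_less_eq[OF t(2), of 0 j] by simp
  have tle: "t i \<le> t j" if "i \<le> j" for i j using strict_mono_less_eq[OF t(2)] that by simp
  have tlt: "t i < t (Suc i)" for i using t(2) by (simp add: strict_mono_Suc_iff)
  let ?M1 = "(\<Pi>\<^sub>M t\<in>{0..}. count_space UNIV) :: (real \<Rightarrow> nat) measure"
  let ?M2 = "(\<Pi>\<^sub>M n\<in>{1..}. borel) :: (nat \<Rightarrow> real) measure"
  define F :: "(real \<Rightarrow> nat) \<times> (nat \<Rightarrow> real) \<Rightarrow> ennreal" where
    "F z = (\<Prod>j<m. \<Prod>n\<in>{fst z (t j)<..fst z (t (Suc j))}. ennreal (exp (- w j * snd z n)))" for z
  have [measurable]: "F \<in> borel_measurable (?M1 \<Otimes>\<^sub>M ?M2)"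
  proof -
    have c [measurable]: "(\<lambda>z. fst z (t j)) \<in> measurable (?M1 \<Otimes>\<^sub>M ?M2) (count_space UNIV)" for j
      using t0[of j] by (intro measurable_compose[OF measurable_fst measurable_component_singleton]) auto
    \<comment> \<open>The range of the product depends on the path. It is frozen at fixed a and b
      first; the two random endpoints are substituted afterwards, one at a time, as countably valued
      maps.\<close>
    have "(\<lambda>z. \<Prod>n\<in>{a<..b}. ennreal (exp (- w j * snd z n))) \<in> borel_measurable (?M1 \<Otimes>\<^sub>M ?M2)" for a b j
    proof (rule borel_measurable_prod_ennreal)
      fix n assume "n \<in> {a<..b}"
      then have "(\<lambda>z. snd z n) \<in> borel_measurable (?M1 \<Otimes>\<^sub>M ?M2)"
        by (intro measurable_compose[OF measurable_snd measurable_component_singleton]) auto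
      then show "(\<lambda>z. ennreal (exp (- w j * snd z n))) \<in> borel_measurable (?M1 \<Otimes>\<^sub>M ?M2)" by measurable
    qed
    then have "(\<lambda>z. \<Prod>n\<in>{a<..fst z (t (Suc j))}. ennreal (exp (- w j * snd z n))) \<in> borel_measurable (?M1 \<Otimes>\<^sub>M ?M2)" for a j
      by (rule measurable_compose_countable) (rule c)
    then have "(\<lambda>z. \<Prod>n\<in>{fst z (t j)<..fst z (t (Suc j))}. ennreal (exp (- w j * snd z n))) \<in> borel_measurable (?M1 \<Otimes>\<^sub>M ?M2)" for j
      by (rule measurable_compose_countable) (rule c)
    then show ?thesis unfolding F_def by (intro borel_measurable_prod_ennreal)
  qed
  have "(\<integral>\<^sup>+\<omega>. (\<Prod>j<m. \<Prod>n\<in>{N (t j) \<omega><..N (t (Suc j)) \<omega>}. ennreal (exp (- w j * P n \<omega>))) \<partial>\<Omega>) =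
      (\<integral>\<^sup>+\<omega>. F (\<lambda>t\<in>{0..}. N t \<omega>, \<lambda>n\<in>{1..}. P n \<omega>) \<partial>\<Omega>)"
    by (intro nn_integral_cong) (auto simp: F_def t0 intro!: prod.cong)
  also have "\<dots> = (\<integral>\<^sup>+\<omega>. \<integral>\<^sup>+\<omega>'. F (\<lambda>t\<in>{0..}. N t \<omega>, \<lambda>n\<in>{1..}. P n \<omega>') \<partial>\<Omega> \<partial>\<Omega>)"
    by (rule joint_nn_integral) measurable
  also have "\<dots> = (\<integral>\<^sup>+\<omega>. (\<Prod>j<m. ennreal (mark_laplace (w j)) ^ (N (t (Suc j)) \<omega> - N (t j) \<omega>)) \<partial>\<Omega>)"
  proof (rule nn_integral_cong)
    fix \<omega> assume \<omega>: "\<omega> \<in> space \<Omega>"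
    define k where "k j = N (t j) \<omega>" for j
    have k: "mono k" unfolding k_def by (intro monoI N_mono \<omega> t0 tle)
    let ?J = "block_of k"
    \<comment> \<open>The double product over cells becomes a single product over jumps, each
      labelled by its cell, to which independence of the marks applies.\<close>
    have blocks: "(\<Prod>j<m. \<Prod>n\<in>{k j<..k (Suc j)}. f j n) = (\<Prod>n\<in>{k 0<..k m}. f (?J n) n)" for f :: "nat \<Rightarrow> nat \<Rightarrow> ennreal"
      unfolding prod_blocks[OF k, symmetric] using block_of_eq[OF k] by (intro prod.cong refl) auto
    have "(\<integral>\<^sup>+\<omega>'. F (\<lambda>t\<in>{0..}. N t \<omega>, \<lambda>n\<in>{1..}. P n \<omega>') \<partial>\<Omega>) =
        (\<integral>\<^sup>+\<omega>'. (\<Prod>j<m. \<Prod>n\<in>{k j<..k (Suc j)}. ennreal (exp (- w j * P n \<omega>'))) \<partial>\<Omega>)"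
      by (intro nn_integral_cong) (auto simp: F_def t0 k_def intro!: prod.cong)
    also have "\<dots> = (\<integral>\<^sup>+\<omega>'. (\<Prod>n\<in>{k 0<..k m}. ennreal (exp (- w (?J n) * P n \<omega>'))) \<partial>\<Omega>)"
      by (simp only: blocks)
    also have "\<dots> = (\<Prod>n\<in>{k 0<..k m}. ennreal (mark_laplace (w (?J n))))"
      using block_of_in(1)[of _ k m] w by (intro nn_integral_marks_prod) auto
    also have "\<dots> = (\<Prod>j<m. \<Prod>n\<in>{k j<..k (Suc j)}. ennreal (mark_laplace (w j)))"
      by (simp only: blocks)
    finally show "(\<integral>\<^sup>+\<omega>'. F (\<lambda>t\<in>{0..}. N t \<omega>, \<lambda>n\<in>{1..}. P n \<omega>') \<partial>\<Omega>) =
        (\<Prod>j<m. ennreal (mark_laplace (w j)) ^ (N (t (Suc j)) \<omega> - N (t j) \<omega>))"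
      by (simp add: k_def)
  qed
  also have "\<dots> = (\<Prod>j<m. \<integral>\<^sup>+\<omega>. ennreal (mark_laplace (w j)) ^ (N (t (Suc j)) \<omega> - N (t j) \<omega>) \<partial>\<Omega>)"
  proof (rule indep_vars_nn_integral)
    have "indep_vars (\<lambda>_. count_space UNIV) (\<lambda>i \<omega>. N (t (Suc i)) \<omega> - N (t i) \<omega>) {..<m}"
      using poisson t(1) tle unfolding poisson_process_def mono_def by blast
    then show "indep_vars (\<lambda>_. borel) (\<lambda>j \<omega>. ennreal (mark_laplace (w j)) ^ (N (t (Suc j)) \<omega> - N (t j) \<omega>)) {..<m}"
      by (rule indep_vars_compose2[where Y="\<lambda>j n. ennreal (mark_laplace (w j)) ^ n"]) auto
  qed auto
  also have "\<dots> = (\<Prod>j<m. ennreal (exp (- (lam * (t (Suc j) - t j) * (1 - mark_laplace (w j))))))"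
    using t0 tlt mark_laplace_bounds(1) w by (intro prod.cong refl nn_integral_increment_power) auto
  also have "\<dots> = ennreal (exp (- (\<Sum>j<m. lam * (t (Suc j) - t j) * (1 - mark_laplace (w j)))))"
    by (simp add: prod_ennreal exp_sum[symmetric] sum_negf)
  finally show ?thesis .
qed

section \<open>Jump times and their approximation by a grid\<close>

lemma jump_time_bounds:
  assumes "\<omega> \<in> space \<Omega>" "0 \<le> s" "s \<le> u" "n \<in> {N s \<omega><..N u \<omega>}"
  shows "s \<le> jump_time N n \<omega>" "jump_time N n \<omega> \<le> u"
proof -
  have "bdd_below {t. 0 \<le> t \<and> n \<le> N t \<omega>}" by (rule bdd_belowI[of _ 0]) auto
  then show "jump_time N n \<omega> \<le> u"
    unfolding jump_time_def using assms by (intro cInf_lower) auto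
  show "s \<le> jump_time N n \<omega>"
    unfolding jump_time_def
  proof (rule cInf_greatest)
    show "{t. 0 \<le> t \<and> n \<le> N t \<omega>} \<noteq> {}" using assms by (auto intro!: exI[of _ u])
    fix t assume "t \<in> {t. 0 \<le> t \<and> n \<le> N t \<omega>}"
    then show "s \<le> t" using N_mono[OF assms(1), of t s] assms by (cases "t \<le> s") auto
  qed
qed

text \<open>The kernel is evaluated at the jump time itself: the kernel h(t - s) yields the noise at
  time t, while h yields its time reversal.\<close>

definition shot_sum :: "(real \<Rightarrow> real) \<Rightarrow> real \<Rightarrow> 'w \<Rightarrow> real" where
  "shot_sum w t \<omega> = (\<Sum>n = 1..N t \<omega>. w (jump_time N n \<omega>) * P n \<omega>)"

definition grid_shot_sum :: "(real \<Rightarrow> real) \<Rightarrow> real \<Rightarrow> nat \<Rightarrow> 'w \<Rightarrow> real" where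
  "grid_shot_sum w T m \<omega> = (\<Sum>j<Suc m. \<Sum>n\<in>{N (grid_point T m j) \<omega><..N (grid_point T m (Suc j)) \<omega>}.
     w (grid_point T m (Suc j)) * P n \<omega>)"

text \<open>Up to time T there are finitely many jumps, and rounding each of them up to a grid point
  moves it by at most T / (m + 1); continuity of w gives convergence term by term.\<close>

lemma grid_shot_sum_LIMSEQ:
  assumes "\<omega> \<in> space \<Omega>" "0 \<le> T" "continuous_on {0..T} w"
  shows "(\<lambda>m. grid_shot_sum w T m \<omega>) \<longlonglongrightarrow> shot_sum w T \<omega>"
proof -
  define t where "t m j = grid_point T m j" for m j
  define k where "k m j = N (t m j) \<omega>" for m j
  have t: "0 \<le> t m j" "i \<le> j \<Longrightarrow> t m i \<le> t m j" "t m 0 = 0" "t m (Suc m) = T" "t m (Suc j) - t m j = T / real (Suc m)" for m i j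
  proof -
    show "i \<le> j \<Longrightarrow> t m i \<le> t m j" using assms(2) unfolding t_def by (intro divide_right_mono mult_left_mono) auto
    show "t m (Suc m) = T" unfolding t_def by simp
    show "t m (Suc j) - t m j = T / real (Suc m)"
      unfolding t_def diff_divide_distrib[symmetric] by (simp add: algebra_simps)
  qed (use assms(2) in \<open>auto simp: t_def\<close>)
  have k: "mono (k m)" for m unfolding k_def by (intro monoI N_mono assms t)
  have k0: "k m 0 = 0" "k m (Suc m) = N T \<omega>" for m
    by (simp_all only: k_def t N_0[OF assms(1)])
  define \<tau> where "\<tau> m n = t m (Suc (block_of (k m) n))" for m n
  have "grid_shot_sum w T m \<omega> = (\<Sum>n = 1..N T \<omega>. w (\<tau> m n) * P n \<omega>)" for m
  proof -
    have "grid_shot_sum w T m \<omega> = (\<Sum>j<Suc m. \<Sum>n\<in>{k m j<..k m (Suc j)}. w (\<tau> m n) * P n \<omega>)"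
      unfolding grid_shot_sum_def k_def[symmetric] t_def[symmetric]
      by (intro sum.cong refl) (simp add: \<tau>_def block_of_eq[OF k])
    also have "\<dots> = (\<Sum>n\<in>{k m 0<..k m (Suc m)}. w (\<tau> m n) * P n \<omega>)" by (rule sum_blocks[OF k])
    also have "{k m 0<..k m (Suc m)} = {1..N T \<omega>}" unfolding k0 by auto
    finally show ?thesis .
  qed
  moreover have "(\<lambda>m. w (\<tau> m n)) \<longlonglongrightarrow> w (jump_time N n \<omega>)" if n: "n \<in> {1..N T \<omega>}" for n
  proof -
    have b: "block_of (k m) n < Suc m" "n \<in> {k m (block_of (k m) n)<..k m (Suc (block_of (k m) n))}" for m
      using block_of_in[of n "k m" "Suc m"] n by (auto simp: k0)
    have j: "t m (block_of (k m) n) \<le> jump_time N n \<omega>" "jump_time N n \<omega> \<le> \<tau> m n" for m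
      using jump_time_bounds[OF assms(1) t(1) t(2), of "block_of (k m) n" "Suc (block_of (k m) n)" n m] b(2)[of m]
      by (auto simp: \<tau>_def k_def)
    have \<tau>T: "\<tau> m n \<in> {0..T}" for m
      using t(1) t(2)[of "Suc (block_of (k m) n)" "Suc m" m] b(1)[of m] by (auto simp: \<tau>_def t(4))
    have jT: "jump_time N n \<omega> \<in> {0..T}"
      using j[of 0] t(1)[of 0 "block_of (k 0) n"] \<tau>T[of 0] by auto
    have "(\<lambda>m. \<tau> m n) \<longlonglongrightarrow> jump_time N n \<omega>"
    proof (rule tendsto_sandwich)
      show "eventually (\<lambda>m. jump_time N n \<omega> \<le> \<tau> m n) sequentially" using j by simp
      show "eventually (\<lambda>m. \<tau> m n \<le> jump_time N n \<omega> + T / real (Suc m)) sequentially"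
        using j(1) t(5) by (intro always_eventually allI) (metis \<tau>_def add.commute add_le_cancel_left diff_add_cancel)
      have "(\<lambda>m. T / real (Suc m)) \<longlonglongrightarrow> 0" by (rule LIMSEQ_Suc) (rule lim_const_over_n)
      then show "(\<lambda>m. jump_time N n \<omega> + T / real (Suc m)) \<longlonglongrightarrow> jump_time N n \<omega>"
        using tendsto_add[OF tendsto_const[of "jump_time N n \<omega>"]] by fastforce
    qed simp
    then show ?thesis
      by (rule continuous_on_tendsto_compose[OF assms(3)]) (use jT \<tau>T in auto)
  qed
  ultimately show ?thesis
    unfolding shot_sum_def by (auto intro!: tendsto_sum tendsto_mult)
qed

lemma grid_shot_sum_measurable [measurable]:
  assumes "0 \<le> T"
  shows "grid_shot_sum w T m \<in> borel_measurable \<Omega>"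
proof -
  have c: "N (grid_point T m j) \<in> measurable \<Omega> (count_space UNIV)" for j
    using assms by (intro N_measurable) auto
  have "(\<lambda>\<omega>. \<Sum>n\<in>{a<..b}. c * P n \<omega>) \<in> borel_measurable \<Omega>" for a b c
    by (intro borel_measurable_sum borel_measurable_times borel_measurable_const P_measurable) auto
  then have "(\<lambda>\<omega>. \<Sum>n\<in>{a<..N (grid_point T m j) \<omega>}. c * P n \<omega>) \<in> borel_measurable \<Omega>" for a c j
    by (rule measurable_compose_countable) (rule c)
  then have "(\<lambda>\<omega>. \<Sum>n\<in>{N (grid_point T m i) \<omega><..N (grid_point T m j) \<omega>}. c * P n \<omega>) \<in> borel_measurable \<Omega>" for i j c
    by (rule measurable_compose_countable) (rule c)
  then show ?thesis unfolding grid_shot_sum_def[abs_def] by (intro borel_measurable_sum)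
qed

lemma shot_sum_measurable:
  assumes "0 \<le> T" "continuous_on {0..T} w"
  shows "shot_sum w T \<in> borel_measurable \<Omega>"
  by (rule borel_measurable_LIMSEQ_real[where u="grid_shot_sum w T"])
     (use assms in \<open>auto intro: grid_shot_sum_LIMSEQ\<close>)

text \<open>The exponential form of Campbell's formula on a bounded interval. The expectation passes
  to the limit by dominated convergence, the exponent by convergence of Riemann sums.\<close>

theorem laplace_shot_sum:
  assumes T: "0 < T" and w: "continuous_on {0..T} w" "\<And>s. s \<in> {0..T} \<Longrightarrow> 0 \<le> w s"
  shows "(\<integral>\<^sup>+\<omega>. ennreal (exp (- shot_sum w T \<omega>)) \<partial>\<Omega>) =
    ennreal (exp (- lam * (LINT s:{0..T}|lborel. 1 - mark_laplace (w s))))"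
proof (rule LIMSEQ_unique)
  have inT: "grid_point T m (Suc j) \<in> {0..T}" if "j < Suc m" for j m
    using T that by (auto simp: field_simps)
  show "(\<lambda>m. \<integral>\<^sup>+\<omega>. ennreal (exp (- grid_shot_sum w T m \<omega>)) \<partial>\<Omega>) \<longlonglongrightarrow> (\<integral>\<^sup>+\<omega>. ennreal (exp (- shot_sum w T \<omega>)) \<partial>\<Omega>)"
  proof (rule nn_integral_dominated_convergence[where w="\<lambda>_. 1"])
    show "(\<lambda>\<omega>. ennreal (exp (- shot_sum w T \<omega>))) \<in> borel_measurable \<Omega>"
      using shot_sum_measurable[OF _ w(1)] T by simp
    show "AE \<omega> in \<Omega>. (\<lambda>m. ennreal (exp (- grid_shot_sum w T m \<omega>))) \<longlonglongrightarrow> ennreal (exp (- shot_sum w T \<omega>))"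
      using grid_shot_sum_LIMSEQ[OF _ _ w(1)] T by (intro AE_I2) (auto intro!: tendsto_intros)
    show "AE \<omega> in \<Omega>. ennreal (exp (- grid_shot_sum w T m \<omega>)) \<le> 1" for m
      using AE_marks_pos
    proof eventually_elim
      case (elim \<omega>)
      then have "0 \<le> grid_shot_sum w T m \<omega>"
        unfolding grid_shot_sum_def
        by (intro sum_nonneg mult_nonneg_nonneg w(2) inT) (auto intro: less_imp_le)
      then show ?case by simp
    qed
  qed (use T in \<open>auto simp: emeasure_space_1\<close>)
  have "(\<integral>\<^sup>+\<omega>. ennreal (exp (- grid_shot_sum w T m \<omega>)) \<partial>\<Omega>) =
      ennreal (exp (- lam * (\<Sum>j<Suc m. T / real (Suc m) * (1 - mark_laplace (w (grid_point T m (Suc j)))))))" for m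
  proof -
    let ?t = "\<lambda>j. grid_point T m j"
    have "(\<integral>\<^sup>+\<omega>. ennreal (exp (- grid_shot_sum w T m \<omega>)) \<partial>\<Omega>) =
        (\<integral>\<^sup>+\<omega>. (\<Prod>j<Suc m. \<Prod>n\<in>{N (?t j) \<omega><..N (?t (Suc j)) \<omega>}. ennreal (exp (- w (?t (Suc j)) * P n \<omega>))) \<partial>\<Omega>)"
      unfolding grid_shot_sum_def
      by (intro nn_integral_cong) (simp only: prod_ennreal[OF exp_ge_zero] prod_ennreal[OF prod_nonneg] exp_ge_zero ball_simps simp_thms
          exp_sum[OF finite_lessThan] exp_sum[OF finite_greaterThanAtMost] sum_negf[symmetric] mult_minus_left)
    also have "\<dots> = ennreal (exp (- (\<Sum>j<Suc m. lam * (?t (Suc j) - ?t j) * (1 - mark_laplace (w (?t (Suc j)))))))"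
      using T inT w(2) by (intro laplace_grid strict_monoI) (auto intro!: divide_strict_right_mono)
    also have "(\<Sum>j<Suc m. lam * (?t (Suc j) - ?t j) * (1 - mark_laplace (w (?t (Suc j))))) =
        lam * (\<Sum>j<Suc m. T / real (Suc m) * (1 - mark_laplace (w (?t (Suc j)))))"
      unfolding sum_distrib_left by (intro sum.cong refl) (simp add: field_simps del: of_nat_Suc, simp add: algebra_simps)
    finally show ?thesis by simp
  qed
  moreover have "continuous_on {0..T} (\<lambda>s. 1 - mark_laplace (w s))"
    using w by (intro continuous_intros continuous_on_compose2[OF continuous_on_mark_laplace w(1)]) auto
  ultimately show "(\<lambda>m. \<integral>\<^sup>+\<omega>. ennreal (exp (- grid_shot_sum w T m \<omega>)) \<partial>\<Omega>) \<longlonglongrightarrow>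
      ennreal (exp (- lam * (LINT s:{0..T}|lborel. 1 - mark_laplace (w s))))"
    using right_riemann_sums_LIMSEQ[OF T, of "\<lambda>s. 1 - mark_laplace (w s)"]
    by (simp only:) (intro tendsto_ennrealI tendsto_exp tendsto_mult tendsto_const, simp)
qed

end

section \<open>Shot sums over the whole half-line\<close>

context marked_poisson
begin

definition mark_exponent :: "real \<Rightarrow> real" where
  "mark_exponent q = 1 - mark_laplace q"

lemma mark_exponent_bounds:
  assumes "0 \<le> q"
  shows "0 \<le> mark_exponent q" "mark_exponent q \<le> 1"
  using mark_laplace_bounds[OF assms] by (auto simp: mark_exponent_def)

lemma mark_exponent_0: "mark_exponent 0 = 0"
  by (simp add: mark_exponent_def mark_laplace_def prob_space)

lemma mark_exponent_mono:
  assumes "0 \<le> q" "q \<le> q'"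
  shows "mark_exponent q \<le> mark_exponent q'"
proof -
  have "mark_laplace q' \<le> mark_laplace q"
    unfolding mark_laplace_def using assms
    by (intro integral_mono_AE integrable_mark_exp, simp, simp)
       (use marks_pos[of 1] in \<open>auto elim!: eventually_mono intro: mult_right_mono\<close>)
  then show ?thesis by (simp add: mark_exponent_def)
qed

lemma continuous_on_mark_exponent: "continuous_on {0..} mark_exponent"
  unfolding mark_exponent_def by (intro continuous_intros continuous_on_mark_laplace)

lemma nn_integral_mark_exponent:
  assumes "0 \<le> q"
  shows "(\<integral>\<^sup>+\<omega>. ennreal (1 - exp (- q * P 1 \<omega>)) \<partial>\<Omega>) = ennreal (mark_exponent q)"
proof -
  have "(\<integral>\<^sup>+\<omega>. ennreal (1 - exp (- q * P 1 \<omega>)) \<partial>\<Omega>) = ennreal (expectation (\<lambda>\<omega>. 1 - exp (- q * P 1 \<omega>)))"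
    using integrable_mark_exp[OF assms] marks_pos[of 1] assms
    by (intro nn_integral_eq_integral) (auto elim!: eventually_mono)
  also have "expectation (\<lambda>\<omega>. 1 - exp (- q * P 1 \<omega>)) = mark_exponent q"
    using integrable_mark_exp[OF assms] by (simp add: mark_exponent_def mark_laplace_def prob_space)
  finally show ?thesis .
qed

text \<open>The bound grows only like ln p, which is why a logarithmic moment is enough. Up to s0
  the integrand is at most 1; beyond it 1 - exp(- x) \<le> x leaves an exponential tail of mass 1 /
  d.\<close>

lemma nn_integral_exp_decay:
  assumes "0 < d" "0 < C" "0 < p"
  shows "(\<integral>\<^sup>+s\<in>{0..}. ennreal (1 - exp (- (C * exp (- d * s)) * p)) \<partial>lborel) \<le>
    ennreal ((max (ln C) 0 + max (ln p) 0 + 1) / d)"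
proof -
  \<comment> \<open>The first nonnegative time from which C * p * exp(- d * s) is at most 1.\<close>
  define s0 where "s0 = max (ln (C * p)) 0 / d"
  have s0: "0 \<le> s0" using assms by (simp add: s0_def)
  have "C * p = exp (ln (C * p))" using assms by simp
  also have "\<dots> \<le> exp (d * s0)" using assms(1) by (simp add: s0_def del: exp_ln)
  finally have Cp: "C * p \<le> exp (d * s0)" .
  have pw: "ennreal (1 - exp (- (C * exp (- d * s)) * p)) * indicator {0..} s \<le>
      indicator {0..s0} s + ennreal (exp (- d * (s - s0))) * indicator {s0..} s" for s
  proof (cases "s0 \<le> s")
    case True
    have "1 - exp (- (C * exp (- d * s)) * p) \<le> C * exp (- d * s) * p"
      using exp_ge_add_one_self[of "- (C * exp (- d * s)) * p"] by simp
    also have "\<dots> \<le> exp (d * s0) * exp (- d * s)"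
      using mult_right_mono[OF Cp, of "exp (- d * s)"] by (simp add: mult_ac)
    also have "\<dots> = exp (- d * (s - s0))" by (simp add: exp_add[symmetric] algebra_simps)
    finally have "ennreal (1 - exp (- (C * exp (- d * s)) * p)) \<le> ennreal (exp (- d * (s - s0)))"
      by (rule ennreal_leI)
    then show ?thesis using True s0 by (auto simp: indicator_def add_increasing)
  next
    case False
    have "ennreal (1 - exp (- (C * exp (- d * s)) * p)) \<le> 1"
      using ennreal_leI[of "1 - exp (- (C * exp (- d * s)) * p)" 1] by simp
    then show ?thesis using False by (auto simp: indicator_def)
  qed
  have tail: "(\<integral>\<^sup>+s. ennreal (exp (- d * (s - s0))) * indicator {s0..} s \<partial>lborel) = ennreal (0 - (- exp (- d * (s0 - s0)) / d))"
  proof (rule nn_integral_FTC_atLeast[where F="\<lambda>s. - exp (- d * (s - s0)) / d"])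
    show "((\<lambda>s. - exp (- d * (s - s0)) / d) \<longlongrightarrow> 0) at_top"
      using assms(1) by real_asymp
    fix x assume "s0 \<le> x"
    show "((\<lambda>s. - exp (- d * (s - s0)) / d) has_real_derivative exp (- d * (x - s0))) (at x)"
      using assms(1) by (auto intro!: derivative_eq_intros)
  qed auto
  have "(\<integral>\<^sup>+s\<in>{0..}. ennreal (1 - exp (- (C * exp (- d * s)) * p)) \<partial>lborel) \<le>
      (\<integral>\<^sup>+s. indicator {0..s0} s + ennreal (exp (- d * (s - s0))) * indicator {s0..} s \<partial>lborel)"
    by (intro nn_integral_mono pw)
  also have "\<dots> = ennreal s0 + ennreal (1 / d)"
    by (subst nn_integral_add) (use s0 tail in auto)
  also have "\<dots> = ennreal (s0 + 1 / d)" using s0 assms(1) by simp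
  also have "\<dots> \<le> ennreal ((max (ln C) 0 + max (ln p) 0 + 1) / d)"
  proof (rule ennreal_leI)
    have "max (ln (C * p)) 0 \<le> max (ln C) 0 + max (ln p) 0" using assms by (simp add: ln_mult)
    then have "(max (ln (C * p)) 0 + 1) / d \<le> (max (ln C) 0 + max (ln p) 0 + 1) / d"
      using assms(1) by (intro divide_right_mono) auto
    then show "s0 + 1 / d \<le> (max (ln C) 0 + max (ln p) 0 + 1) / d" by (simp add: s0_def add_divide_distrib)
  qed
  finally show ?thesis .
qed

lemma nn_integral_mark_exponent_decay:
  assumes log_moment: "(\<integral>\<^sup>+\<omega>. ennreal (max (ln (P 1 \<omega>)) 0) \<partial>\<Omega>) < \<infinity>"
    and d: "0 < d" and C: "0 < C"
  shows "(\<integral>\<^sup>+s\<in>{0..}. ennreal (mark_exponent (C * exp (- d * s))) \<partial>lborel) < \<infinity>"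
proof -
  interpret pair_sigma_finite lborel \<Omega> by unfold_locales
  have [measurable]: "P 1 \<in> borel_measurable \<Omega>" by simp
  have "(\<integral>\<^sup>+s\<in>{0..}. ennreal (mark_exponent (C * exp (- d * s))) \<partial>lborel) =
      (\<integral>\<^sup>+s. \<integral>\<^sup>+\<omega>. ennreal (1 - exp (- (C * exp (- d * s)) * P 1 \<omega>)) * indicator {0..} s \<partial>\<Omega> \<partial>lborel)"
    using C by (intro nn_integral_cong) (auto simp: nn_integral_mark_exponent[symmetric] nn_integral_multc)
  also have "\<dots> = (\<integral>\<^sup>+\<omega>. \<integral>\<^sup>+s. ennreal (1 - exp (- (C * exp (- d * s)) * P 1 \<omega>)) * indicator {0..} s \<partial>lborel \<partial>\<Omega>)"
    by (rule Fubini'[symmetric]) measurable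
  also have "\<dots> \<le> (\<integral>\<^sup>+\<omega>. ennreal ((max (ln C) 0 + max (ln (P 1 \<omega>)) 0 + 1) / d) \<partial>\<Omega>)"
  proof (rule nn_integral_mono_AE)
    show "AE \<omega> in \<Omega>. (\<integral>\<^sup>+s\<in>{0..}. ennreal (1 - exp (- (C * exp (- d * s)) * P 1 \<omega>)) \<partial>lborel) \<le>
        ennreal ((max (ln C) 0 + max (ln (P 1 \<omega>)) 0 + 1) / d)"
      using marks_pos[OF order_refl] by eventually_elim (rule nn_integral_exp_decay[OF d C])
  qed
  also have "\<dots> = (\<integral>\<^sup>+\<omega>. ennreal (1 / d) * (ennreal (max (ln C) 0 + 1) + ennreal (max (ln (P 1 \<omega>)) 0)) \<partial>\<Omega>)"
  proof -
    have "ennreal ((A + B + 1) / d) = ennreal (1 / d) * (ennreal (A + 1) + ennreal B)" if "0 \<le> A" "0 \<le> B" for A B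
      using d that by (simp add: ennreal_plus[symmetric] ennreal_mult[symmetric] add_divide_distrib del: ennreal_plus)
    then show ?thesis by (intro nn_integral_cong) simp
  qed
  also have "\<dots> = ennreal (1 / d) * (ennreal (max (ln C) 0 + 1) + (\<integral>\<^sup>+\<omega>. ennreal (max (ln (P 1 \<omega>)) 0) \<partial>\<Omega>))"
    by (simp add: nn_integral_cmult nn_integral_add emeasure_space_1)
  also have "\<dots> < \<infinity>" using log_moment by (simp add: ennreal_mult_less_top)
  finally show ?thesis .
qed

definition decaying_kernel :: "(real \<Rightarrow> real) \<Rightarrow> bool" where
  "decaying_kernel w \<longleftrightarrow> continuous_on {0..} w \<and> (\<forall>s\<ge>0. 0 \<le> w s) \<and>
     (\<exists>C>0. \<exists>d>0. \<forall>s\<ge>0. w s \<le> C * exp (- d * s))"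

lemma decaying_kernelD:
  assumes "decaying_kernel w"
  shows "continuous_on {0..} w" "0 \<le> s \<Longrightarrow> 0 \<le> w s" "continuous_on {0..T} w"
  using assms by (auto simp: decaying_kernel_def intro: continuous_on_subset)

lemma decaying_kernel_scale:
  assumes "decaying_kernel w" "0 \<le> q"
  shows "decaying_kernel (\<lambda>s. q * w s)"
proof -
  obtain C d where "0 < C" "0 < d" and C: "\<And>s. 0 \<le> s \<Longrightarrow> w s \<le> C * exp (- d * s)"
    using assms(1) by (auto simp: decaying_kernel_def)
  \<comment> \<open>The constant in \<open>decaying_kernel\<close> has to be positive; q + 1
    achieves this also for q = 0.\<close>
  have "q * w s \<le> ((q + 1) * C) * exp (- d * s)" if "0 \<le> s" for s
  proof -
    have "q * w s \<le> (q + 1) * (C * exp (- d * s))"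
      using C[OF that] decaying_kernelD(2)[OF assms(1) that] assms(2) by (intro mult_mono) auto
    then show ?thesis by (simp add: mult_ac)
  qed
  moreover have "0 < (q + 1) * C" using \<open>0 < C\<close> assms(2) by simp
  ultimately show ?thesis
    using decaying_kernelD[OF assms(1)] assms(2) \<open>0 < d\<close> unfolding decaying_kernel_def
    by (intro conjI continuous_intros) (blast, auto)
qed

lemma continuous_on_mark_exponent_kernel:
  assumes "continuous_on S w" "\<And>s. s \<in> S \<Longrightarrow> 0 \<le> w s"
  shows "continuous_on S (\<lambda>s. mark_exponent (w s))"
  by (rule continuous_on_compose2[OF continuous_on_mark_exponent assms(1)]) (use assms(2) in auto)

definition total_exponent :: "(real \<Rightarrow> real) \<Rightarrow> real" where
  "total_exponent w = (LINT s:{0..}|lborel. mark_exponent (w s))"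

lemma shot_sum_scale: "shot_sum (\<lambda>s. q * w s) t \<omega> = q * shot_sum w t \<omega>"
  by (simp add: shot_sum_def sum_distrib_left mult.assoc)

lemma jump_time_nonneg:
  assumes "\<omega> \<in> space \<Omega>" "0 \<le> t" "n \<in> {1..N t \<omega>}"
  shows "0 \<le> jump_time N n \<omega>" "jump_time N n \<omega> \<le> t"
  using jump_time_bounds[OF assms(1) _ assms(2), of n] assms(3) N_0[OF assms(1)] by auto

lemma shot_sum_mono:
  assumes "\<omega> \<in> space \<Omega>" "\<forall>n\<ge>1. 0 < P n \<omega>" "decaying_kernel w" "0 \<le> s" "s \<le> t"
  shows "0 \<le> shot_sum w s \<omega>" "shot_sum w s \<omega> \<le> shot_sum w t \<omega>"
proof -
  have nn: "0 \<le> w (jump_time N n \<omega>) * P n \<omega>" if "n \<in> {1..N t \<omega>}" for n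
    using jump_time_nonneg[OF assms(1) _ that] decaying_kernelD(2)[OF assms(3)] assms that
    by (intro mult_nonneg_nonneg) (auto intro: less_imp_le)
  have le: "N s \<omega> \<le> N t \<omega>" using N_mono assms by blast
  show "0 \<le> shot_sum w s \<omega>" unfolding shot_sum_def using le by (intro sum_nonneg nn) auto
  show "shot_sum w s \<omega> \<le> shot_sum w t \<omega>"
    unfolding shot_sum_def using le by (intro sum_mono2) (auto intro!: nn)
qed

lemma shot_sum_measurable_kernel: "decaying_kernel w \<Longrightarrow> 0 \<le> t \<Longrightarrow> shot_sum w t \<in> borel_measurable \<Omega>"
  by (intro shot_sum_measurable decaying_kernelD(3))

text \<open>Where the sequence diverges, \<open>lim\<close> is an unspecified value; for decaying
  kernels and a finite logarithmic moment this is a null set. Integer times suffice because the sums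
  grow with time.\<close>

definition shot_limit :: "(real \<Rightarrow> real) \<Rightarrow> 'w \<Rightarrow> real" where
  "shot_limit w \<omega> = lim (\<lambda>k. shot_sum w (real (Suc k)) \<omega>)"

lemma shot_limit_measurable: "decaying_kernel w \<Longrightarrow> shot_limit w \<in> borel_measurable \<Omega>"
  unfolding shot_limit_def by (intro borel_measurable_lim_metric shot_sum_measurable_kernel) auto

section \<open>Convergence over the half-line under the logarithmic moment\<close>

context
  assumes log_moment: "(\<integral>\<^sup>+\<omega>. ennreal (max (ln (P 1 \<omega>)) 0) \<partial>\<Omega>) < \<infinity>"
begin

lemma integrable_mark_exponent_kernel:
  assumes w: "decaying_kernel w"
  shows "set_integrable lborel {0..} (\<lambda>s. mark_exponent (w s))"
proof -
  obtain C d where Cd: "0 < C" "0 < d" and C: "\<And>s. 0 \<le> s \<Longrightarrow> w s \<le> C * exp (- d * s)"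
    using w by (auto simp: decaying_kernel_def)
  have nn: "0 \<le> mark_exponent (w s)" "mark_exponent (w s) \<le> mark_exponent (C * exp (- d * s))" if "0 \<le> s" for s
    using that C decaying_kernelD(2)[OF w] by (auto intro!: mark_exponent_bounds mark_exponent_mono)
  have m: "(\<lambda>s. indicator {0..} s *\<^sub>R mark_exponent (w s)) \<in> borel_measurable lborel"
    using borel_measurable_continuous_on_indicator[OF _ continuous_on_mark_exponent_kernel[of "{0..}" w]] decaying_kernelD[OF w]
    by simp
  have "(\<integral>\<^sup>+s. ennreal (norm (indicator {0..} s *\<^sub>R mark_exponent (w s))) \<partial>lborel) \<le>
      (\<integral>\<^sup>+s\<in>{0..}. ennreal (mark_exponent (C * exp (- d * s))) \<partial>lborel)"
    using nn by (intro nn_integral_mono) (auto simp: indicator_def intro!: ennreal_leI)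
  also have "\<dots> < \<infinity>" by (rule nn_integral_mark_exponent_decay[OF log_moment Cd(2,1)])
  finally show ?thesis
    unfolding set_integrable_def using m by (auto simp: integrable_iff_bounded)
qed

lemma total_exponent_LIMSEQ:
  assumes w: "decaying_kernel w"
  shows "(\<lambda>k. LINT s:{0..real (Suc k)}|lborel. mark_exponent (w s)) \<longlonglongrightarrow> total_exponent w"
proof -
  have "((\<lambda>T. LINT s:{0..T}|lborel. mark_exponent (w s)) \<longlongrightarrow> total_exponent w) at_top"
    unfolding total_exponent_def
    by (rule tendsto_set_lebesgue_integral_at_top[OF _ integrable_mark_exponent_kernel[OF w]]) auto
  moreover have "filterlim (\<lambda>k. real (Suc k)) at_top sequentially"
    by (rule filterlim_compose[OF filterlim_real_sequentially filterlim_Suc])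
  ultimately show ?thesis by (rule filterlim_compose)
qed

lemma laplace_shot_sum_LIMSEQ:
  assumes w: "decaying_kernel w"
  shows "(\<lambda>k. \<integral>\<^sup>+\<omega>. ennreal (exp (- shot_sum w (real (Suc k)) \<omega>)) \<partial>\<Omega>) \<longlonglongrightarrow> ennreal (exp (- lam * total_exponent w))"
proof -
  note total_exponent_LIMSEQ[OF w]
  moreover have "(\<integral>\<^sup>+\<omega>. ennreal (exp (- shot_sum w (real (Suc k)) \<omega>)) \<partial>\<Omega>) =
      ennreal (exp (- lam * (LINT s:{0..real (Suc k)}|lborel. mark_exponent (w s))))" for k
    unfolding mark_exponent_def using decaying_kernelD[OF w] by (intro laplace_shot_sum) auto
  ultimately show ?thesis
    by (simp only:) (intro tendsto_ennrealI tendsto_exp tendsto_mult tendsto_const)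
qed

text \<open>The integrands tend to \<open>mark_exponent 0\<close>, which is 0, and are dominated by
  the one at scale 1. This limit rules out a loss of mass in
  \<open>AE_shot_sum_convergent\<close>.\<close>

lemma total_exponent_scale_LIMSEQ:
  assumes w: "decaying_kernel w"
  shows "(\<lambda>m. total_exponent (\<lambda>s. 1 / real (Suc m) * w s)) \<longlonglongrightarrow> 0"
proof -
  have "(\<lambda>m. \<integral>s. indicator {0..} s *\<^sub>R mark_exponent (1 / real (Suc m) * w s) \<partial>lborel) \<longlonglongrightarrow> (\<integral>s. 0 \<partial>(lborel :: real measure))"
  proof (rule integral_dominated_convergence[where w="\<lambda>s. indicator {0..} s *\<^sub>R mark_exponent (w s)"])
    show "integrable lborel (\<lambda>s. indicator {0..} s *\<^sub>R mark_exponent (w s))"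
      using integrable_mark_exponent_kernel[OF w] by (simp add: set_integrable_def)
    show "(\<lambda>s. indicator {0..} s *\<^sub>R mark_exponent (1 / real (Suc m) * w s)) \<in> borel_measurable lborel" for m
      using integrable_mark_exponent_kernel[OF decaying_kernel_scale[OF w, of "1 / real (Suc m)"]]
      unfolding set_integrable_def by (intro borel_measurable_integrable) auto
    show "AE s in lborel. (\<lambda>m. indicator {0..} s *\<^sub>R mark_exponent (1 / real (Suc m) * w s)) \<longlonglongrightarrow> 0"
    proof (rule AE_I2)
      fix s :: real
      show "(\<lambda>m. indicator {0..} s *\<^sub>R mark_exponent (1 / real (Suc m) * w s)) \<longlonglongrightarrow> 0"
      proof (cases "0 \<le> s")
        case True
        have "(\<lambda>m. 1 / real (Suc m) * w s) \<longlonglongrightarrow> 0 * w s"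
          by (intro tendsto_mult tendsto_const LIMSEQ_Suc[OF lim_const_over_n])
        then have "(\<lambda>m. mark_exponent (1 / real (Suc m) * w s)) \<longlonglongrightarrow> mark_exponent 0"
          using decaying_kernelD(2)[OF w True]
          by (intro continuous_on_tendsto_compose[OF continuous_on_mark_exponent]) auto
        then show ?thesis using True by (simp add: mark_exponent_0)
      qed simp
    qed
    fix m
    have "1 / real (Suc m) * w s \<le> w s" if "0 \<le> s" for s
      using mult_right_mono[of "1 / real (Suc m)" 1 "w s"] decaying_kernelD(2)[OF w that] by simp
    then have le: "norm (mark_exponent (1 / real (Suc m) * w s)) \<le> mark_exponent (w s)" if "0 \<le> s" for s
      using decaying_kernelD(2)[OF w that] that mark_exponent_bounds(1)[of "1 / real (Suc m) * w s"]
        mark_exponent_mono[of "1 / real (Suc m) * w s" "w s"]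
      by (simp del: of_nat_Suc)
    show "AE s in lborel. norm (indicator {0..} s *\<^sub>R mark_exponent (1 / real (Suc m) * w s)) \<le>
        indicator {0..} s *\<^sub>R mark_exponent (w s)"
      using le by (intro AE_I2) (simp add: indicator_def del: of_nat_Suc)
  qed simp
  then show ?thesis by (simp add: total_exponent_def set_lebesgue_integral_def)
qed

text \<open>The sums S_k increase, so convergence means boundedness. The limit of exp(- q S_k)
  vanishes off the event B of bounded sums, hence exp(- lam \<psi>(q)) \<le> P(B), where \<psi>(q)
  is the total exponent of the kernel scaled by q. As q tends to 0 the left-hand side tends to
  1.\<close>

lemma AE_shot_sum_convergent:
  assumes w: "decaying_kernel w"
  shows "AE \<omega> in \<Omega>. (\<lambda>k. shot_sum w (real (Suc k)) \<omega>) \<longlonglongrightarrow> shot_limit w \<omega>"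
proof -
  let ?S = "\<lambda>k. shot_sum w (real (Suc k))"
  have [measurable]: "?S k \<in> borel_measurable \<Omega>" for k by (intro shot_sum_measurable_kernel w) simp
  define B where "B = {\<omega> \<in> space \<Omega>. \<exists>b::nat. \<forall>k. ?S k \<omega> \<le> real b}"
  have [measurable]: "B \<in> sets \<Omega>" unfolding B_def by measurable
  have le: "ennreal (exp (- lam * total_exponent (\<lambda>s. q * w s))) \<le> ennreal (prob B)" if q: "0 < q" for q
  proof -
    have qS: "shot_sum (\<lambda>s. q * w s) (real (Suc k)) \<omega> = q * ?S k \<omega>" for k \<omega> by (rule shot_sum_scale)
    let ?E = "\<lambda>k \<omega>. ennreal (exp (- (q * ?S k \<omega>)))"
    have "(\<lambda>k. \<integral>\<^sup>+\<omega>. ?E k \<omega> \<partial>\<Omega>) \<longlonglongrightarrow> (\<integral>\<^sup>+\<omega>. (INF k. ?E k \<omega>) \<partial>\<Omega>)"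
    proof (rule nn_integral_dominated_convergence[where w="\<lambda>_. 1"])
      show "AE \<omega> in \<Omega>. (\<lambda>k. ?E k \<omega>) \<longlonglongrightarrow> (INF k. ?E k \<omega>)"
        using AE_marks_pos AE_space
      proof eventually_elim
        case (elim \<omega>)
        show ?case
          by (rule LIMSEQ_INF) (use q shot_sum_mono(2)[OF elim(2,1) w] in \<open>auto simp: decseq_def intro!: ennreal_leI mult_left_mono\<close>)
      qed
      show "AE \<omega> in \<Omega>. ?E k \<omega> \<le> 1" for k
        using AE_marks_pos AE_space
        by eventually_elim (use q shot_sum_mono(1)[OF _ _ w, of _ "real (Suc k)" "real (Suc k)"] in auto)
      show "(\<lambda>\<omega>. ?E k \<omega>) \<in> borel_measurable \<Omega>" for k by measurable
      show "(\<lambda>\<omega>. INF k. ?E k \<omega>) \<in> borel_measurable \<Omega>"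
        by (rule borel_measurable_INF) (simp_all del: of_nat_Suc)
    qed (simp_all add: emeasure_space_1)
    moreover have "(\<lambda>k. \<integral>\<^sup>+\<omega>. ?E k \<omega> \<partial>\<Omega>) \<longlonglongrightarrow> ennreal (exp (- lam * total_exponent (\<lambda>s. q * w s)))"
      using laplace_shot_sum_LIMSEQ[OF decaying_kernel_scale[OF w, of q]] q unfolding qS by simp
    ultimately have "ennreal (exp (- lam * total_exponent (\<lambda>s. q * w s))) = (\<integral>\<^sup>+\<omega>. (INF k. ?E k \<omega>) \<partial>\<Omega>)"
      by (rule LIMSEQ_unique[symmetric])
    also have "\<dots> \<le> (\<integral>\<^sup>+\<omega>. indicator B \<omega> \<partial>\<Omega>)"
    proof (rule nn_integral_mono_AE)
      show "AE \<omega> in \<Omega>. (INF k. ?E k \<omega>) \<le> indicator B \<omega>"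
        using AE_marks_pos AE_space
      proof eventually_elim
      case (elim \<omega>)
      show ?case
      proof (cases "\<omega> \<in> B")
        case True
        have "(INF k. ?E k \<omega>) \<le> ennreal (exp (- (q * ?S 0 \<omega>)))" by (rule INF_lower) simp
        also have "\<dots> \<le> 1" using q shot_sum_mono(1)[OF elim(2,1) w, of 1 1] by simp
        finally show ?thesis using True by simp
      next
        case False
        have "(INF k. ?E k \<omega>) \<le> ennreal (exp (- (q * real b)))" for b :: nat
        proof -
          obtain k where "real b < ?S k \<omega>" using False elim(2) by (auto simp: B_def not_le)
          then have "?E k \<omega> \<le> ennreal (exp (- (q * real b)))"
            using q by (intro ennreal_leI) simp
          then show ?thesis by (rule INF_lower2[OF UNIV_I])
        qed
        moreover have "(\<lambda>b::nat. ennreal (exp (- (q * real b)))) \<longlonglongrightarrow> ennreal 0"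
          using q by (intro tendsto_ennrealI) real_asymp
        ultimately have "(INF k. ?E k \<omega>) \<le> ennreal 0"
          by (intro LIMSEQ_le_const) auto
        then show ?thesis by simp
      qed
      qed
    qed
    also have "\<dots> = ennreal (prob B)" by (simp add: emeasure_eq_measure)
    finally show ?thesis .
  qed
  have "(\<lambda>m. exp (- lam * total_exponent (\<lambda>s. 1 / real (Suc m) * w s))) \<longlonglongrightarrow> exp (- lam * 0)"
    by (intro tendsto_exp tendsto_mult tendsto_const total_exponent_scale_LIMSEQ w)
  then have "exp (- lam * 0) \<le> prob B"
  proof (rule LIMSEQ_le_const2, intro exI allI impI)
    fix m
    show "exp (- lam * total_exponent (\<lambda>s. 1 / real (Suc m) * w s)) \<le> prob B"
      using le[of "1 / real (Suc m)"] by (subst ennreal_le_iff[symmetric]) (auto simp del: of_nat_Suc)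
  qed
  then have "prob B = 1" using prob_le_1[of B] by simp
  then have "AE \<omega> in \<Omega>. \<omega> \<in> B" by (rule AE_prob_1)
  then show ?thesis
    using AE_marks_pos AE_space
  proof eventually_elim
    case (elim \<omega>)
    then obtain b where b: "\<And>k. ?S k \<omega> \<le> real b" by (auto simp: B_def)
    have "incseq (\<lambda>k. ?S k \<omega>)"
      using shot_sum_mono(2)[OF elim(3,2) w] by (auto simp: incseq_def)
    then obtain L where "(\<lambda>k. ?S k \<omega>) \<longlonglongrightarrow> L" using incseq_convergent[of _ "real b"] b by blast
    then show ?case unfolding shot_limit_def by (simp add: limI)
  qed
qed

lemma AE_shot_limit_ge:
  assumes w: "decaying_kernel w"
  shows "AE \<omega> in \<Omega>. \<forall>k. 0 \<le> shot_sum w (real k) \<omega> \<and> shot_sum w (real k) \<omega> \<le> shot_limit w \<omega>"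
  using AE_shot_sum_convergent[OF w] AE_marks_pos AE_space
proof eventually_elim
  case (elim \<omega>)
  have inc: "incseq (\<lambda>k. shot_sum w (real (Suc k)) \<omega>)"
    using shot_sum_mono(2)[OF elim(3,2) w] by (auto simp: incseq_def)
  have "shot_sum w (real k) \<omega> \<le> shot_sum w (real (Suc k)) \<omega>" for k
    using shot_sum_mono(2)[OF elim(3,2) w, of "real k" "real (Suc k)"] by simp
  then show ?case
    using incseq_le[OF inc elim(1)] shot_sum_mono(1)[OF elim(3,2) w] by (meson of_nat_0_le_iff order_refl order_trans)
qed

lemma laplace_shot_limit:
  assumes w: "decaying_kernel w"
  shows "(\<integral>\<^sup>+\<omega>. ennreal (exp (- shot_limit w \<omega>)) \<partial>\<Omega>) = ennreal (exp (- lam * total_exponent w))"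
proof (rule LIMSEQ_unique[OF _ laplace_shot_sum_LIMSEQ[OF w]])
  show "(\<lambda>k. \<integral>\<^sup>+\<omega>. ennreal (exp (- shot_sum w (real (Suc k)) \<omega>)) \<partial>\<Omega>) \<longlonglongrightarrow> (\<integral>\<^sup>+\<omega>. ennreal (exp (- shot_limit w \<omega>)) \<partial>\<Omega>)"
  proof (rule nn_integral_dominated_convergence[where w="\<lambda>_. 1"])
    show "AE \<omega> in \<Omega>. (\<lambda>k. ennreal (exp (- shot_sum w (real (Suc k)) \<omega>))) \<longlonglongrightarrow> ennreal (exp (- shot_limit w \<omega>))"
      using AE_shot_sum_convergent[OF w] by eventually_elim (intro tendsto_ennrealI tendsto_exp tendsto_minus)
    show "AE \<omega> in \<Omega>. ennreal (exp (- shot_sum w (real (Suc k)) \<omega>)) \<le> 1" for k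
      using AE_shot_limit_ge[OF w] by eventually_elim (auto simp del: of_nat_Suc)
    have [measurable]: "shot_sum w (real (Suc k)) \<in> borel_measurable \<Omega>" "shot_limit w \<in> borel_measurable \<Omega>" for k
      using w by (auto intro: shot_sum_measurable_kernel shot_limit_measurable)
    show "(\<lambda>\<omega>. ennreal (exp (- shot_sum w (real (Suc k)) \<omega>))) \<in> borel_measurable \<Omega>" for k by measurable
    show "(\<lambda>\<omega>. ennreal (exp (- shot_limit w \<omega>))) \<in> borel_measurable \<Omega>" by measurable
  qed (simp_all add: emeasure_space_1)
qed

section \<open>Strict positivity of the limit\<close>

lemma AE_jump: "AE \<omega> in \<Omega>. \<exists>k. 1 \<le> N (real (Suc k)) \<omega>"
proof -
  have [measurable]: "N (real (Suc k)) \<in> measurable \<Omega> (count_space UNIV)" for k by (rule N_measurable) simp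
  define B where "B = {\<omega> \<in> space \<Omega>. \<forall>k. N (real (Suc k)) \<omega> = 0}"
  have [measurable]: "B \<in> sets \<Omega>" unfolding B_def by measurable
  have "emeasure \<Omega> B \<le> ennreal (exp (- lam * real (Suc k)))" for k
  proof -
    have "emeasure \<Omega> B = (\<integral>\<^sup>+\<omega>. indicator B \<omega> \<partial>\<Omega>)" by simp
    \<comment> \<open>Since 0 ^ 0 = 1, the power is the indicator of no jump in the
      interval.\<close>
    also have "\<dots> \<le> (\<integral>\<^sup>+\<omega>. ennreal 0 ^ (N (real (Suc k)) \<omega> - N 0 \<omega>) \<partial>\<Omega>)"
      by (intro nn_integral_mono) (auto simp: B_def indicator_def)
    also have "\<dots> = ennreal (exp (- lam * real (Suc k)))"
      by (subst nn_integral_increment_power) auto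
    finally show ?thesis .
  qed
  moreover have "(\<lambda>k. ennreal (exp (- lam * real (Suc k)))) \<longlonglongrightarrow> ennreal 0"
    using lam_pos by (intro tendsto_ennrealI) real_asymp
  ultimately have "emeasure \<Omega> B \<le> ennreal 0" by (intro LIMSEQ_le_const) auto
  then have "AE \<omega> in \<Omega>. \<omega> \<notin> B" by (intro AE_not_in) (auto simp: null_sets_def)
  then show ?thesis using AE_space by eventually_elim (auto simp: B_def Suc_le_eq)
qed

text \<open>An integer-valued path that is right-continuous at 0 stays at 0 for a while. The strict
  inequality matters because the response at time 0 is v itself, which may have zero
  entries.\<close>

lemma jump_time_1_pos:
  assumes "\<omega> \<in> space \<Omega>" "0 \<le> u" "1 \<le> N u \<omega>"
  shows "0 < jump_time N 1 \<omega>"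
proof -
  have "continuous (at_right 0) (\<lambda>s. N s \<omega>)"
    using poisson assms(1) by (auto simp: poisson_process_def)
  then have "((\<lambda>s. N s \<omega>) \<longlongrightarrow> 0) (at_right 0)"
    by (simp add: continuous_within N_0[OF assms(1)])
  then have "eventually (\<lambda>s. N s \<omega> = 0) (at_right 0)" by (simp add: tendsto_discrete)
  then obtain e where e: "0 < e" "\<And>s. 0 < s \<Longrightarrow> s < e \<Longrightarrow> N s \<omega> = 0"
    unfolding eventually_at_right_field by auto
  have z: "N (e / 2) \<omega> = 0" using e by simp
  have "e / 2 \<le> u"
    using N_mono[OF assms(1,2), of "e / 2"] z assms(3) by (cases "u \<le> e / 2") auto
  then have "e / 2 \<le> jump_time N 1 \<omega>"
    using jump_time_bounds(1)[OF assms(1), of "e / 2" u 1] e(1) z assms(3) by auto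
  then show ?thesis using e(1) by linarith
qed

lemma AE_shot_limit_pos:
  assumes w: "decaying_kernel w" and pos: "\<And>s. 0 < s \<Longrightarrow> 0 < w s"
  shows "AE \<omega> in \<Omega>. 0 < shot_limit w \<omega>"
  using AE_shot_limit_ge[OF w] AE_jump AE_marks_pos AE_space
proof eventually_elim
  case (elim \<omega>)
  then obtain k where k: "1 \<le> N (real (Suc k)) \<omega>" by auto
  have "0 < w (jump_time N 1 \<omega>) * P 1 \<omega>"
    using jump_time_1_pos[OF elim(4) _ k] elim(3) pos by auto
  also have "\<dots> \<le> shot_sum w (real (Suc k)) \<omega>"
    unfolding shot_sum_def
  proof (rule member_le_sum)
    fix n assume "n \<in> {1..N (real (Suc k)) \<omega>} - {1}"
    then show "0 \<le> w (jump_time N n \<omega>) * P n \<omega>"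
      using jump_time_nonneg(1)[OF elim(4), of "real (Suc k)" n] elim(3) decaying_kernelD(2)[OF w]
      by (intro mult_nonneg_nonneg) (auto intro: less_imp_le simp del: of_nat_Suc)
  qed (use k in auto)
  also have "\<dots> \<le> shot_limit w \<omega>" using elim(1) by blast
  finally show ?case .
qed

end

end

section \<open>The invariant law of a dissipative linear system driven by shot noise\<close>

lemma borel_measurable_vecI:
  fixes f :: "'a \<Rightarrow> real^'n::finite"
  assumes "\<And>i. (\<lambda>x. f x $ i) \<in> borel_measurable M"
  shows "f \<in> borel_measurable M"
proof (subst borel_measurable_euclidean_space, rule ballI)
  fix b :: "real^'n" assume "b \<in> Basis"
  then obtain i where "b = axis i 1" by (auto simp: Basis_vec_def)
  then show "(\<lambda>x. f x \<bullet> b) \<in> borel_measurable M" using assms[of i] by (simp add: inner_axis)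
qed

lemma borel_measurable_vec_nth [measurable]: "(\<lambda>x::real^'n::finite. x $ i) \<in> borel_measurable borel"
  by (intro borel_measurable_continuous_onI continuous_intros)

lemma inner_vec_nonneg:
  fixes \<theta> x :: "real^'n::finite"
  assumes "\<forall>i. 0 \<le> \<theta> $ i" "\<forall>i. 0 \<le> x $ i"
  shows "0 \<le> \<theta> \<bullet> x"
  using assms by (auto simp: inner_vec_def intro!: sum_nonneg)

abbreviation laplace_of :: "(real^'n::finite) measure \<Rightarrow> real^'n \<Rightarrow> ennreal" where
  "laplace_of \<mu> \<theta> \<equiv> (\<integral>\<^sup>+x. ennreal (exp (- (\<theta> \<bullet> x))) \<partial>\<mu>)"

lemma prob_measure_eqI_nn_laplace:
  fixes \<mu> \<nu> :: "(real^'n::finite) measure"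
  assumes \<mu>: "prob_space \<mu>" "sets \<mu> = sets borel" "AE x in \<mu>. \<forall>i. 0 \<le> x $ i"
    and \<nu>: "prob_space \<nu>" "sets \<nu> = sets borel" "AE x in \<nu>. \<forall>i. 0 \<le> x $ i"
    and eq: "\<And>\<theta>. (\<forall>i. 0 \<le> \<theta> $ i) \<Longrightarrow> laplace_of \<mu> \<theta> = laplace_of \<nu> \<theta>"
  shows "\<mu> = \<nu>"
proof (rule prob_measure_eqI_laplace[OF \<mu> \<nu>])
  fix \<theta> :: "real^'n" assume "\<forall>i. 0 \<le> \<theta> $ i"
  have "(\<lambda>x. exp (- (\<theta> \<bullet> x))) \<in> borel_measurable borel" by measurable
  then have "(\<lambda>x. exp (- (\<theta> \<bullet> x))) \<in> borel_measurable \<mu>" "(\<lambda>x. exp (- (\<theta> \<bullet> x))) \<in> borel_measurable \<nu>"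
    by (simp_all add: measurable_cong_sets[OF \<mu>(2) refl] measurable_cong_sets[OF \<nu>(2) refl])
  then show "(\<integral>x. exp (- (\<theta> \<bullet> x)) \<partial>\<mu>) = (\<integral>x. exp (- (\<theta> \<bullet> x)) \<partial>\<nu>)"
    using eq[OF \<open>\<forall>i. 0 \<le> \<theta> $ i\<close>] by (simp add: integral_eq_nn_integral)
qed

lemma positive_orthant_measurable [measurable]: "positive_orthant \<in> sets borel"
  unfolding positive_orthant_def by measurable

text \<open>What the argument takes from the river network: y is a linear Lyapunov functional that
  decreases along the flow at rate d, and \<open>v_reaches\<close> makes every coordinate of the
  response positive at positive times.\<close>

locale metzler_shot_noise = marked_poisson \<Omega> N P lam
  for \<Omega> :: "'w measure" and N P lam +
  fixes A :: "real^'n::finite^'n" and v :: "real^'n" and y :: "'n \<Rightarrow> real" and d :: real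
  assumes metzler: "metzler A"
    and weight_pos: "\<And>i. 0 < y i" and rate_pos: "0 < d"
    and dissipative: "\<And>j. (\<Sum>i\<in>UNIV. y i * A $ i $ j) \<le> - d * y j"
    and v_nonneg: "\<And>i. 0 \<le> v $ i"
    and v_reaches: "\<And>i. 0 < v $ i \<or> 0 < (A *v v) $ i"
    and log_moment: "(\<integral>\<^sup>+\<omega>. ennreal (max (ln (P 1 \<omega>)) 0) \<partial>\<Omega>) < \<infinity>"
begin

definition flow :: "real \<Rightarrow> real^'n^'n" where
  "flow t = matrix_exp (t *\<^sub>R A)"

definition response :: "real \<Rightarrow> real^'n" where
  "response t = flow t *v v"

lemma flow_nonneg: "0 \<le> t \<Longrightarrow> 0 \<le> flow t $ i $ j"
  unfolding flow_def by (rule matrix_exp_metzler_nonneg[OF metzler])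

lemma flow_decay:
  assumes "0 \<le> t"
  shows "flow t $ i $ j \<le> exp (- d * t) * (y j / y i)"
proof -
  have "y i * flow t $ i $ j \<le> (\<Sum>i\<in>UNIV. y i * flow t $ i $ j)"
    by (rule member_le_sum[of i UNIV "\<lambda>i. y i * flow t $ i $ j"])
       (use flow_nonneg[OF assms] less_imp_le[OF weight_pos] in simp_all)
  also have "\<dots> \<le> exp (- d * t) * y j"
    unfolding flow_def by (rule matrix_exp_decay[OF metzler dissipative assms])
  finally show ?thesis using weight_pos[of i] by (simp add: field_simps)
qed

lemma flow_LIMSEQ: "(\<lambda>k. flow (real (Suc k)) $ i $ j) \<longlonglongrightarrow> 0"
proof (rule tendsto_sandwich[where f="\<lambda>_. 0" and h="\<lambda>k. exp (- d * real (Suc k)) * (y j / y i)"])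
  show "(\<lambda>k. exp (- d * real (Suc k)) * (y j / y i)) \<longlonglongrightarrow> 0"
    using rate_pos by real_asymp
  show "eventually (\<lambda>k. flow (real (Suc k)) $ i $ j \<le> exp (- d * real (Suc k)) * (y j / y i)) sequentially"
    by (intro always_eventually allI flow_decay) simp
  show "eventually (\<lambda>k. 0 \<le> flow (real (Suc k)) $ i $ j) sequentially"
    by (intro always_eventually allI flow_nonneg) simp
qed simp

lemma continuous_on_flow: "continuous_on S (\<lambda>t. flow t $ i $ j)"
  unfolding flow_def using DERIV_isCont[OF DERIV_matrix_exp] by (intro continuous_at_imp_continuous_on) auto

lemma response_nth: "response t $ i = (\<Sum>j\<in>UNIV. flow t $ i $ j * v $ j)"
  by (simp add: response_def matrix_vector_mult_def)

lemma response_nonneg: "0 \<le> t \<Longrightarrow> 0 \<le> response t $ i"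
  unfolding response_nth by (intro sum_nonneg mult_nonneg_nonneg flow_nonneg v_nonneg)

lemma response_pos: "0 < t \<Longrightarrow> 0 < response t $ i"
  unfolding response_def flow_def by (intro matrix_exp_metzler_pos metzler v_nonneg v_reaches)

lemma response_add: "response (t + s) = flow t *v response s"
  by (simp add: response_def flow_def matrix_exp_add matrix_vector_mul_assoc)

lemma decaying_kernel_response:
  assumes \<theta>: "\<forall>i. 0 \<le> \<theta> $ i"
  shows "decaying_kernel (\<lambda>s. \<theta> \<bullet> response s)"
  unfolding decaying_kernel_def
proof (intro conjI allI impI)
  show "continuous_on {0..} (\<lambda>s. \<theta> \<bullet> response s)"
    unfolding inner_vec_def response_nth by (intro continuous_intros continuous_on_flow)
  show "0 \<le> \<theta> \<bullet> response s" if "0 \<le> s" for s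
    using that \<theta> response_nonneg by (intro inner_vec_nonneg) auto
  define C where "C = (\<Sum>i\<in>UNIV. \<theta> $ i * (\<Sum>j\<in>UNIV. y j / y i * v $ j))"
  have "0 \<le> C" unfolding C_def
    using \<theta> v_nonneg weight_pos by (intro sum_nonneg mult_nonneg_nonneg divide_nonneg_nonneg) (auto intro: less_imp_le)
  have "\<theta> \<bullet> response s \<le> (C + 1) * exp (- d * s)" if "0 \<le> s" for s
  proof -
    have "\<theta> \<bullet> response s \<le> (\<Sum>i\<in>UNIV. \<theta> $ i * (\<Sum>j\<in>UNIV. exp (- d * s) * (y j / y i) * v $ j))"
      unfolding inner_vec_def response_nth inner_real_def
      using \<theta> v_nonneg that by (intro sum_mono mult_left_mono mult_right_mono flow_decay) auto
    also have "\<dots> = C * exp (- d * s)"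
      by (simp add: C_def sum_distrib_left sum_distrib_right mult_ac)
    also have "\<dots> \<le> (C + 1) * exp (- d * s)" by (intro mult_right_mono) auto
    finally show ?thesis .
  qed
  then show "\<exists>C>0. \<exists>d>0. \<forall>s\<ge>0. \<theta> \<bullet> response s \<le> C * exp (- d * s)"
    using \<open>0 \<le> C\<close> rate_pos by (intro exI[of _ "C + 1"] conjI exI[of _ d]) auto
qed

lemma decaying_kernel_response_nth: "decaying_kernel (\<lambda>s. response s $ i)"
proof -
  have "\<forall>j. 0 \<le> (axis i 1 :: real^'n) $ j" by (simp add: axis_def)
  from decaying_kernel_response[OF this] show ?thesis by (simp add: inner_axis')
qed

text \<open>By \<open>response_add\<close> the part of the integral beyond t is the total exponent
  for the parameter \<open>\<theta> v* flow t\<close>. This is the fixed-point equation that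
  invariance imposes on Laplace exponents.\<close>

lemma total_exponent_response_split:
  assumes \<theta>: "\<forall>i. 0 \<le> \<theta> $ i" and t: "0 \<le> t"
  shows "total_exponent (\<lambda>s. \<theta> \<bullet> response s) =
    (LINT s:{0..t}|lborel. mark_exponent (\<theta> \<bullet> response s)) + total_exponent (\<lambda>s. (\<theta> v* flow t) \<bullet> response s)"
proof -
  let ?f = "\<lambda>s. mark_exponent (\<theta> \<bullet> response s)"
  have int: "set_integrable lborel {0..} ?f"
    by (rule integrable_mark_exponent_kernel[OF log_moment decaying_kernel_response[OF \<theta>]])
  have i1: "set_integrable lborel {0..t} ?f" and i2: "set_integrable lborel {t..} ?f"
    by (rule set_integrable_subset[OF int]; use t in auto)+
  have "total_exponent (\<lambda>s. (\<theta> v* flow t) \<bullet> response s) = (\<integral>s. indicator {0..} s *\<^sub>R ?f (t + s) \<partial>lborel)"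
    by (simp add: total_exponent_def set_lebesgue_integral_def response_add dot_lmul_matrix)
  also have "\<dots> = (\<integral>s. indicator {t..} (t + 1 * s) *\<^sub>R ?f (t + 1 * s) \<partial>lborel)"
    by (intro Bochner_Integration.integral_cong) (auto simp: indicator_def)
  also have "\<dots> = (\<integral>s. indicator {t..} s *\<^sub>R ?f s \<partial>lborel)"
    by (subst lborel_integral_real_affine[where c=1 and t=t]) auto
  finally have tail: "total_exponent (\<lambda>s. (\<theta> v* flow t) \<bullet> response s) = (\<integral>s. indicator {t..} s *\<^sub>R ?f s \<partial>lborel)" .
  have "total_exponent (\<lambda>s. \<theta> \<bullet> response s) = (\<integral>s. indicator {0..t} s *\<^sub>R ?f s + indicator {t..} s *\<^sub>R ?f s \<partial>lborel)"
    unfolding total_exponent_def set_lebesgue_integral_def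
  proof (rule integral_cong_AE)
    \<comment> \<open>The two closed intervals share the point t, a null set.\<close>
    show "AE s in lborel. indicator {0..} s *\<^sub>R ?f s = indicator {0..t} s *\<^sub>R ?f s + indicator {t..} s *\<^sub>R ?f s"
      using AE_lborel_singleton[of t] by eventually_elim (use t in \<open>auto simp: indicator_def\<close>)
  qed (use int i1 i2 in \<open>auto simp: set_integrable_def\<close>)
  also have "\<dots> = (LINT s:{0..t}|lborel. ?f s) + (\<integral>s. indicator {t..} s *\<^sub>R ?f s \<partial>lborel)"
    using i1 i2 by (simp add: set_integrable_def set_lebesgue_integral_def)
  finally show ?thesis by (simp add: tail)
qed

section \<open>Transition laws and their Laplace transforms\<close>

definition noise :: "real \<Rightarrow> 'w \<Rightarrow> real^'n" where
  "noise t \<omega> = (\<chi> i. shot_sum (\<lambda>s. response (t - s) $ i) t \<omega>)"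

lemma shot_noise_process_eq: "shot_noise_process A v N P x t \<omega> = flow t *v x + noise t \<omega>"
proof -
  have "(matrix_exp ((t - jump_time N n \<omega>) *\<^sub>R A) *v (P n \<omega> *\<^sub>R v)) $ i = response (t - jump_time N n \<omega>) $ i * P n \<omega>" for n i
    by (simp add: response_def flow_def matrix_vector_mult_def sum_distrib_left mult_ac)
  then show ?thesis
    by (simp add: shot_noise_process_def flow_def noise_def shot_sum_def vec_eq_iff)
qed

abbreviation transition :: "(real^'n) measure \<Rightarrow> real \<Rightarrow> (real^'n) measure" where
  "transition g t \<equiv> distr (g \<Otimes>\<^sub>M \<Omega>) borel (\<lambda>(x, \<omega>). flow t *v x + noise t \<omega>)"

lemma continuous_on_response: "continuous_on S (\<lambda>s. response (t - s) $ i)"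
proof -
  have "continuous_on UNIV (\<lambda>s. response s $ i)"
    unfolding response_nth by (intro continuous_intros continuous_on_flow)
  then show ?thesis by (rule continuous_on_compose2) (auto intro!: continuous_intros)
qed

lemma noise_measurable: "0 \<le> t \<Longrightarrow> noise t \<in> borel_measurable \<Omega>"
  unfolding noise_def by (rule borel_measurable_vecI) (simp add: shot_sum_measurable continuous_on_response)

lemma inner_noise: "\<theta> \<bullet> noise t \<omega> = shot_sum (\<lambda>s. \<theta> \<bullet> response (t - s)) t \<omega>"
  unfolding shot_sum_def noise_def inner_vec_def
  by (simp add: sum_distrib_left sum_distrib_right mult.assoc) (rule sum.swap)

lemma AE_noise_nonneg:
  assumes "0 \<le> t"
  shows "AE \<omega> in \<Omega>. \<forall>i. 0 \<le> noise t \<omega> $ i"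
  using AE_marks_pos AE_space
proof eventually_elim
  case (elim \<omega>)
  show ?case
  proof
    fix i
    show "0 \<le> noise t \<omega> $ i"
      unfolding noise_def shot_sum_def vec_lambda_beta
    proof (rule sum_nonneg)
      fix n assume n: "n \<in> {1..N t \<omega>}"
      show "0 \<le> response (t - jump_time N n \<omega>) $ i * P n \<omega>"
        using jump_time_nonneg[OF elim(2) assms n] elim(1) n
        by (intro mult_nonneg_nonneg response_nonneg) (auto intro: less_imp_le)
    qed
  qed
qed

text \<open>The reflection of s into t - s preserves Lebesgue measure on the interval, so the noise
  has the same exponent as the shot sum with the unreversed kernel.\<close>

lemma laplace_noise:
  assumes \<theta>: "\<forall>i. 0 \<le> \<theta> $ i" and t: "0 < t"
  shows "(\<integral>\<^sup>+\<omega>. ennreal (exp (- (\<theta> \<bullet> noise t \<omega>))) \<partial>\<Omega>) =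
    ennreal (exp (- lam * (LINT s:{0..t}|lborel. mark_exponent (\<theta> \<bullet> response s))))"
proof -
  have "(\<integral>\<^sup>+\<omega>. ennreal (exp (- (\<theta> \<bullet> noise t \<omega>))) \<partial>\<Omega>) =
      ennreal (exp (- lam * (LINT s:{0..t}|lborel. 1 - mark_laplace (\<theta> \<bullet> response (t - s)))))"
    unfolding inner_noise
  proof (rule laplace_shot_sum[OF t])
    show "continuous_on {0..t} (\<lambda>s. \<theta> \<bullet> response (t - s))"
      unfolding inner_vec_def by (intro continuous_intros continuous_on_response)
    show "0 \<le> \<theta> \<bullet> response (t - s)" if "s \<in> {0..t}" for s
      using that \<theta> response_nonneg by (intro inner_vec_nonneg) auto
  qed
  also have "(LINT s:{0..t}|lborel. 1 - mark_laplace (\<theta> \<bullet> response (t - s))) =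
      (\<integral>s. indicator {0..t} (t + (-1) * s) *\<^sub>R mark_exponent (\<theta> \<bullet> response (t + (-1) * s)) \<partial>lborel)"
    unfolding set_lebesgue_integral_def mark_exponent_def
    by (intro Bochner_Integration.integral_cong) (auto simp: indicator_def)
  also have "\<dots> = (LINT s:{0..t}|lborel. mark_exponent (\<theta> \<bullet> response s))"
    unfolding set_lebesgue_integral_def by (subst lborel_integral_real_affine[where c="-1" and t=t]) auto
  finally show ?thesis .
qed

lemma vector_flow_nonneg: "(\<forall>i. 0 \<le> \<theta> $ i) \<Longrightarrow> 0 \<le> t \<Longrightarrow> 0 \<le> (\<theta> v* flow t) $ i"
  by (simp add: vector_matrix_mult_def flow_nonneg sum_nonneg)

context
  fixes g :: "(real^'n) measure"
  assumes g: "prob_space g" "sets g = sets borel" "AE x in g. \<forall>i. 0 \<le> x $ i"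
begin

lemma transition_measurable:
  "0 \<le> t \<Longrightarrow> (\<lambda>(x, \<omega>). flow t *v x + noise t \<omega>) \<in> borel_measurable (g \<Otimes>\<^sub>M \<Omega>)"
proof -
  assume t: "0 \<le> t"
  note [measurable_cong] = g(2)
  note [measurable] = noise_measurable[OF t]
  have "(\<lambda>x::real^'n. flow t *v x) \<in> borel_measurable borel"
    by (intro borel_measurable_continuous_onI matrix_vector_mult_linear_continuous_on)
  then show ?thesis by measurable
qed

lemma prob_space_transition:
  assumes "0 \<le> t"
  shows "prob_space (transition g t)"
  using transition_measurable[OF assms] g(1) prob_space_axioms
  by (intro prob_space.prob_space_distr prob_space_pair)

lemma AE_transition_nonneg:
  assumes t: "0 \<le> t"
  shows "AE x in transition g t. \<forall>i. 0 \<le> x $ i"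
proof -
  interpret g: prob_space g by (rule g(1))
  interpret pair_prob_space g \<Omega> ..
  let ?X = "\<lambda>(x, \<omega>). flow t *v x + noise t \<omega>"
  note m [measurable] = transition_measurable[OF t]
  have "{z \<in> space (g \<Otimes>\<^sub>M \<Omega>). \<forall>i. 0 \<le> ?X z $ i} \<in> sets (g \<Otimes>\<^sub>M \<Omega>)" by measurable
  moreover have "AE x in g. AE \<omega> in \<Omega>. \<forall>i. 0 \<le> ?X (x, \<omega>) $ i"
    using g(3)
  proof eventually_elim
    case (elim x)
    have "0 \<le> (flow t *v x) $ i" for i
      using elim flow_nonneg[OF t] by (auto simp: matrix_vector_mult_def intro!: sum_nonneg)
    with AE_noise_nonneg[OF t] show ?case by (auto elim!: eventually_mono)
  qed
  ultimately have "AE z in g \<Otimes>\<^sub>M \<Omega>. \<forall>i. 0 \<le> ?X z $ i" by (rule AE_pair_measure)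
  moreover have "{x. \<forall>i. 0 \<le> x $ i} \<in> sets (borel :: (real^'n) measure)" by measurable
  ultimately show ?thesis using m by (subst AE_distr_iff) auto
qed

text \<open>The product measure makes initial state and noise independent, so the transform factors;
  the flow acting on x is moved onto \<theta> by transposition.\<close>

lemma laplace_transition:
  assumes \<theta>: "\<forall>i. 0 \<le> \<theta> $ i" and t: "0 < t"
  shows "laplace_of (transition g t) \<theta> =
    laplace_of g (\<theta> v* flow t) *
    ennreal (exp (- lam * (LINT s:{0..t}|lborel. mark_exponent (\<theta> \<bullet> response s))))"
proof -
  note m [measurable] = transition_measurable[OF less_imp_le[OF t]]
  note [measurable] = noise_measurable[OF less_imp_le[OF t]]
  note [measurable_cong] = g(2)
  have "laplace_of (transition g t) \<theta> =
      (\<integral>\<^sup>+z. ennreal (exp (- (\<theta> \<bullet> (case z of (x, \<omega>) \<Rightarrow> flow t *v x + noise t \<omega>)))) \<partial>(g \<Otimes>\<^sub>M \<Omega>))"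
    by (rule nn_integral_distr[OF m]) measurable
  also have "\<dots> = (\<integral>\<^sup>+x. \<integral>\<^sup>+\<omega>. ennreal (exp (- (\<theta> \<bullet> (flow t *v x + noise t \<omega>)))) \<partial>\<Omega> \<partial>g)"
    by (subst nn_integral_fst[symmetric]) (simp_all add: case_prod_beta', measurable)
  also have "\<dots> = (\<integral>\<^sup>+x. \<integral>\<^sup>+\<omega>. ennreal (exp (- ((\<theta> v* flow t) \<bullet> x))) * ennreal (exp (- (\<theta> \<bullet> noise t \<omega>))) \<partial>\<Omega> \<partial>g)"
    by (simp add: inner_add_right dot_lmul_matrix ennreal_mult[symmetric] mult_exp_exp)
  also have "\<dots> = (\<integral>\<^sup>+x. ennreal (exp (- ((\<theta> v* flow t) \<bullet> x))) * (\<integral>\<^sup>+\<omega>. ennreal (exp (- (\<theta> \<bullet> noise t \<omega>))) \<partial>\<Omega>) \<partial>g)"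
    by (intro nn_integral_cong nn_integral_cmult) measurable
  also have "\<dots> = laplace_of g (\<theta> v* flow t) * (\<integral>\<^sup>+\<omega>. ennreal (exp (- (\<theta> \<bullet> noise t \<omega>))) \<partial>\<Omega>)"
    by (rule nn_integral_multc) measurable
  finally show ?thesis unfolding laplace_noise[OF \<theta> t] .
qed

text \<open>The flow tends to 0 entrywise, so the initial state is forgotten in the limit; on the
  orthant the integrand is bounded by 1.\<close>

lemma laplace_flow_LIMSEQ:
  "(\<lambda>k. laplace_of g (\<theta> v* flow (real (Suc k)))) \<longlonglongrightarrow> 1" if \<theta>: "\<forall>i. 0 \<le> \<theta> $ i"
proof -
  interpret g: prob_space g by (rule g(1))
  note [measurable_cong] = g(2)
  have "(\<lambda>k. laplace_of g (\<theta> v* flow (real (Suc k)))) \<longlonglongrightarrow> (\<integral>\<^sup>+x. 1 \<partial>g)"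
  proof (rule nn_integral_dominated_convergence[where w="\<lambda>_. 1"])
    show "AE x in g. ennreal (exp (- ((\<theta> v* flow (real (Suc k))) \<bullet> x))) \<le> 1" for k
      using g(3)
    proof eventually_elim
      case (elim x)
      have "0 \<le> (\<theta> v* flow (real (Suc k))) \<bullet> x"
        using \<theta> elim by (intro inner_vec_nonneg allI vector_flow_nonneg) auto
      then show ?case by simp
    qed
    show "AE x in g. (\<lambda>k. ennreal (exp (- ((\<theta> v* flow (real (Suc k))) \<bullet> x)))) \<longlonglongrightarrow> 1"
    proof (rule AE_I2)
      fix x
      have "(\<lambda>k. (\<theta> v* flow (real (Suc k))) \<bullet> x) \<longlonglongrightarrow> (\<Sum>j\<in>UNIV. (\<Sum>i\<in>UNIV. \<theta> $ i * 0) * x $ j)"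
        unfolding inner_vec_def vector_matrix_mult_def inner_real_def vec_lambda_beta
        by (intro tendsto_sum tendsto_mult tendsto_const flow_LIMSEQ)
      then have "(\<lambda>k. ennreal (exp (- ((\<theta> v* flow (real (Suc k))) \<bullet> x)))) \<longlonglongrightarrow> ennreal (exp (- 0))"
        by (intro tendsto_ennrealI tendsto_exp tendsto_minus) simp
      then show "(\<lambda>k. ennreal (exp (- ((\<theta> v* flow (real (Suc k))) \<bullet> x)))) \<longlonglongrightarrow> 1" by simp
    qed
  qed (simp_all add: g.emeasure_space_1)
  then show ?thesis by (simp add: g.emeasure_space_1)
qed

end

section \<open>Existence and uniqueness of the invariant law\<close>

definition limit_law :: "(real^'n) measure" where
  "limit_law = distr \<Omega> borel (\<lambda>\<omega>. \<chi> i. shot_limit (\<lambda>s. response s $ i) \<omega>)"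

lemma limit_measurable [measurable]: "(\<lambda>\<omega>. \<chi> i. shot_limit (\<lambda>s. response s $ i) \<omega>) \<in> borel_measurable \<Omega>"
  by (rule borel_measurable_vecI) (simp add: shot_limit_measurable decaying_kernel_response_nth)

lemma prob_space_limit_law: "prob_space limit_law"
  unfolding limit_law_def by (rule prob_space_distr) measurable

lemma sets_limit_law: "sets limit_law = sets borel"
  by (simp add: limit_law_def)

lemma AE_limit_law_pos: "AE x in limit_law. x \<in> positive_orthant"
proof -
  have "AE \<omega> in \<Omega>. \<forall>i. 0 < shot_limit (\<lambda>s. response s $ i) \<omega>"
    using AE_shot_limit_pos[OF log_moment decaying_kernel_response_nth response_pos]
    by (simp add: AE_all_countable)
  then show ?thesis unfolding limit_law_def by (subst AE_distr_iff) (auto simp: positive_orthant_def)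
qed

text \<open>Being defined through \<open>lim\<close>, \<open>shot_limit\<close> is linear in the
  kernel only where the sequences converge. Off a null set all coordinate limits exist and combine
  to the limit for the kernel \<theta> \<bullet> response.\<close>

lemma laplace_limit_law:
  assumes \<theta>: "\<forall>i. 0 \<le> \<theta> $ i"
  shows "laplace_of limit_law \<theta> = ennreal (exp (- lam * total_exponent (\<lambda>s. \<theta> \<bullet> response s)))"
proof -
  let ?Z = "\<lambda>\<omega>. \<chi> i. shot_limit (\<lambda>s. response s $ i) \<omega>"
  have "laplace_of limit_law \<theta> = (\<integral>\<^sup>+\<omega>. ennreal (exp (- (\<theta> \<bullet> ?Z \<omega>))) \<partial>\<Omega>)"
    unfolding limit_law_def by (rule nn_integral_distr) measurable
  also have "\<dots> = (\<integral>\<^sup>+\<omega>. ennreal (exp (- shot_limit (\<lambda>s. \<theta> \<bullet> response s) \<omega>)) \<partial>\<Omega>)"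
  proof (rule nn_integral_cong_AE)
    have "AE \<omega> in \<Omega>. \<forall>i. (\<lambda>k. shot_sum (\<lambda>s. response s $ i) (real (Suc k)) \<omega>) \<longlonglongrightarrow> shot_limit (\<lambda>s. response s $ i) \<omega>"
      using AE_shot_sum_convergent[OF log_moment decaying_kernel_response_nth] by (simp add: AE_all_countable)
    with AE_shot_sum_convergent[OF log_moment decaying_kernel_response[OF \<theta>]]
    show "AE \<omega> in \<Omega>. ennreal (exp (- (\<theta> \<bullet> ?Z \<omega>))) = ennreal (exp (- shot_limit (\<lambda>s. \<theta> \<bullet> response s) \<omega>))"
    proof eventually_elim
      case (elim \<omega>)
      have "shot_sum (\<lambda>s. \<theta> \<bullet> response s) t \<omega> = (\<Sum>i\<in>UNIV. \<theta> $ i * shot_sum (\<lambda>s. response s $ i) t \<omega>)" for t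
        unfolding shot_sum_def inner_vec_def
        by (simp add: sum_distrib_left sum_distrib_right mult.assoc) (rule sum.swap)
      moreover have "(\<lambda>k. \<Sum>i\<in>UNIV. \<theta> $ i * shot_sum (\<lambda>s. response s $ i) (real (Suc k)) \<omega>) \<longlonglongrightarrow> \<theta> \<bullet> ?Z \<omega>"
        unfolding inner_vec_def inner_real_def vec_lambda_beta
        using elim(2) by (intro tendsto_sum tendsto_mult tendsto_const) blast
      ultimately have "\<theta> \<bullet> ?Z \<omega> = shot_limit (\<lambda>s. \<theta> \<bullet> response s) \<omega>"
        using elim(1) LIMSEQ_unique by fastforce
      then show ?case by simp
    qed
  qed
  also have "\<dots> = ennreal (exp (- lam * total_exponent (\<lambda>s. \<theta> \<bullet> response s)))"
    by (rule laplace_shot_limit[OF log_moment decaying_kernel_response[OF \<theta>]])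
  finally show ?thesis .
qed

lemma positive_imp_nonneg:
  assumes "AE x in g. x \<in> positive_orthant"
  shows "AE x in g. \<forall>i. 0 \<le> x $ i"
  using assms by eventually_elim (auto simp: positive_orthant_def intro: less_imp_le)

lemma invariant_distribution_iff:
  "invariant_distribution \<Omega> (shot_noise_process A v N P) positive_orthant g \<longleftrightarrow>
     prob_space g \<and> sets g = sets borel \<and> (AE x in g. x \<in> positive_orthant) \<and>
     (\<forall>t>0. transition g t = g)"
proof -
  have "emeasure g positive_orthant = 1 \<longleftrightarrow> (AE x in g. x \<in> positive_orthant)"
    if "prob_space g" "sets g = sets borel"
  proof -
    interpret g: prob_space g by fact
    have "positive_orthant \<in> sets g" using that by simp
    then show ?thesis
      using g.prob_eq_1[of positive_orthant] by (simp add: g.emeasure_eq_measure)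
  qed
  then show ?thesis
    unfolding invariant_distribution_def shot_noise_process_eq by blast
qed

text \<open>The transform at time t is that of the limit law at \<open>\<theta> v* flow t\<close>
  times that of the noise; by \<open>total_exponent_response_split\<close> the exponents add up to
  the one at \<theta>.\<close>

lemma invariant_limit_law:
  "invariant_distribution \<Omega> (shot_noise_process A v N P) positive_orthant limit_law"
  unfolding invariant_distribution_iff
proof (intro conjI allI impI)
  show "prob_space limit_law" "sets limit_law = sets borel" "AE x in limit_law. x \<in> positive_orthant"
    by (fact prob_space_limit_law sets_limit_law AE_limit_law_pos)+
  note g = prob_space_limit_law sets_limit_law positive_imp_nonneg[OF AE_limit_law_pos]
  fix t :: real assume t: "0 < t"
  show "transition limit_law t = limit_law"
  proof (rule prob_measure_eqI_nn_laplace[OF prob_space_transition[OF g] sets_distr AE_transition_nonneg[OF g] g])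
    fix \<theta> :: "real^'n" assume \<theta>: "\<forall>i. 0 \<le> \<theta> $ i"
    have "\<forall>i. 0 \<le> (\<theta> v* flow t) $ i" using \<theta> t by (auto intro: vector_flow_nonneg)
    then show "laplace_of (transition limit_law t) \<theta> =
        laplace_of limit_law \<theta>"
      unfolding laplace_transition[OF g \<theta> t] laplace_limit_law[OF \<theta>]
        total_exponent_response_split[OF \<theta> less_imp_le[OF t]]
      by (subst laplace_limit_law) (auto simp: ennreal_mult[symmetric] exp_add[symmetric] algebra_simps)
  qed (use t in auto)
qed

text \<open>By invariance at the times k + 1, the transform at the pulled-back parameter times that
  of the noise does not depend on k. As k grows, the first factor tends to 1 and the second to the
  asserted value.\<close>

lemma laplace_invariant:
  assumes inv: "invariant_distribution \<Omega> (shot_noise_process A v N P) positive_orthant g"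
    and \<theta>: "\<forall>i. 0 \<le> \<theta> $ i"
  shows "laplace_of g \<theta> = ennreal (exp (- lam * total_exponent (\<lambda>s. \<theta> \<bullet> response s)))"
proof (rule LIMSEQ_unique)
  have g: "prob_space g" "sets g = sets borel" "AE x in g. \<forall>i. 0 \<le> x $ i"
    and eq: "\<And>t. 0 < t \<Longrightarrow> transition g t = g"
    using inv positive_imp_nonneg[of g] unfolding invariant_distribution_iff by blast+
  let ?L = "\<lambda>k. LINT s:{0..real (Suc k)}|lborel. mark_exponent (\<theta> \<bullet> response s)"
  have "?L \<longlonglongrightarrow> total_exponent (\<lambda>s. \<theta> \<bullet> response s)"
    by (rule total_exponent_LIMSEQ[OF log_moment decaying_kernel_response[OF \<theta>]])
  then have lim: "(\<lambda>k. ennreal (exp (- lam * ?L k))) \<longlonglongrightarrow> ennreal (exp (- lam * total_exponent (\<lambda>s. \<theta> \<bullet> response s)))"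
    by (intro tendsto_ennrealI tendsto_exp tendsto_mult tendsto_const)
  have "(\<lambda>k. laplace_of g (\<theta> v* flow (real (Suc k))) * ennreal (exp (- lam * ?L k))) \<longlonglongrightarrow>
      1 * ennreal (exp (- lam * total_exponent (\<lambda>s. \<theta> \<bullet> response s)))"
    by (rule tendsto_mult_ennreal[OF laplace_flow_LIMSEQ[OF g \<theta>] lim]) auto
  moreover have "laplace_of g (\<theta> v* flow (real (Suc k))) * ennreal (exp (- lam * ?L k)) =
      laplace_of g \<theta>" for k
    using laplace_transition[OF g \<theta>, of "real (Suc k)"] eq[of "real (Suc k)"] by (simp del: of_nat_Suc)
  ultimately show "(\<lambda>k::nat. \<integral>\<^sup>+x. ennreal (exp (- (\<theta> \<bullet> x))) \<partial>g) \<longlonglongrightarrow> ennreal (exp (- lam * total_exponent (\<lambda>s. \<theta> \<bullet> response s)))"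
    by simp
qed simp

theorem ex1_invariant_distribution:
  "\<exists>!g. invariant_distribution \<Omega> (shot_noise_process A v N P) positive_orthant g"
proof (rule ex1I, rule invariant_limit_law)
  fix g assume inv: "invariant_distribution \<Omega> (shot_noise_process A v N P) positive_orthant g"
  then have g: "prob_space g" "sets g = sets borel" "AE x in g. \<forall>i. 0 \<le> x $ i"
    using positive_imp_nonneg[of g] unfolding invariant_distribution_iff by blast+
  show "g = limit_law"
    by (rule prob_measure_eqI_nn_laplace[OF g prob_space_limit_law sets_limit_law positive_imp_nonneg[OF AE_limit_law_pos]])
       (simp add: laplace_invariant[OF inv] laplace_limit_law)
qed

end

section \<open>Moments from Laplace transforms\<close>

text \<open>A single term (p x)^n / n! of the series for exp(p x) is at most the whole
  series.\<close>

lemma power_exp_neg_le: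
  assumes "0 \<le> (x::real)" "0 < p"
  shows "x ^ n * exp (- p * x) \<le> fact n / p ^ n"
proof -
  have "(\<Sum>k\<in>{n}. inverse (fact k) * (p * x) ^ k) \<le> (\<Sum>k. inverse (fact k) * (p * x) ^ k)"
    using assms summable_exp[of "p * x"] by (intro sum_le_suminf) auto
  then have "(p * x) ^ n / fact n \<le> exp (p * x)"
    by (simp add: exp_def scaleR_conv_of_real field_simps)
  then show ?thesis
    using assms by (simp add: power_mult_distrib exp_minus field_simps)
qed

lemma mult_exp_neg_le: "x * exp (- x) \<le> 1 - exp (- x)" for x :: real
  using exp_ge_add_one_self[of x] by (simp add: exp_minus field_simps)

lemma exp_neg_diff_le:
  assumes "c \<le> (a::real)" "c \<le> b"
  shows "\<bar>exp (- a) - exp (- b)\<bar> \<le> \<bar>a - b\<bar> * exp (- c)"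
proof -
  have *: "\<bar>exp (- a) - exp (- b)\<bar> \<le> \<bar>a - b\<bar> * exp (- c)" if "c \<le> a" "a \<le> b" for a b :: real
  proof -
    have "exp (- a) - exp (- b) = exp (- a) * (1 - exp (- (b - a)))"
      by (simp add: algebra_simps exp_add[symmetric])
    also have "1 - exp (- (b - a)) \<le> b - a"
      using exp_ge_add_one_self[of "- (b - a)"] by linarith
    also have "exp (- a) * (b - a) \<le> exp (- c) * (b - a)"
      using that by (intro mult_right_mono) auto
    finally show ?thesis using that by (simp add: mult.commute abs_if)
  qed
  show ?thesis
    using *[of a b] *[of b a] assms by (cases "a \<le> b") (auto simp: abs_minus_commute)
qed

abbreviation laplace_moment :: "'a measure \<Rightarrow> ('a \<Rightarrow> real) \<Rightarrow> nat \<Rightarrow> real \<Rightarrow> real" where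
  "laplace_moment M f n q \<equiv> (\<integral>x. f x ^ n * exp (- q * f x) \<partial>M)"

text \<open>\<Phi> enters through its differences only. This covers n = 0 over an infinite measure,
  where exp(- q f) need not be integrable although 1 - exp(- q f) is.\<close>

lemma DERIV_laplace_moment:
  fixes f :: "'a \<Rightarrow> real"
  assumes f [measurable]: "f \<in> borel_measurable M" and nn: "\<And>x. 0 \<le> f x"
    and int: "\<And>p. 0 < p \<Longrightarrow> integrable M (\<lambda>x. f x ^ Suc n * exp (- p * f x))"
    and \<Phi>: "\<And>p p'. 0 < p \<Longrightarrow> 0 < p' \<Longrightarrow> \<Phi> p' - \<Phi> p = (\<integral>x. f x ^ n * (exp (- p' * f x) - exp (- p * f x)) \<partial>M)"
    and q: "0 < q"
  shows "(\<Phi> has_real_derivative - laplace_moment M f (Suc n) q) (at q)"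
proof -
  \<comment> \<open>Staying above q/2 provides the common integrable majorant f^(n+1) exp(- (q/2) f)
    for the difference quotients.\<close>
  have "(\<Phi> has_real_derivative - laplace_moment M f (Suc n) q) (at q within {q/2<..})"
    unfolding has_field_derivative_iff tendsto_at_iff_sequentially comp_def
  proof (intro allI impI)
    fix X assume X: "\<forall>i. X i \<in> {q/2<..} - {q}" "X \<longlonglongrightarrow> q"
    have eq: "(\<Phi> (X i) - \<Phi> q) / (X i - q) = (\<integral>x. f x ^ n * (exp (- X i * f x) - exp (- q * f x)) / (X i - q) \<partial>M)" for i
    proof -
      have "0 < X i" using X(1) q by (auto dest!: spec[of _ i])
      then show ?thesis using \<Phi>[OF q] by simp
    qed
    have "(\<lambda>i. \<integral>x. f x ^ n * (exp (- X i * f x) - exp (- q * f x)) / (X i - q) \<partial>M) \<longlonglongrightarrow>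
        (\<integral>x. - (f x ^ Suc n * exp (- q * f x)) \<partial>M)"
    proof (rule integral_dominated_convergence[where w="\<lambda>x. f x ^ Suc n * exp (- (q/2) * f x)"])
      show "integrable M (\<lambda>x. f x ^ Suc n * exp (- (q/2) * f x))" using q by (intro int) simp
      show "AE x in M. (\<lambda>i. f x ^ n * (exp (- X i * f x) - exp (- q * f x)) / (X i - q)) \<longlonglongrightarrow> - (f x ^ Suc n * exp (- q * f x))"
      proof (rule AE_I2)
        fix x
        have "((\<lambda>p. exp (- p * f x)) has_real_derivative - f x * exp (- q * f x)) (at q)"
          by (auto intro!: derivative_eq_intros)
        then have "((\<lambda>p. (exp (- p * f x) - exp (- q * f x)) / (p - q)) \<longlongrightarrow> - f x * exp (- q * f x)) (at q)"
          by (simp add: has_field_derivative_iff)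
        then have "(\<lambda>i. (exp (- X i * f x) - exp (- q * f x)) / (X i - q)) \<longlonglongrightarrow> - f x * exp (- q * f x)"
          using X unfolding tendsto_at_iff_sequentially comp_def by auto
        then have "(\<lambda>i. f x ^ n * ((exp (- X i * f x) - exp (- q * f x)) / (X i - q))) \<longlonglongrightarrow> f x ^ n * (- f x * exp (- q * f x))"
          by (intro tendsto_mult tendsto_const)
        then show "(\<lambda>i. f x ^ n * (exp (- X i * f x) - exp (- q * f x)) / (X i - q)) \<longlonglongrightarrow> - (f x ^ Suc n * exp (- q * f x))"
          by (simp add: mult_ac)
      qed
      fix i
      have Xi: "q / 2 < X i" "X i \<noteq> q" using X(1) by (auto dest!: spec[of _ i])
      show "AE x in M. norm (f x ^ n * (exp (- X i * f x) - exp (- q * f x)) / (X i - q)) \<le> f x ^ Suc n * exp (- (q/2) * f x)"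
      proof (rule AE_I2)
        fix x
        have "\<bar>exp (- (X i * f x)) - exp (- (q * f x))\<bar> \<le> \<bar>X i * f x - q * f x\<bar> * exp (- (q/2 * f x))"
          using Xi q nn[of x] by (intro exp_neg_diff_le mult_right_mono) auto
        also have "\<bar>X i * f x - q * f x\<bar> = \<bar>X i - q\<bar> * f x"
          using nn[of x] by (simp add: left_diff_distrib[symmetric] abs_mult)
        finally have "\<bar>exp (- (X i * f x)) - exp (- (q * f x))\<bar> / \<bar>X i - q\<bar> \<le> f x * exp (- (q/2 * f x))"
          using Xi by (simp add: pos_divide_le_eq mult_ac)
        then have "f x ^ n * (\<bar>exp (- (X i * f x)) - exp (- (q * f x))\<bar> / \<bar>X i - q\<bar>) \<le> f x ^ n * (f x * exp (- (q/2 * f x)))"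
          using nn[of x] by (intro mult_left_mono) auto
        then show "norm (f x ^ n * (exp (- X i * f x) - exp (- q * f x)) / (X i - q)) \<le> f x ^ Suc n * exp (- (q/2) * f x)"
          using nn[of x] by (simp add: abs_mult mult_ac)
      qed
    qed measurable
    then show "(\<lambda>i. (\<Phi> (X i) - \<Phi> q) / (X i - q)) \<longlonglongrightarrow> - laplace_moment M f (Suc n) q"
      unfolding eq Bochner_Integration.integral_minus .
  qed
  then show ?thesis using q by (simp add: at_within_open[of q "{q/2<..}"])
qed

text \<open>Multiplication on [0,\<infinity>] is not continuous at (0,\<infinity>). For increasing
  sequences the limits are suprema, and a limit 0 forces all terms to be 0, so this case does no
  harm.\<close>

lemma incseq_mult_LIMSEQ_ennreal:
  fixes a b :: "nat \<Rightarrow> ennreal"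
  assumes "incseq a" "incseq b" "a \<longlonglongrightarrow> A" "b \<longlonglongrightarrow> B"
  shows "(\<lambda>n. a n * b n) \<longlonglongrightarrow> A * B"
proof -
  have A: "A = (SUP n. a n)" and B: "B = (SUP n. b n)"
    using assms LIMSEQ_SUP LIMSEQ_unique by blast+
  have inc: "incseq (\<lambda>n. a n * b n)"
    using assms(1,2) by (auto simp: incseq_def intro!: mult_mono)
  have "A * B = (SUP n. SUP m. a n * b m)"
    unfolding A B by (simp only: SUP_mult_right_ennreal, simp only: SUP_mult_left_ennreal)
  also have "\<dots> = (SUP n. a n * b n)"
  proof (rule antisym)
    show "(SUP n. SUP m. a n * b m) \<le> (SUP n. a n * b n)"
    proof (intro SUP_least)
      fix n m
      have "a n * b m \<le> a (max n m) * b (max n m)"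
        using assms(1,2) by (intro mult_mono) (auto simp: incseq_def)
      then show "a n * b m \<le> (SUP n. a n * b n)" by (rule SUP_upper2[OF UNIV_I])
    qed
    show "(SUP n. a n * b n) \<le> (SUP n. SUP m. a n * b m)"
      by (intro SUP_least) (meson SUP_upper2 UNIV_I order_refl)
  qed
  finally show ?thesis using LIMSEQ_SUP[OF inc] by simp
qed

text \<open>As q decreases to 0 the factor exp(- q f) increases to 1, so monotone convergence
  applies to infinite moments as well.\<close>

lemma laplace_moment_LIMSEQ:
  fixes f :: "'a \<Rightarrow> real"
  assumes f [measurable]: "f \<in> borel_measurable M" and nn: "\<And>x. 0 \<le> f x"
    and int: "\<And>p. 0 < p \<Longrightarrow> integrable M (\<lambda>x. f x ^ n * exp (- p * f x))"
  shows "incseq (\<lambda>m. ennreal (laplace_moment M f n (1 / real (Suc m))))"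
    and "(\<lambda>m. ennreal (laplace_moment M f n (1 / real (Suc m)))) \<longlonglongrightarrow> (\<integral>\<^sup>+x. ennreal (f x) ^ n \<partial>M)"
proof -
  let ?F = "\<lambda>m x. ennreal (f x ^ n * exp (- (1 / real (Suc m)) * f x))"
  have eq: "ennreal (laplace_moment M f n (1 / real (Suc m))) = (\<integral>\<^sup>+x. ?F m x \<partial>M)" for m
    using nn by (intro nn_integral_eq_integral[symmetric] int) auto
  have inc: "incseq ?F"
    unfolding incseq_def le_fun_def
  proof (intro allI impI ennreal_leI mult_left_mono)
    fix m m' :: nat and x assume "m \<le> m'"
    then have "1 / real (Suc m') \<le> 1 / real (Suc m)" by (simp add: frac_le)
    then have "1 / real (Suc m') * f x \<le> 1 / real (Suc m) * f x" by (rule mult_right_mono) (rule nn)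
    then show "exp (- (1 / real (Suc m)) * f x) \<le> exp (- (1 / real (Suc m')) * f x)" by simp
  qed (use nn in auto)
  then show "incseq (\<lambda>m. ennreal (laplace_moment M f n (1 / real (Suc m))))"
    unfolding eq by (auto simp: incseq_def le_fun_def intro!: nn_integral_mono simp del: of_nat_Suc)
  show "(\<lambda>m. ennreal (laplace_moment M f n (1 / real (Suc m)))) \<longlonglongrightarrow> (\<integral>\<^sup>+x. ennreal (f x) ^ n \<partial>M)"
    unfolding eq
  proof (rule nn_integral_LIMSEQ[OF inc])
    fix x
    have "(\<lambda>m. f x ^ n * exp (- (1 / real (Suc m)) * f x)) \<longlonglongrightarrow> f x ^ n * exp (- 0 * f x)"
      by (intro tendsto_mult tendsto_exp tendsto_minus tendsto_const LIMSEQ_Suc[OF lim_const_over_n])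
    then show "(\<lambda>m. ?F m x) \<longlonglongrightarrow> ennreal (f x) ^ n"
      using nn[of x] by (simp add: ennreal_power tendsto_ennrealI del: of_nat_Suc)
  qed measurable
qed

text \<open>Differentiating the identity \<open>E exp (- q X) = exp (- \<psi> q)\<close> repeatedly in \<open>q > 0\<close> involves only
  finite quantities; the possibly infinite moments appear in the limit \<open>q \<rightarrow> 0\<close>.\<close>

theorem moment_recursion:
  fixes X :: "'a \<Rightarrow> real" and f :: "'b \<Rightarrow> real"
  assumes g: "prob_space g" and X [measurable]: "X \<in> borel_measurable g" and Xnn: "\<And>x. 0 \<le> X x"
    and f [measurable]: "f \<in> borel_measurable \<Theta>" and fnn: "\<And>x. 0 \<le> f x"
    and int: "\<And>q. 0 < q \<Longrightarrow> integrable \<Theta> (\<lambda>x. 1 - exp (- q * f x))"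
    and laplace: "\<And>q. 0 < q \<Longrightarrow> (\<integral>x. exp (- q * X x) \<partial>g) = exp (- (\<integral>x. 1 - exp (- q * f x) \<partial>\<Theta>))"
  shows "(\<integral>\<^sup>+x. ennreal (X x) ^ Suc n \<partial>g) =
    (\<Sum>k\<le>n. of_nat (n choose k) * (\<integral>\<^sup>+x. ennreal (f x) ^ Suc k \<partial>\<Theta>) * (\<integral>\<^sup>+x. ennreal (X x) ^ (n - k) \<partial>g))"
proof -
  interpret prob_space g by (rule g)
  define Mq where "Mq n q = laplace_moment g X n q" for n q
  define Kq where "Kq n q = laplace_moment \<Theta> f n q" for n q
  define \<psi> where "\<psi> q = (\<integral>x. 1 - exp (- q * f x) \<partial>\<Theta>)" for q
  have intX: "integrable g (\<lambda>x. X x ^ n * exp (- q * X x))" if "0 < q" for n q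
  proof (rule integrable_const_bound[where B="fact n / q ^ n"])
    show "AE x in g. norm (X x ^ n * exp (- q * X x)) \<le> fact n / q ^ n"
      using power_exp_neg_le[OF Xnn that] Xnn by (intro AE_I2) (simp add: abs_mult)
  qed measurable
  have intf: "integrable \<Theta> (\<lambda>x. f x ^ Suc n * exp (- q * f x))" if q: "0 < q" for n q
  proof (rule Bochner_Integration.integrable_bound)
    \<comment> \<open>The factor exp(- q f) is split into two halves: one absorbs f^n through
      \<open>power_exp_neg_le\<close>, the other, with the remaining f, is traded for the integrable
      1 - exp(- (q/2) f).\<close>
    let ?C = "fact n / (q / 2) ^ n * (2 / q)"
    show "integrable \<Theta> (\<lambda>x. ?C * (1 - exp (- (q / 2) * f x)))"
      using q by (intro integrable_mult_right int) simp
    show "AE x in \<Theta>. norm (f x ^ Suc n * exp (- q * f x)) \<le> norm (?C * (1 - exp (- (q / 2) * f x)))"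
    proof (rule AE_I2)
      fix x
      have a: "f x ^ n * exp (- (q / 2) * f x) \<le> fact n / (q / 2) ^ n"
        using q fnn by (intro power_exp_neg_le) auto
      have b: "f x * exp (- (q / 2) * f x) \<le> 2 / q * (1 - exp (- (q / 2) * f x))"
        using mult_exp_neg_le[of "q / 2 * f x"] q by (simp add: field_simps)
      have "f x ^ Suc n * exp (- q * f x) = (f x ^ n * exp (- (q / 2) * f x)) * (f x * exp (- (q / 2) * f x))"
        by (simp add: mult_ac exp_add[symmetric])
      also have "\<dots> \<le> fact n / (q / 2) ^ n * (2 / q * (1 - exp (- (q / 2) * f x)))"
        using q fnn[of x] by (intro mult_mono a b) auto
      also have "\<dots> \<le> norm (?C * (1 - exp (- (q / 2) * f x)))"
        unfolding mult.assoc real_norm_def by (rule abs_ge_self)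
      finally show "norm (f x ^ Suc n * exp (- q * f x)) \<le> norm (?C * (1 - exp (- (q / 2) * f x)))"
        using fnn[of x] by (simp add: abs_mult del: times_divide_eq_left times_divide_eq_right)
    qed
  qed measurable
  have DM: "(Mq n has_real_derivative - Mq (Suc n) q) (at q)" if "0 < q" for n q
    unfolding Mq_def
    by (rule DERIV_laplace_moment[OF X Xnn intX _ that])
       (assumption, simp only: right_diff_distrib, intro Bochner_Integration.integral_diff[symmetric] intX)
  have DK: "(Kq (Suc n) has_real_derivative - Kq (Suc (Suc n)) q) (at q)" if "0 < q" for n q
    unfolding Kq_def
    by (rule DERIV_laplace_moment[OF f fnn intf _ that])
       (assumption, simp only: right_diff_distrib, intro Bochner_Integration.integral_diff[symmetric] intf)
  have D\<psi>: "((\<lambda>q. - \<psi> q) has_real_derivative - Kq (Suc 0) q) (at q)" if "0 < q" for q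
    unfolding Kq_def
  proof (rule DERIV_laplace_moment[OF f fnn intf _ that])
    fix p p' :: real assume "0 < p" "0 < p'"
    then show "- \<psi> p' - - \<psi> p = (\<integral>x. f x ^ 0 * (exp (- p' * f x) - exp (- p * f x)) \<partial>\<Theta>)"
      using Bochner_Integration.integral_diff[OF int int, of p p'] by (simp add: \<psi>_def)
  qed
  have M0: "Mq 0 q = exp (- \<psi> q)" if "0 < q" for q
    using laplace[OF that] by (simp add: Mq_def \<psi>_def)
  \<comment> \<open>The case 0 differentiates E exp(- q X) = exp(- \<psi> q). Each further case
    differentiates the previous identity by the product rule, and Pascal's rule merges the two
    sums.\<close>
  have rec: "Mq (Suc n) q = (\<Sum>k\<le>n. real (n choose k) * Kq (Suc k) q * Mq (n - k) q)" if "0 < q" for n q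
    using that
  proof (induction n arbitrary: q)
    case 0
    have "((\<lambda>q. exp (- \<psi> q)) has_real_derivative exp (- \<psi> q) * - Kq (Suc 0) q) (at q)"
      by (rule DERIV_chain2[OF DERIV_exp D\<psi>[OF 0]])
    then have "(Mq 0 has_real_derivative exp (- \<psi> q) * - Kq (Suc 0) q) (at q)"
      by (rule has_field_derivative_transform_within_open[where S="{0<..}"]) (use 0 M0 in auto)
    from DERIV_unique[OF this DM[OF 0]] show ?case using M0[OF 0] by (simp add: mult.commute)
  next
    case (Suc n)
    let ?D = "\<Sum>k\<le>n. real (n choose k) * (- Kq (Suc (Suc k)) q * Mq (n - k) q + - Mq (Suc (n - k)) q * Kq (Suc k) q)"
    have "((\<lambda>q. \<Sum>k\<le>n. real (n choose k) * (Kq (Suc k) q * Mq (n - k) q)) has_real_derivative ?D) (at q)"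
      by (intro DERIV_sum DERIV_cmult DERIV_mult DM DK Suc.prems)
    then have "(Mq (Suc n) has_real_derivative ?D) (at q)"
      by (rule has_field_derivative_transform_within_open[where S="{0<..}"]) (use Suc in \<open>auto simp: mult.assoc\<close>)
    from DERIV_unique[OF this DM[OF Suc.prems]] have "Mq (Suc (Suc n)) q = - ?D" by linarith
    also have "- ?D = (\<Sum>k\<le>n. real (n choose k) * Kq (Suc (Suc k)) q * Mq (n - k) q) +
        (\<Sum>k\<le>n. real (n choose k) * Kq (Suc k) q * Mq (Suc n - k) q)"
      unfolding sum.distrib[symmetric] sum_negf[symmetric]
      by (rule sum.cong) (auto simp: Suc_diff_le algebra_simps)
    \<comment> \<open>The term added at k = Suc n has coefficient \<open>n choose Suc n\<close>,
      which is 0.\<close>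
    also have "(\<Sum>k\<le>n. real (n choose k) * Kq (Suc k) q * Mq (Suc n - k) q) =
        (\<Sum>k\<le>Suc n. real (n choose k) * Kq (Suc k) q * Mq (Suc n - k) q)"
      by simp
    also have "\<dots> = Kq (Suc 0) q * Mq (Suc n) q + (\<Sum>k\<le>n. real (n choose Suc k) * Kq (Suc (Suc k)) q * Mq (n - k) q)"
      by (subst sum.atMost_Suc_shift) simp
    finally show ?case
      by (subst sum.atMost_Suc_shift) (simp add: sum.distrib[symmetric] algebra_simps)
  qed
  let ?q = "\<lambda>m. 1 / real (Suc m)"
  note limM = laplace_moment_LIMSEQ[OF X Xnn intX, folded Mq_def]
  note limK = laplace_moment_LIMSEQ[OF f fnn intf, folded Kq_def]
  have Mnn: "0 \<le> Mq n q" and Knn: "0 \<le> Kq n q" for n q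
    unfolding Mq_def Kq_def using Xnn fnn by (auto intro!: integral_nonneg_AE)
  have "(\<lambda>m. \<Sum>k\<le>n. of_nat (n choose k) * (ennreal (Kq (Suc k) (?q m)) * ennreal (Mq (n - k) (?q m)))) \<longlonglongrightarrow>
      (\<Sum>k\<le>n. of_nat (n choose k) * ((\<integral>\<^sup>+x. ennreal (f x) ^ Suc k \<partial>\<Theta>) * (\<integral>\<^sup>+x. ennreal (X x) ^ (n - k) \<partial>g)))"
    by (intro tendsto_sum ennreal_tendsto_cmult incseq_mult_LIMSEQ_ennreal limM limK) (simp add: of_nat_less_top)
  moreover have "(\<Sum>k\<le>n. of_nat (n choose k) * (ennreal (Kq (Suc k) (?q m)) * ennreal (Mq (n - k) (?q m)))) =
      ennreal (Mq (Suc n) (?q m))" for m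
    by (subst rec) (simp_all add: Mnn Knn ennreal_mult[symmetric] ennreal_of_nat_eq_real_of_nat mult.assoc del: of_nat_Suc)
  ultimately show ?thesis
    using LIMSEQ_unique[OF limM(2)[of "Suc n"]] by (simp add: mult.assoc del: of_nat_Suc power_Suc)
qed

section \<open>The moment formula\<close>

text \<open>Substitution u = exp(- c s), under which du / u becomes c ds. It is carried out with x =
  - s on compact intervals and extended to \<open>{0<..1}\<close> by monotone convergence.\<close>

lemma nn_integral_exp_substitution:
  fixes F :: "real \<Rightarrow> real"
  assumes F [measurable]: "F \<in> borel_measurable borel" and c: "0 < c"
  shows "(\<integral>\<^sup>+u\<in>{0<..1}. ennreal (1 / u * F (- (ln u / c))) \<partial>lborel) = ennreal c * (\<integral>\<^sup>+s\<in>{0..}. ennreal (F s) \<partial>lborel)"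
proof (rule LIMSEQ_unique)
  let ?f = "\<lambda>u. 1 / u * F (- (ln u / c))"
  let ?I = "\<lambda>k. indicator {exp (c * - real k)..exp (c * 0)}"
  let ?A = "\<lambda>k. \<integral>\<^sup>+u. ennreal (?f u) * ?I k u \<partial>lborel"
  show "?A \<longlonglongrightarrow> (\<integral>\<^sup>+u\<in>{0<..1}. ennreal (?f u) \<partial>lborel)"
  proof (rule nn_integral_LIMSEQ)
    show "incseq (\<lambda>k u. ennreal (?f u) * ?I k u)"
      using c by (auto simp: incseq_def le_fun_def indicator_def intro: order_trans[rotated])
    fix u :: real
    have "eventually (\<lambda>k. exp (c * - real k) < u) sequentially" if "0 < u"
    proof -
      have "(\<lambda>k. exp (c * - real k)) \<longlonglongrightarrow> 0" using c by real_asymp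
      then show ?thesis using that by (rule order_tendstoD(2))
    qed
    then have "eventually (\<lambda>k. ennreal (?f u) * ?I k u = ennreal (?f u) * indicator {0<..1} u) sequentially"
    proof (cases "0 < u")
      case True
      then have "eventually (\<lambda>k. exp (c * - real k) < u) sequentially"
        using \<open>0 < u \<Longrightarrow> eventually (\<lambda>k. exp (c * - real k) < u) sequentially\<close> by blast
      then show ?thesis by eventually_elim (use True in \<open>auto simp: indicator_def\<close>)
    next
      case False
      have "\<not> exp (c * - real k) \<le> u" for k using False exp_gt_zero[of "c * - real k"] by linarith
      then show ?thesis using False by (auto simp: indicator_def)
    qed
    then show "(\<lambda>k. ennreal (?f u) * ?I k u) \<longlonglongrightarrow> ennreal (?f u) * indicator {0<..1} u"
      by (rule tendsto_eventually)
  qed measurable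
  have A: "?A k = ennreal c * (\<integral>\<^sup>+s. ennreal (F s) * indicator {0..real k} s \<partial>lborel)" for k
  proof -
    have "?A k = (\<integral>\<^sup>+x. ennreal (?f (exp (c * x)) * (c * exp (c * x))) * indicator {- real k..0} x \<partial>lborel)"
      unfolding nn_integral_set_ennreal
    proof (rule nn_integral_substitution[where g="\<lambda>x. exp (c * x)" and g'="\<lambda>x. c * exp (c * x)"])
      show "set_borel_measurable borel {exp (c * - real k)..exp (c * 0)} ?f"
        unfolding set_borel_measurable_def by measurable
      show "((\<lambda>x. exp (c * x)) has_real_derivative c * exp (c * x)) (at x)" for x
        by (auto intro!: derivative_eq_intros)
      show "continuous_on {- real k..0} (\<lambda>x. c * exp (c * x))" by (intro continuous_intros)
    qed (use c in auto)
    also have "\<dots> = (\<integral>\<^sup>+x. ennreal c * (ennreal (F (- x)) * indicator {- real k..0} x) \<partial>lborel)"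
    proof (rule nn_integral_cong)
      fix x
      have "?f (exp (c * x)) * (c * exp (c * x)) = c * F (- x)" using c by simp
      then show "ennreal (?f (exp (c * x)) * (c * exp (c * x))) * indicator {- real k..0} x =
          ennreal c * (ennreal (F (- x)) * indicator {- real k..0} x)"
        using c by (simp only: ennreal_mult' less_imp_le mult.assoc)
    qed
    also have "\<dots> = ennreal c * (\<integral>\<^sup>+x. ennreal (F (- x)) * indicator {- real k..0} x \<partial>lborel)"
      by (rule nn_integral_cmult) measurable
    also have "(\<integral>\<^sup>+x. ennreal (F (- x)) * indicator {- real k..0} x \<partial>lborel) =
        (\<integral>\<^sup>+x. ennreal (F (- (0 + (-1) * x))) * indicator {- real k..0} (0 + (-1) * x) \<partial>lborel)"
      by (subst nn_integral_real_affine[where c="-1" and t=0]) simp_all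
    also have "\<dots> = (\<integral>\<^sup>+s. ennreal (F s) * indicator {0..real k} s \<partial>lborel)"
      by (intro nn_integral_cong) (auto simp: indicator_def)
    finally show ?thesis .
  qed
  have "(\<lambda>k. \<integral>\<^sup>+s. ennreal (F s) * indicator {0..real k} s \<partial>lborel) \<longlonglongrightarrow> (\<integral>\<^sup>+s\<in>{0..}. ennreal (F s) \<partial>lborel)"
  proof (rule nn_integral_LIMSEQ)
    show "incseq (\<lambda>k s. ennreal (F s) * indicator {0..real k} s)"
      by (auto simp: incseq_def le_fun_def indicator_def)
    fix s :: real
    have "eventually (\<lambda>k. s \<le> real k) sequentially"
      using filterlim_real_sequentially by (simp add: filterlim_at_top)
    then have "eventually (\<lambda>k. ennreal (F s) * indicator {0..real k} s = ennreal (F s) * indicator {0..} s) sequentially"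
      by eventually_elim (auto simp: indicator_def)
    then show "(\<lambda>k. ennreal (F s) * indicator {0..real k} s) \<longlonglongrightarrow> ennreal (F s) * indicator {0..} s"
      by (rule tendsto_eventually)
  qed measurable
  then show "?A \<longlonglongrightarrow> ennreal c * (\<integral>\<^sup>+s\<in>{0..}. ennreal (F s) \<partial>lborel)"
    unfolding A by (intro ennreal_tendsto_cmult) auto
qed

context metzler_shot_noise
begin

lemma response_measurable [measurable]: "(\<lambda>s. response s $ i) \<in> borel_measurable borel"
proof (rule borel_measurable_continuous_onI)
  show "continuous_on UNIV (\<lambda>s. response s $ i)"
    unfolding response_nth by (intro continuous_intros continuous_on_flow)
qed

text \<open>\<open>moment_recursion\<close> is applied to the intensity measure \<Theta> of the
  pairs of time and mark and to f(s, \<omega>) = h(s) P_1(\<omega>): the moments of f under \<Theta>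
  are the cumulants of the coordinate, and they factor into the rate, a mark moment and a time
  integral.\<close>

theorem invariant_moment:
  assumes inv: "invariant_distribution \<Omega> (shot_noise_process A v N P) positive_orthant g" and "1 \<le> n"
  shows "(\<integral>\<^sup>+x. ennreal (x $ i) ^ n \<partial>g) =
    (\<Sum>k = 1..n. bell_poly n k (\<lambda>j. ennreal lam * (\<integral>\<^sup>+\<omega>. ennreal (P 1 \<omega>) ^ j \<partial>\<Omega>) *
      (\<integral>\<^sup>+s\<in>{0..}. ennreal (response s $ i) ^ j \<partial>lborel)))"
proof -
  let ?p = "\<lambda>j. \<integral>\<^sup>+\<omega>. ennreal (P 1 \<omega>) ^ j \<partial>\<Omega>" and ?h = "\<lambda>j. \<integral>\<^sup>+s\<in>{0..}. ennreal (response s $ i) ^ j \<partial>lborel"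
  have [measurable]: "P 1 \<in> borel_measurable \<Omega>" by simp
  have g: "prob_space g" "sets g = sets borel" "AE x in g. x \<in> positive_orthant"
    using inv unfolding invariant_distribution_iff by auto
  let ?t = "\<lambda>q. total_exponent (\<lambda>s. q * response s $ i)"
  interpret g: prob_space g by (rule g(1))
  note [measurable_cong] = g(2)
  define \<Theta> where "\<Theta> = density (lborel \<Otimes>\<^sub>M \<Omega>) (\<lambda>(s, \<omega>). ennreal lam * indicator {0::real..} s)"
  \<comment> \<open>Truncation at 0, here and in X, gives the nonnegativity everywhere that
    \<open>moment_recursion\<close> asks for; it changes values only on null sets of \<Theta> and
    g.\<close>
  define f where "f = (\<lambda>(s, \<omega>). max 0 (response s $ i * P 1 \<omega>))"
  define X where "X x = max 0 (x $ i)" for x :: "real^'n"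
  have f: "f \<in> borel_measurable \<Theta>" unfolding f_def \<Theta>_def by measurable
  have f' [measurable]: "f \<in> borel_measurable (lborel \<Otimes>\<^sub>M \<Omega>)" unfolding f_def by measurable
  have X: "X \<in> borel_measurable g" unfolding X_def by measurable
  have nn\<Theta>: "(\<integral>\<^sup>+z. \<phi> z \<partial>\<Theta>) = ennreal lam * (\<integral>\<^sup>+s\<in>{0..}. (\<integral>\<^sup>+\<omega>. \<phi> (s, \<omega>) \<partial>\<Omega>) \<partial>lborel)"
    if [measurable]: "\<phi> \<in> borel_measurable (lborel \<Otimes>\<^sub>M \<Omega>)" for \<phi>
  proof -
    have "(\<integral>\<^sup>+z. \<phi> z \<partial>\<Theta>) = (\<integral>\<^sup>+z. (ennreal lam * indicator {0..} (fst z)) * \<phi> z \<partial>(lborel \<Otimes>\<^sub>M \<Omega>))"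
      unfolding \<Theta>_def by (subst nn_integral_density) (simp_all add: case_prod_beta')
    also have "\<dots> = (\<integral>\<^sup>+s. \<integral>\<^sup>+\<omega>. (ennreal lam * indicator {0..} s) * \<phi> (s, \<omega>) \<partial>\<Omega> \<partial>lborel)"
      by (subst nn_integral_fst[symmetric]) simp_all
    also have "\<dots> = (\<integral>\<^sup>+s. ennreal lam * ((\<integral>\<^sup>+\<omega>. \<phi> (s, \<omega>) \<partial>\<Omega>) * indicator {0..} s) \<partial>lborel)"
      by (intro nn_integral_cong, subst nn_integral_cmult) (simp_all add: mult_ac)
    also have "\<dots> = ennreal lam * (\<integral>\<^sup>+s\<in>{0..}. (\<integral>\<^sup>+\<omega>. \<phi> (s, \<omega>) \<partial>\<Omega>) \<partial>lborel)"
      by (rule nn_integral_cmult) measurable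
    finally show ?thesis .
  qed
  have exponent: "has_bochner_integral \<Theta> (\<lambda>z. 1 - exp (- q * f z)) (lam * ?t q)"
    if q: "0 < q" for q
  proof (rule has_bochner_integral_nn_integral)
    have ker: "decaying_kernel (\<lambda>s. q * response s $ i)"
      using q by (intro decaying_kernel_scale decaying_kernel_response_nth) simp
    have nonneg: "0 \<le> indicator {0..} s *\<^sub>R mark_exponent (q * response s $ i)" for s
      using q response_nonneg by (auto simp: indicator_def intro!: mark_exponent_bounds mult_nonneg_nonneg)
    show "0 \<le> lam * ?t q"
      using lam_pos nonneg unfolding total_exponent_def set_lebesgue_integral_def
      by (intro mult_nonneg_nonneg integral_nonneg_AE) auto
    show "AE z in \<Theta>. 0 \<le> 1 - exp (- q * f z)" using q by (auto simp: f_def)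
    show "(\<lambda>z. 1 - exp (- q * f z)) \<in> borel_measurable \<Theta>" using f by measurable
    have "(\<integral>\<^sup>+z. ennreal (1 - exp (- q * f z)) \<partial>\<Theta>) =
        ennreal lam * (\<integral>\<^sup>+s\<in>{0..}. (\<integral>\<^sup>+\<omega>. ennreal (1 - exp (- q * f (s, \<omega>))) \<partial>\<Omega>) \<partial>lborel)"
      by (rule nn\<Theta>) measurable
    also have "(\<integral>\<^sup>+s\<in>{0..}. (\<integral>\<^sup>+\<omega>. ennreal (1 - exp (- q * f (s, \<omega>))) \<partial>\<Omega>) \<partial>lborel) =
        (\<integral>\<^sup>+s. ennreal (indicator {0..} s *\<^sub>R mark_exponent (q * response s $ i)) \<partial>lborel)"
    proof (rule nn_integral_cong)
      fix s :: real
      have "(\<integral>\<^sup>+\<omega>. ennreal (1 - exp (- q * f (s, \<omega>))) \<partial>\<Omega>) = ennreal (mark_exponent (q * response s $ i))" if s: "0 \<le> s"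
      proof -
        have "(\<integral>\<^sup>+\<omega>. ennreal (1 - exp (- q * f (s, \<omega>))) \<partial>\<Omega>) = (\<integral>\<^sup>+\<omega>. ennreal (1 - exp (- (q * response s $ i) * P 1 \<omega>)) \<partial>\<Omega>)"
        proof (rule nn_integral_cong_AE)
          show "AE \<omega> in \<Omega>. ennreal (1 - exp (- q * f (s, \<omega>))) = ennreal (1 - exp (- (q * response s $ i) * P 1 \<omega>))"
            using marks_pos[OF order_refl]
            by eventually_elim (use response_nonneg[OF s] in \<open>simp add: f_def max_absorb2 mult.assoc\<close>)
        qed
        also have "\<dots> = ennreal (mark_exponent (q * response s $ i))"
          using q response_nonneg[OF s] by (intro nn_integral_mark_exponent) simp
        finally show ?thesis .
      qed
      then show "(\<integral>\<^sup>+\<omega>. ennreal (1 - exp (- q * f (s, \<omega>))) \<partial>\<Omega>) * indicator {0..} s =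
          ennreal (indicator {0..} s *\<^sub>R mark_exponent (q * response s $ i))"
        by (simp add: indicator_def)
    qed
    also have "\<dots> = ennreal (?t q)"
      unfolding total_exponent_def set_lebesgue_integral_def
      using integrable_mark_exponent_kernel[OF log_moment ker] nonneg
      by (intro nn_integral_eq_integral) (auto simp: set_integrable_def)
    also have "ennreal lam * \<dots> = ennreal (lam * ?t q)"
      using lam_pos by (intro ennreal_mult'[symmetric]) simp
    finally show "(\<integral>\<^sup>+z. ennreal (1 - exp (- q * f z)) \<partial>\<Theta>) = ennreal (lam * ?t q)" .
  qed
  have laplace: "(\<integral>x. exp (- q * X x) \<partial>g) = exp (- (\<integral>z. 1 - exp (- q * f z) \<partial>\<Theta>))" if q: "0 < q" for q
  proof -
    have "\<forall>j. 0 \<le> (axis i q :: real^'n) $ j" using q by (simp add: axis_def)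
    from laplace_invariant[OF inv this]
    have L: "(\<integral>\<^sup>+x. ennreal (exp (- (q * x $ i))) \<partial>g) = ennreal (exp (- lam * ?t q))"
      by (simp add: inner_axis')
    have "(\<integral>x. exp (- q * X x) \<partial>g) = enn2real (\<integral>\<^sup>+x. ennreal (exp (- q * X x)) \<partial>g)"
      using X by (intro integral_eq_nn_integral) auto
    also have "(\<integral>\<^sup>+x. ennreal (exp (- q * X x)) \<partial>g) = (\<integral>\<^sup>+x. ennreal (exp (- (q * x $ i))) \<partial>g)"
      using g(3) by (intro nn_integral_cong_AE, elim eventually_mono)
        (simp add: X_def positive_orthant_def max_absorb2 less_imp_le)
    finally show ?thesis
      using has_bochner_integral_integral_eq[OF exponent[OF q]] by (simp add: L)
  qed
  have rec: "(\<integral>\<^sup>+x. ennreal (X x) ^ Suc m \<partial>g) =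
    (\<Sum>k\<le>m. of_nat (m choose k) * (\<integral>\<^sup>+z. ennreal (f z) ^ Suc k \<partial>\<Theta>) * (\<integral>\<^sup>+x. ennreal (X x) ^ (m - k) \<partial>g))" for m
  proof (rule moment_recursion[OF g(1) X _ f])
    show "integrable \<Theta> (\<lambda>z. 1 - exp (- q * f z))" if "0 < q" for q
      using exponent[OF that] by (rule integrable.intros)
    show "(\<integral>x. exp (- q * X x) \<partial>g) = exp (- (\<integral>z. 1 - exp (- q * f z) \<partial>\<Theta>))" if "0 < q" for q
      by (rule laplace[OF that])
  qed (auto simp: X_def f_def)
  have "(\<integral>\<^sup>+x. ennreal (x $ i) ^ n \<partial>g) = (\<integral>\<^sup>+x. ennreal (X x) ^ n \<partial>g)"
    using g(3) by (intro nn_integral_cong_AE, elim eventually_mono) (simp add: X_def)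
  also have "\<dots> = (\<Sum>k = 1..n. bell_poly n k (\<lambda>j. \<integral>\<^sup>+z. ennreal (f z) ^ j \<partial>\<Theta>))"
    by (rule moment_eq_sum_bell_poly[where M="\<lambda>n. \<integral>\<^sup>+x. ennreal (X x) ^ n \<partial>g", OF _ rec \<open>1 \<le> n\<close>])
       (simp add: g.emeasure_space_1)
  also have "(\<lambda>j. \<integral>\<^sup>+z. ennreal (f z) ^ j \<partial>\<Theta>) = (\<lambda>j. ennreal lam * ?p j *
      ?h j)"
  proof
    fix j
    have "(\<integral>\<^sup>+z. ennreal (f z) ^ j \<partial>\<Theta>) = ennreal lam * (\<integral>\<^sup>+s\<in>{0..}. (\<integral>\<^sup>+\<omega>. ennreal (f (s, \<omega>)) ^ j \<partial>\<Omega>) \<partial>lborel)"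
      by (rule nn\<Theta>) measurable
    also have "(\<integral>\<^sup>+s\<in>{0..}. (\<integral>\<^sup>+\<omega>. ennreal (f (s, \<omega>)) ^ j \<partial>\<Omega>) \<partial>lborel) =
        (\<integral>\<^sup>+s. ?p j * (ennreal (response s $ i) ^ j * indicator {0..} s) \<partial>lborel)"
    proof (rule nn_integral_cong)
      fix s :: real
      have "(\<integral>\<^sup>+\<omega>. ennreal (f (s, \<omega>)) ^ j \<partial>\<Omega>) = ennreal (response s $ i) ^ j * ?p j" if "0 \<le> s"
      proof -
        have "ennreal (f (s, \<omega>)) ^ j = ennreal (response s $ i) ^ j * ennreal (P 1 \<omega>) ^ j" for \<omega>
          using response_nonneg[OF that, of i] by (simp add: f_def ennreal_mult' power_mult_distrib)
        then show ?thesis by (simp add: nn_integral_cmult)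
      qed
      then show "(\<integral>\<^sup>+\<omega>. ennreal (f (s, \<omega>)) ^ j \<partial>\<Omega>) * indicator {0..} s =
          ?p j * (ennreal (response s $ i) ^ j * indicator {0..} s)"
        by (simp add: indicator_def mult_ac)
    qed
    also have "\<dots> = ?p j * ?h j"
      by (rule nn_integral_cmult) measurable
    finally show "(\<integral>\<^sup>+z. ennreal (f z) ^ j \<partial>\<Theta>) = ennreal lam * ?p j *
      ?h j" by (simp add: mult.assoc)
  qed
  finally show ?thesis .
qed

end

theorem proposition5p1:
  fixes r :: "'e::finite" and trib :: "'e \<Rightarrow> 'e set"
    and K H a :: "'e \<Rightarrow> real" and lam :: real
    and \<Omega> :: "'w measure" and N :: "real \<Rightarrow> 'w \<Rightarrow> nat" and P :: "nat \<Rightarrow> 'w \<Rightarrow> real"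
    and f_P :: "real \<Rightarrow> real"
  assumes "river_tree r trib"
    and "\<And>e. 0 < K e" and "\<And>e. 0 < H e" and "\<And>e. 0 < a e"
    and "0 < lam"
    and "prob_space \<Omega>"
    and "poisson_process \<Omega> lam N"
    and "prob_space.indep_vars \<Omega> (\<lambda>_. borel) P {1..}"
    and "\<And>n. 1 \<le> n \<Longrightarrow> distributed \<Omega> lborel (P n) (\<lambda>x. ennreal (f_P x))"
    and "\<And>x. 0 \<le> f_P x" and "\<And>x. x \<le> 0 \<Longrightarrow> f_P x = 0"
    and "prob_space.indep_set \<Omega>
           (sigma_generated \<Omega> {0..} N (count_space UNIV)) (sigma_generated \<Omega> {1..} P borel)"
    and "(\<integral>\<^sup>+\<omega>. ennreal (max (ln (P 1 \<omega>)) 0) \<partial>\<Omega>) < \<infinity>"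
  shows "(\<exists>!g. invariant_distribution \<Omega> (network_process trib K H a N P) positive_orthant g) \<and>
    (\<forall>g. invariant_distribution \<Omega> (network_process trib K H a N P) positive_orthant g \<longrightarrow>
      (\<forall>n\<ge>1.
        (\<integral>\<^sup>+x. ennreal (x $ Inl r) ^ n \<partial>g) =
        ennreal ((\<Sum>e\<in>UNIV. a e) * K r) ^ n *
        (\<Sum>k = 1..n. ennreal (lam / H r) ^ k *
          bell_poly n k (\<lambda>i. (\<integral>\<^sup>+\<omega>. ennreal (P 1 \<omega>) ^ i \<partial>\<Omega>) *
                             c_coeff r trib K H a (real i)))))"
proof -
  interpret \<Omega>: prob_space \<Omega> by fact
  obtain y d where y: "\<And>i. 0 < y i" and d: "0 < d"
    and yd: "\<And>j. (\<Sum>i\<in>UNIV. y i * system_matrix trib K H $ i $ j) \<le> - d * y j"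
    using system_matrix_dissipative[of r trib K H] assms(1-3) by blast
  have law: "distr \<Omega> borel (P n) = density lborel (\<lambda>x. ennreal (f_P x))" if "1 \<le> n" for n
    using assms(9)[OF that] by (simp add: distributed_def cong: distr_cong)
  interpret metzler_shot_noise \<Omega> N P lam "system_matrix trib K H" "input_vector H a" y d
  proof
    fix n :: nat assume n: "1 \<le> n"
    show "distr \<Omega> borel (P n) = distr \<Omega> borel (P 1)" using law[OF n] law[of 1] by simp
    have Pn: "P n \<in> measurable \<Omega> lborel" and f: "(\<lambda>x. ennreal (f_P x)) \<in> borel_measurable lborel"
      using assms(9)[OF n] by (auto simp: distributed_def)
    have "AE x in density lborel (\<lambda>x. ennreal (f_P x)). 0 < x"
      using f assms(11) by (subst AE_density) (auto simp: not_le[symmetric])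
    then have "AE x in distr \<Omega> borel (P n). 0 < x" unfolding law[OF n] .
    then show "AE \<omega> in \<Omega>. 0 < P n \<omega>" using Pn by (intro AE_distrD[of "P n" \<Omega> borel]) auto
  next
    fix i :: "'e + 'e"
    show "0 \<le> input_vector H a $ i"
      using assms(3,4) by (cases i) (auto intro: less_imp_le)
    show "0 < input_vector H a $ i \<or> 0 < (system_matrix trib K H *v input_vector H a) $ i"
      by (rule system_matrix_input_pos) (use assms in auto)
  qed (fact assms y d yd metzler_system_matrix[OF assms(2)])+
  let ?inv = "invariant_distribution \<Omega> (network_process trib K H a N P) positive_orthant"
  \<comment> \<open>The bracket in the coefficients is the response of Q_r divided by this
    constant.\<close>
  define b where "b = (\<Sum>e\<in>UNIV. a e) * K r"
  have b: "0 < b" using assms(2,4) by (simp add: b_def sum_pos)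
  let ?c = "\<lambda>i. c_coeff r trib K H a (real i)"
  let ?I = "\<lambda>i. \<integral>\<^sup>+s\<in>{0..}. ennreal ((response s $ Inl r / b) ^ i) \<partial>lborel"
  have Hr: "0 < H r" by (rule assms(3))
  have c: "?c i =
      ennreal (H r) * ?I i" if i: "1 \<le> i" for i
  proof -
    have "(\<Sum>e\<in>UNIV. H e / K r * (a e / (\<Sum>e'\<in>UNIV. a e')) * m_root r trib K H u $ e) =
        response (- (ln u / H r)) $ Inl r / b" for u
    proof -
      have "(\<Sum>e\<in>UNIV. H e / K r * (a e / (\<Sum>e'\<in>UNIV. a e')) * m_root r trib K H u $ e) =
          (\<Sum>e\<in>UNIV. H e * a e * m_root r trib K H u $ e) / b"
        by (simp add: b_def sum_divide_distrib mult_ac)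
      then show ?thesis by (simp only: m_root_sum response_def flow_def)
    qed
    moreover have "0 \<le> response (- (ln u / H r)) $ Inl r / b" if "u \<in> {0<..1}" for u
    proof -
      have "ln u \<le> 0" using that by simp
      then show ?thesis using Hr b by (intro divide_nonneg_pos response_nonneg) (auto simp: divide_nonpos_pos)
    qed
    \<comment> \<open>At x = 0 this relies on i \<ge> 1, since 0 powr 0 = 0 but 0 ^ 0 = 1.\<close>
    moreover have "x powr real i = x ^ i" if "0 \<le> x" for x :: real
      using powr_realpow'[of x i] i that by simp
    ultimately have "?c i =
        (\<integral>\<^sup>+u\<in>{0<..1}. ennreal (1 / u * (response (- (ln u / H r)) $ Inl r / b) ^ i) \<partial>lborel)"
      unfolding c_coeff_def by (intro nn_integral_cong) (simp add: indicator_def)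
    also have "\<dots> = ennreal (H r) * ?I i"
      by (rule nn_integral_exp_substitution[OF _ Hr]) measurable
    finally show ?thesis .
  qed
  have cumulant: "ennreal lam * M * (\<integral>\<^sup>+s\<in>{0..}. ennreal (response s $ Inl r) ^ i \<partial>lborel) =
      ennreal b ^ i * ennreal (lam / H r) * (M * ?c i)" if i: "1 \<le> i" for i M
  proof -
    have "(\<integral>\<^sup>+s\<in>{0..}. ennreal (response s $ Inl r) ^ i \<partial>lborel) =
        (\<integral>\<^sup>+s. ennreal b ^ i * (ennreal ((response s $ Inl r / b) ^ i) * indicator {0..} s) \<partial>lborel)"
    proof (rule nn_integral_cong)
      fix s :: real
      have "ennreal (response s $ Inl r) ^ i = ennreal b ^ i * ennreal ((response s $ Inl r / b) ^ i)" if "0 \<le> s"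
        using b response_nonneg[OF that, of "Inl r"]
        by (simp add: ennreal_power ennreal_mult[symmetric] power_divide)
      then show "ennreal (response s $ Inl r) ^ i * indicator {0..} s =
          ennreal b ^ i * (ennreal ((response s $ Inl r / b) ^ i) * indicator {0..} s)"
        by (simp add: indicator_def)
    qed
    also have "\<dots> = ennreal b ^ i * ?I i"
      by (rule nn_integral_cmult) measurable
    finally have I: "(\<integral>\<^sup>+s\<in>{0..}. ennreal (response s $ Inl r) ^ i \<partial>lborel) =
      ennreal b ^ i * ?I i" .
    \<comment> \<open>The change of variables in the coefficient produces a factor H_r, which is
      taken out of the rate; the scaling by b and by the remaining rate is pulled out of the Bell
      polynomials by homogeneity.\<close>
    have "ennreal lam = ennreal (lam / H r) * ennreal (H r)"
      using Hr assms(5) by (simp add: ennreal_mult[symmetric])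
    then show ?thesis unfolding I c[OF i] by (simp add: mult_ac)
  qed
  have moment: "(\<integral>\<^sup>+x. ennreal (x $ Inl r) ^ n \<partial>g) =
      ennreal b ^ n * (\<Sum>k = 1..n. ennreal (lam / H r) ^ k *
        bell_poly n k (\<lambda>i. (\<integral>\<^sup>+\<omega>. ennreal (P 1 \<omega>) ^ i \<partial>\<Omega>) * ?c i))"
    if g: "?inv g" and n: "1 \<le> n" for g n
  proof -
    let ?\<kappa> = "\<lambda>i. (\<integral>\<^sup>+\<omega>. ennreal (P 1 \<omega>) ^ i \<partial>\<Omega>) * ?c i"
    have "(\<integral>\<^sup>+x. ennreal (x $ Inl r) ^ n \<partial>g) =
        (\<Sum>k = 1..n. bell_poly n k (\<lambda>i. ennreal lam * (\<integral>\<^sup>+\<omega>. ennreal (P 1 \<omega>) ^ i \<partial>\<Omega>) *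
          (\<integral>\<^sup>+s\<in>{0..}. ennreal (response s $ Inl r) ^ i \<partial>lborel)))"
      using g n unfolding network_process_def by (rule invariant_moment)
    also have "\<dots> = (\<Sum>k = 1..n. bell_poly n k (\<lambda>i. ennreal b ^ i * ennreal (lam / H r) * ?\<kappa> i))"
      by (intro sum.cong refl bell_poly_cong cumulant) simp
    also have "\<dots> = ennreal b ^ n * (\<Sum>k = 1..n. ennreal (lam / H r) ^ k * bell_poly n k ?\<kappa>)"
      unfolding bell_poly_homogeneous by (simp only: sum_distrib_left mult.assoc)
    finally show ?thesis .
  qed
  have "\<exists>!g. ?inv g" using ex1_invariant_distribution unfolding network_process_def .
  then show ?thesis using moment unfolding b_def by blast
qed

end
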